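(* Let $s\in(0,1)$, $m>0$, $\alpha\in(0,3)$. Suppose $A:\mathbb{R}^3\to\mathbb{R}^3$ is a linear vector field of the form $A(x)=Ax$, $x\in\mathbb{R}^3$, where (on the right) $A$ is a $3\times3$ real symmetric constant matrix. If $p\in\left(1+\frac{\alpha}{3},\frac{3+\alpha}{3-2s}\right)$, then $$\tau_A:=\inf_{u\in H^s_A(\mathbb{R}^3,\mathbb{C})\setminus\{0\}}\frac{\|u\|_{A,s}^2}{\mathcal{D}(u)^{1/p}}$$ is attained on $H^s_A(\mathbb{R}^3,\mathbb{C})$, i.e. there is $u\in H^s_A(\mathbb{R}^3,\mathbb{C})\setminus\{0\}$ with $\|u\|_{A,s}^2/\mathcal{D}(u)^{1/p}=\tau_A$.
   Context: $C_s:=\dfrac{s\,2^{\frac{2s-1}{2}}}{\pi^{3/2}\,\Gamma(1-s)}$, where $\Gamma$ is the Gamma function. $\mathcal{K}_\nu$ is the modified Bessel function (also called MacDonald function) of order $\nu$: $\mathcal{K}_\nu(\zeta)=\frac12\left(\frac{\zeta}{2}\right)^\nu\int_0^{+\infty}e^{-\frac{\zeta^2}{4t}-t}t^{-1-\nu}\,dt$ for $\zeta>0$. For measurable $u,v:\mathbb{R}^3\to\mathbb{C}$ put $$\langle u,v\rangle_{A,s}:=\Re\int_{\mathbb{R}^3\times\mathbb{R}^3}\frac{\left(e^{-i(x-y)\cdot A\left(\frac{x+y}{2}\right)}u(x)-u(y)\right)\overline{\left(e^{-i(x-y)\cdot A\left(\frac{x+y}{2}\right)}v(x)-v(y)\right)}}{|x-y|^{\frac{3+2s}{2}}}\,\mathcal{K}_{\frac{3+2s}{2}}(m|x-y|)\,dx\,dy,$$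 $(u,v)_{A,s}:=\frac{C_s}{2}m^{\frac{3+2s}{2}}\langle u,v\rangle_{A,s}+m^{2s}\Re\int_{\mathbb{R}^3}u\overline{v}\,dx$ and $\|u\|_{A,s}:=\sqrt{(u,u)_{A,s}}$. $H^s_A(\mathbb{R}^3,\mathbb{C})$ is the closure of $C^\infty_c(\mathbb{R}^3,\mathbb{C})$ in $\mathcal{H}:=\{u:\mathbb{R}^3\to\mathbb{C}: (u,u)_{A,s}<+\infty\}$ with respect to $\|\cdot\|_{A,s}$. Moreover $\mathcal{D}(u):=\int_{\mathbb{R}^3}(I_\alpha*|u|^p)|u|^p\,dx$, where $I_\alpha(x)=\pi^{3/2}2^\alpha\frac{\Gamma(\alpha/2)}{\Gamma((3-\alpha)/2)}\frac{1}{|x|^{3-\alpha}}$ is the Riesz potential. *)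

theory Defs
  imports "HOL-Analysis.Analysis"
begin

text \<open>
  Functions on \<open>\<real>\<^sup>3\<close> are represented by honest functions \<open>real^3 \<Rightarrow> complex\<close>; identification of
  functions that agree almost everywhere is made explicit where it matters (only in ``\<open>u \<noteq> 0\<close>'').
  ``Measurable'' means Lebesgue measurable, and all integrals are Lebesgue integrals.
\<close>

fun k_times_cont_diff :: "nat \<Rightarrow> (real^3 \<Rightarrow> complex) \<Rightarrow> bool" where
  "k_times_cont_diff 0 f \<longleftrightarrow> continuous_on UNIV f"
| "k_times_cont_diff (Suc k) f \<longleftrightarrow>
     (\<forall>x. f differentiable (at x)) \<and>
     (\<forall>v. k_times_cont_diff k (\<lambda>x. frechet_derivative f (at x) v))"

definition test_functions :: "(real^3 \<Rightarrow> complex) set" where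
  "test_functions = {f. (\<forall>k. k_times_cont_diff k f) \<and> compact (closure {x. f x \<noteq> 0})}"

definition C_const :: "real \<Rightarrow> real" where
  "C_const s = s * 2 powr ((2 * s - 1) / 2) / (pi powr (3/2) * Gamma (1 - s))"

text \<open>Only used for \<open>\<zeta> > 0\<close>, where the integral converges.\<close>

definition Bessel_K :: "real \<Rightarrow> real \<Rightarrow> real" where
  "Bessel_K \<nu> \<zeta> =
     1/2 * (\<zeta> / 2) powr \<nu> *
     (LINT t:{0<..}|lebesgue. exp (- (\<zeta>\<^sup>2 / (4 * t)) - t) * t powr (- 1 - \<nu>))"

definition magnetic_phase :: "(real^3 \<Rightarrow> real^3) \<Rightarrow> real^3 \<Rightarrow> real^3 \<Rightarrow> complex" where
  "magnetic_phase A x y =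
     exp (- (\<i> * complex_of_real ((x - y) \<bullet> A ((1/2) *\<^sub>R (x + y)))))"

definition magnetic_integrand ::
  "(real^3 \<Rightarrow> real^3) \<Rightarrow> real \<Rightarrow> real \<Rightarrow> (real^3 \<Rightarrow> complex) \<Rightarrow> (real^3 \<Rightarrow> complex)
     \<Rightarrow> (real^3) \<times> (real^3) \<Rightarrow> complex" where
  "magnetic_integrand A s m u v = (\<lambda>(x, y).
     (magnetic_phase A x y * u x - u y) * cnj (magnetic_phase A x y * v x - v y)
       / complex_of_real (norm (x - y) powr ((3 + 2 * s) / 2))
       * complex_of_real (Bessel_K ((3 + 2 * s) / 2) (m * norm (x - y))))"

definition magnetic_form ::
  "(real^3 \<Rightarrow> real^3) \<Rightarrow> real \<Rightarrow> real \<Rightarrow> (real^3 \<Rightarrow> complex) \<Rightarrow> (real^3 \<Rightarrow> complex) \<Rightarrow> real" where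
  "magnetic_form A s m u v = Re (LINT z|lebesgue. magnetic_integrand A s m u v z)"

definition magnetic_inner ::
  "(real^3 \<Rightarrow> real^3) \<Rightarrow> real \<Rightarrow> real \<Rightarrow> (real^3 \<Rightarrow> complex) \<Rightarrow> (real^3 \<Rightarrow> complex) \<Rightarrow> real" where
  "magnetic_inner A s m u v =
     C_const s / 2 * m powr ((3 + 2 * s) / 2) * magnetic_form A s m u v
       + m powr (2 * s) * Re (LINT x|lebesgue. u x * cnj (v x))"

definition magnetic_norm ::
  "(real^3 \<Rightarrow> real^3) \<Rightarrow> real \<Rightarrow> real \<Rightarrow> (real^3 \<Rightarrow> complex) \<Rightarrow> real" where
  "magnetic_norm A s m u = sqrt (magnetic_inner A s m u u)"

text \<open>
  The space \<open>\<H>\<close>.  A Bochner integral is \<open>0\<close> when it diverges, so \<open>(u,u) < \<infinity>\<close> has to be spelled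
  out: both integrands are nonnegative reals and their coefficients are positive, hence
  finiteness means integrability of both.
\<close>

definition finite_energy_space ::
  "(real^3 \<Rightarrow> real^3) \<Rightarrow> real \<Rightarrow> real \<Rightarrow> (real^3 \<Rightarrow> complex) set" where
  "finite_energy_space A s m =
     {u. u \<in> borel_measurable lebesgue
       \<and> integrable lebesgue (magnetic_integrand A s m u u)
       \<and> integrable lebesgue (\<lambda>x. u x * cnj (u x))}"

text \<open>
  The space \<open>H\<^sup>s\<^sub>A\<close>: closure of the test functions in \<open>\<H>\<close> for the seminorm on representatives
  (a norm modulo almost everywhere equality).
\<close>

definition magnetic_Sobolev ::
  "(real^3 \<Rightarrow> real^3) \<Rightarrow> real \<Rightarrow> real \<Rightarrow> (real^3 \<Rightarrow> complex) set" where
  "magnetic_Sobolev A s m =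
     {u \<in> finite_energy_space A s m.
        \<forall>\<epsilon>>0. \<exists>\<phi>\<in>test_functions. magnetic_norm A s m (\<lambda>x. u x - \<phi> x) < \<epsilon>}"

definition magnetic_Sobolev_nonzero ::
  "(real^3 \<Rightarrow> real^3) \<Rightarrow> real \<Rightarrow> real \<Rightarrow> (real^3 \<Rightarrow> complex) set" where
  "magnetic_Sobolev_nonzero A s m =
     {u \<in> magnetic_Sobolev A s m. \<not> (AE x in lebesgue. u x = 0)}"

definition Riesz_potential :: "real \<Rightarrow> real^3 \<Rightarrow> real" where
  "Riesz_potential \<alpha> x =
     pi powr (3/2) * 2 powr \<alpha> * (Gamma (\<alpha> / 2) / Gamma ((3 - \<alpha>) / 2))
       * (1 / norm x powr (3 - \<alpha>))"

definition fun_convolution :: "(real^3 \<Rightarrow> real) \<Rightarrow> (real^3 \<Rightarrow> real) \<Rightarrow> real^3 \<Rightarrow> real" where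
  "fun_convolution f g x = (LINT y|lebesgue. f (x - y) * g y)"

text \<open>
  For \<open>u\<close> in \<open>H\<^sup>s\<^sub>A\<close> and \<open>p\<close> in the range considered, both integrals are finite (the convolution
  for almost every \<open>x\<close>) by the Hardy--Littlewood--Sobolev inequality and the Sobolev embedding.
\<close>

definition Choquard_energy :: "real \<Rightarrow> real \<Rightarrow> (real^3 \<Rightarrow> complex) \<Rightarrow> real" where
  "Choquard_energy \<alpha> p u =
     (LINT x|lebesgue. fun_convolution (Riesz_potential \<alpha>) (\<lambda>y. norm (u y) powr p) x
        * norm (u x) powr p)"

definition magnetic_quotient ::
  "(real^3 \<Rightarrow> real^3) \<Rightarrow> real \<Rightarrow> real \<Rightarrow> real \<Rightarrow> real \<Rightarrow> (real^3 \<Rightarrow> complex) \<Rightarrow> real" where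
  "magnetic_quotient A s m \<alpha> p u =
     (magnetic_norm A s m u)\<^sup>2 / Choquard_energy \<alpha> p u powr (1 / p)"

definition tau :: "(real^3 \<Rightarrow> real^3) \<Rightarrow> real \<Rightarrow> real \<Rightarrow> real \<Rightarrow> real \<Rightarrow> real" where
  "tau A s m \<alpha> p = (INF u\<in>magnetic_Sobolev_nonzero A s m. magnetic_quotient A s m \<alpha> p u)"

end

theory Submission
  imports Defs "HOL-Complex_Analysis.Great_Picard"
begin

text \<open>
  The matrix \<open>A\<close> is symmetric, so the field \<open>x \<mapsto> A x\<close> is the gradient of
  \<open>\<phi>(x) = (x \<bullet> A x) / 2\<close>, and \<open>(x - y) \<bullet> A ((x + y) / 2) = \<phi>(x) - \<phi>(y)\<close>. The magnetic
  phase is therefore a pure gauge: for \<open>v = exp(- \<i> \<phi>) u\<close> the form of \<open>u\<close> is the nonmagnetic form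
  of \<open>v\<close>, while \<open>\<bar>u\<bar> = \<bar>v\<bar>\<close> keeps the Choquard energy. Multiplication by the smooth unimodular
  function \<open>exp(- \<i> \<phi>)\<close> also preserves the test functions, hence their closure. The problem becomes:
  minimise \<open>N(v) / D(v)\<^sup>1\<^sup>/\<^sup>p\<close> over a closed subspace \<open>X\<close> that is invariant under translations, where
  \<open>N(v) = \<integral>\<integral> \<bar>v(x) - v(y)\<bar>\<^sup>2 J(x - y) + \<integral> \<bar>v\<bar>\<^sup>2\<close> and
  \<open>D(v) = \<integral>\<integral> I(x - y) \<bar>v(x)\<bar>\<^sup>p \<bar>v(y)\<bar>\<^sup>p\<close>.

  A minimum is found by concentration compactness. Let \<open>v\<^sub>n\<close> be a minimising sequence with
  \<open>D(v\<^sub>n) = 1\<close>.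

  \<^item> \<open>v\<^sub>n\<close> cannot spread out. If the \<open>L\<^sup>2\<close> mass in all unit balls tended to zero, then so would all
    \<open>L\<^sup>q\<close> norms with \<open>2 < q < 6 / (3 - 2 s)\<close> (lemma \<open>vanishing\<close>), and they control \<open>D\<close>
    (\<open>interaction_le\<close>). After translation a fixed amount of mass stays in the unit ball.
  \<^item> A subsequence converges almost everywhere to some \<open>v\<close> (\<open>local_compactness\<close>), \<open>v\<close> is not zero
    (\<open>local_mass_vanishes\<close>), and it lies in \<open>X\<close> (\<open>weakly_closed\<close>).
  \<^item> Both functionals split as in the Brezis--Lieb lemma: with \<open>w\<^sub>n = v\<^sub>n - v\<close>,
    \<open>N(v\<^sub>n) - N(w\<^sub>n) \<rightarrow> N(v)\<close> and \<open>D(v\<^sub>n) - D(w\<^sub>n) \<rightarrow> D(v)\<close> (\<open>energy_split\<close>, \<open>interaction_split\<close>).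
    With \<open>\<theta> = D(v)\<close> and \<open>\<tau>\<close> the infimum, this gives \<open>\<tau> \<ge> \<tau> (\<theta>\<^sup>1\<^sup>/\<^sup>p + (1 - \<theta>)\<^sup>1\<^sup>/\<^sup>p)\<close>.
    As \<open>p > 1\<close>, the bracket exceeds \<open>1\<close> for \<open>0 < \<theta> < 1\<close>. Hence \<open>\<theta> = 1\<close> and \<open>v\<close> is a minimiser.

  Two devices keep the analysis elementary. The Riesz kernel is cut at \<open>\<bar>z\<bar> = 1\<close>: since \<open>p\<close> lies
  strictly inside its range, each half has an integrable power for which a pointwise inequality replaces the
  Hardy--Littlewood--Sobolev inequality (\<open>kernel_product_bound\<close>). And one pointwise estimate
  (\<open>power_le_density\<close>) gives both the fractional Sobolev embedding and the vanishing lemma.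

  The integrals are nonnegative Lebesgue integrals of Borel functions. The last part passes from
  Lebesgue measurable functions to Borel representatives.
\<close>

section \<open>Almost dominated convergence and elementary inequalities\<close>

text \<open>
  Dominated convergence when the dominating function works only up to a small multiple of a sequence
  with bounded integrals: the positive part of \<open>h\<^sub>n - \<eta> R\<^sub>n\<close> is dominated by \<open>g\<close>, and the rest
  contributes at most \<open>\<eta> K\<close>. The Brezis--Lieb splittings below are instances.
\<close>
lemma nn_integral_tendsto_0_almost_dominated:
  fixes h R :: "nat \<Rightarrow> 'a \<Rightarrow> real" and K :: ennreal
  assumes [measurable]: "\<And>n. h n \<in> borel_measurable M" "\<And>n. R n \<in> borel_measurable M"
    and h0: "\<And>n x. 0 \<le> h n x" and R0: "\<And>n x. 0 \<le> R n x"
    and lim: "AE x in M. (\<lambda>n. h n x) \<longlonglongrightarrow> 0"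
    and K: "K < \<infinity>" "\<And>n. (\<integral>\<^sup>+x. R n x \<partial>M) \<le> K"
    and dom: "\<And>\<eta>::real. 0 < \<eta> \<Longrightarrow> \<exists>g\<in>borel_measurable M. (\<forall>x. 0 \<le> g x)
        \<and> (\<integral>\<^sup>+x. ennreal (g x) \<partial>M) < \<infinity> \<and> (\<forall>n x. h n x \<le> \<eta> * R n x + g x)"
  shows "(\<lambda>n. \<integral>\<^sup>+x. h n x \<partial>M) \<longlonglongrightarrow> 0"
proof (rule order_tendstoI)
  fix e :: ennreal assume e: "0 < e"
  \<comment> \<open>\<open>e\<close> may be infinite; truncating makes it the image of a real \<open>\<epsilon>\<close>.\<close>
  define e' where "e' = min e 1"
  have e': "0 < e'" "e' \<le> e" "e' < \<infinity>" using e by (auto simp: e'_def min_def intro: le_less_trans[OF _ ennreal_one_less_top])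
  define \<epsilon> where "\<epsilon> = enn2real e'"
  have eps: "0 < \<epsilon>" "ennreal \<epsilon> = e'"
    using e' by (auto simp: \<epsilon>_def enn2real_positive_iff)
  define k where "k = enn2real K"
  have k: "0 \<le> k" "ennreal k = K" using K by (auto simp: k_def)
  define \<eta> where "\<eta> = \<epsilon> / (2 * (k + 1))"
  have eta: "0 < \<eta>" "\<eta> * k < \<epsilon> / 2"
  proof -
    show "0 < \<eta>" using eps k by (simp add: \<eta>_def)
    have "\<eta> * k < \<eta> * (k + 1)" using \<open>0 < \<eta>\<close> by simp
    also have "\<dots> = \<epsilon> / 2" using k by (simp add: \<eta>_def field_simps)
    finally show "\<eta> * k < \<epsilon> / 2" .
  qed
  from dom[OF eta(1)] obtain g where [measurable]: "g \<in> borel_measurable M"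
    and g: "\<And>x. 0 \<le> g x" "(\<integral>\<^sup>+x. ennreal (g x) \<partial>M) < \<infinity>" "\<And>n x. h n x \<le> \<eta> * R n x + g x"
    by blast
  define D where "D n x = max 0 (h n x - \<eta> * R n x)" for n x
  have [measurable]: "D n \<in> borel_measurable M" for n unfolding D_def by measurable
  have "(\<lambda>n. \<integral>\<^sup>+x. D n x \<partial>M) \<longlonglongrightarrow> (\<integral>\<^sup>+x. ennreal 0 \<partial>M)"
  proof (rule nn_integral_dominated_convergence[where w = g])
    show "AE x in M. ennreal (D n x) \<le> g x" for n
      using g by (auto simp: D_def intro!: AE_I2 ennreal_leI) (smt (verit, ccfv_SIG))
    show "AE x in M. (\<lambda>n. ennreal (D n x)) \<longlonglongrightarrow> ennreal 0"
      using lim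
    proof eventually_elim
      case (elim x)
      have "(\<lambda>n. D n x) \<longlonglongrightarrow> 0"
      proof (rule tendsto_sandwich[OF _ _ tendsto_const elim])
        show "\<forall>\<^sub>F n in sequentially. 0 \<le> D n x" by (simp add: D_def)
        show "\<forall>\<^sub>F n in sequentially. D n x \<le> h n x"
          using h0 R0 eta(1) by (intro always_eventually allI) (simp add: D_def)
      qed
      then show ?case by (intro tendsto_ennrealI)
    qed
  qed (use g in auto)
  then have "(\<lambda>n. \<integral>\<^sup>+x. D n x \<partial>M) \<longlonglongrightarrow> 0" by simp
  then have "\<forall>\<^sub>F n in sequentially. (\<integral>\<^sup>+x. D n x \<partial>M) < ennreal (\<epsilon> / 2)"
    using eps(1) by (intro order_tendstoD(2)[where y=0]) auto
  then show "\<forall>\<^sub>F n in sequentially. (\<integral>\<^sup>+x. h n x \<partial>M) < e"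
  proof eventually_elim
    case (elim n)
    have "(\<integral>\<^sup>+x. h n x \<partial>M) \<le> (\<integral>\<^sup>+x. ennreal (D n x) + ennreal \<eta> * ennreal (R n x) \<partial>M)"
      using R0 eta(1)
      by (intro nn_integral_mono)
         (auto simp: D_def ennreal_mult[symmetric] ennreal_plus[symmetric] intro!: ennreal_leI simp del: ennreal_plus)
    also have "\<dots> = (\<integral>\<^sup>+x. D n x \<partial>M) + ennreal \<eta> * (\<integral>\<^sup>+x. R n x \<partial>M)"
      by (simp add: nn_integral_add nn_integral_cmult)
    also have "\<dots> \<le> (\<integral>\<^sup>+x. D n x \<partial>M) + ennreal (\<eta> * k)"
      using K k eta by (auto simp: ennreal_mult intro!: add_left_mono mult_left_mono)
    also have "\<dots> < ennreal (\<epsilon> / 2) + ennreal (\<epsilon> / 2)"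
      using elim eta eps k by (intro add_strict_mono) (auto simp: ennreal_less_iff)
    also have "\<dots> = e'" using eps by (simp flip: ennreal_plus)
    finally show ?case using e' by simp
  qed
qed (auto simp: not_less)

lemma enn2real_nn_integral_split_tendsto:
  fixes a b :: "nat \<Rightarrow> 'a \<Rightarrow> real" and c :: "'a \<Rightarrow> real"
  assumes [measurable]: "\<And>n. a n \<in> borel_measurable M" "\<And>n. b n \<in> borel_measurable M"
      "c \<in> borel_measurable M"
    and nonneg: "\<And>n x. 0 \<le> a n x" "\<And>n x. 0 \<le> b n x" "\<And>x. 0 \<le> c x"
    and fin: "\<And>n. (\<integral>\<^sup>+x. a n x \<partial>M) < \<infinity>" "\<And>n. (\<integral>\<^sup>+x. b n x \<partial>M) < \<infinity>" "(\<integral>\<^sup>+x. c x \<partial>M) < \<infinity>"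
    and lim: "(\<lambda>n. \<integral>\<^sup>+x. \<bar>a n x - b n x - c x\<bar> \<partial>M) \<longlonglongrightarrow> 0"
  shows "(\<lambda>n. enn2real (\<integral>\<^sup>+x. a n x \<partial>M) - enn2real (\<integral>\<^sup>+x. b n x \<partial>M))
      \<longlonglongrightarrow> enn2real (\<integral>\<^sup>+x. c x \<partial>M)"
proof -
  have I: "integrable M (a n)" "integrable M (b n)" "integrable M c" for n
    using nonneg fin by (auto intro!: integrableI_nonneg)
  have eq: "enn2real (\<integral>\<^sup>+x. f x \<partial>M) = integral\<^sup>L M f"
    if "f \<in> borel_measurable M" "\<And>x. 0 \<le> f x" for f
    using that by (simp add: integral_eq_nn_integral)
  have I': "integrable M (\<lambda>x. \<bar>a n x - b n x - c x\<bar>)" for n using I by auto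
  have "(\<lambda>n. enn2real (\<integral>\<^sup>+x. \<bar>a n x - b n x - c x\<bar> \<partial>M)) \<longlonglongrightarrow> 0"
    by (rule tendsto_enn2real) (use lim in simp_all)
  then have L: "(\<lambda>n. \<integral>x. \<bar>a n x - b n x - c x\<bar> \<partial>M) \<longlonglongrightarrow> 0"
    by (simp add: eq)
  have "(\<lambda>n. (\<integral>x. a n x \<partial>M) - (\<integral>x. b n x \<partial>M) - (\<integral>x. c x \<partial>M)) \<longlonglongrightarrow> 0"
  proof (rule Lim_null_comparison[OF _ L], rule always_eventually, rule allI)
    fix n
    have "(\<integral>x. a n x \<partial>M) - (\<integral>x. b n x \<partial>M) - (\<integral>x. c x \<partial>M) = (\<integral>x. a n x - b n x - c x \<partial>M)"
      using I(1)[of n] I(2)[of n] I(3) by simp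
    also have "norm \<dots> \<le> (\<integral>x. \<bar>a n x - b n x - c x\<bar> \<partial>M)"
      by (rule order_trans[OF integral_norm_bound]) simp
    finally show "norm ((\<integral>x. a n x \<partial>M) - (\<integral>x. b n x \<partial>M) - (\<integral>x. c x \<partial>M))
        \<le> (\<integral>x. \<bar>a n x - b n x - c x\<bar> \<partial>M)" .
  qed
  then show ?thesis
    using nonneg by (subst (asm) LIM_zero_iff) (simp add: eq)
qed

text \<open>
  The elementary inequality behind the Brezis--Lieb lemma. If \<open>b\<close> is small compared with \<open>a\<close>,
  continuity of \<open>t \<mapsto> t\<^sup>p\<close> at \<open>1\<close> gives the \<open>\<epsilon>\<close> term; otherwise both norms are at most a multiple
  of the norm of \<open>b\<close>.
\<close>
lemma norm_powr_add_diff_bound: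
  fixes p \<epsilon> :: real
  assumes p: "1 \<le> p" and eps: "0 < \<epsilon>"
  shows "\<exists>C\<ge>1. \<forall>a b :: 'a::real_normed_vector.
    \<bar>norm (a + b) powr p - norm a powr p\<bar> \<le> \<epsilon> * norm a powr p + C * norm b powr p"
proof -
  have "((\<lambda>d. (1 + d) powr p) \<longlongrightarrow> (1 + 0) powr p) (at_right 0)"
       "((\<lambda>d. (1 - d) powr p) \<longlongrightarrow> (1 - 0) powr p) (at_right 0)"
    by (intro tendsto_intros; simp)+
  then have "\<forall>\<^sub>F d in at_right 0. dist ((1 + d) powr p) 1 < \<epsilon>"
            "\<forall>\<^sub>F d in at_right 0. dist ((1 - d) powr p) 1 < \<epsilon>"
    using eps by (auto dest!: tendstoD)
  moreover have "\<forall>\<^sub>F d in at_right (0::real). d \<in> {0<..<1}"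
    by (rule eventually_at_right_real) simp
  ultimately have "\<forall>\<^sub>F d in at_right 0. dist ((1 + d) powr p) 1 < \<epsilon> \<and> dist ((1 - d) powr p) 1 < \<epsilon> \<and> d \<in> {0<..<1}"
    by eventually_elim auto
  then obtain d where d: "0 < d" "d < 1" "(1 + d) powr p \<le> 1 + \<epsilon>" "(1 - d) powr p \<ge> 1 - \<epsilon>"
    using eventually_happens[of _ "at_right (0::real)"]
    by (force simp: dist_real_def)
  define C where "C = (1 + 1 / d) powr p"
  have C1: "1 \<le> C" unfolding C_def using d p by (intro ge_one_powr_ge_zero) auto
  show ?thesis
  proof (intro exI[of _ C] conjI allI)
    show "1 \<le> C" by (rule C1)
    fix a b :: 'a
    let ?A = "norm a" and ?B = "norm b" and ?S = "norm (a + b)"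
    show "\<bar>?S powr p - ?A powr p\<bar> \<le> \<epsilon> * ?A powr p + C * ?B powr p"
    proof (cases "?B \<le> d * ?A")
      case True
      have "?S \<le> (1 + d) * ?A" using norm_triangle_ineq[of a b] True by (simp add: algebra_simps)
      then have "?S powr p \<le> ((1 + d) * ?A) powr p" using p by (intro powr_mono2) auto
      also have "\<dots> = (1 + d) powr p * ?A powr p" using d by (simp add: powr_mult)
      also have "\<dots> \<le> (1 + \<epsilon>) * ?A powr p" using d by (intro mult_right_mono) auto
      finally have 1: "?S powr p - ?A powr p \<le> \<epsilon> * ?A powr p" by (simp add: algebra_simps)
      have "(1 - d) * ?A \<le> ?S"
        using norm_triangle_ineq2[of a "-b"] True by (simp add: algebra_simps)
      then have "((1 - d) * ?A) powr p \<le> ?S powr p" using p d by (intro powr_mono2) auto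
      moreover have "((1 - d) * ?A) powr p = (1 - d) powr p * ?A powr p"
        using d by (simp add: powr_mult)
      moreover have "(1 - \<epsilon>) * ?A powr p \<le> (1 - d) powr p * ?A powr p"
        using d by (intro mult_right_mono) auto
      ultimately have 2: "?A powr p - ?S powr p \<le> \<epsilon> * ?A powr p" by (simp add: algebra_simps)
      have "0 \<le> C * ?B powr p" using C1 by simp
      with 1 2 show ?thesis by linarith
    next
      case False
      then have "?A \<le> ?B / d" using d by (simp add: field_simps)
      then have "?S \<le> (1 + 1 / d) * ?B" "?A \<le> (1 + 1 / d) * ?B"
        using norm_triangle_ineq[of a b] norm_ge_zero[of b] by (auto simp: algebra_simps intro: order_trans add_increasing)
      then have "?S powr p \<le> ((1 + 1 / d) * ?B) powr p" "?A powr p \<le> ((1 + 1 / d) * ?B) powr p"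
        using p d by (auto intro!: powr_mono2)
      moreover have "((1 + 1 / d) * ?B) powr p = C * ?B powr p"
        using d by (simp add: powr_mult C_def)
      ultimately have "\<bar>?S powr p - ?A powr p\<bar> \<le> C * ?B powr p"
        by (smt (verit) powr_ge_zero)
      moreover have "0 \<le> \<epsilon> * ?A powr p" using eps by simp
      ultimately show ?thesis by linarith
    qed
  qed
qed

text \<open>
  Weighted arithmetic-geometric means, up to a constant: replace each factor by the largest one.
\<close>
lemma powr_three_product_le_sum:
  fixes X Y Z \<alpha> \<beta> :: real
  assumes "0 \<le> X" "0 \<le> Y" "0 \<le> Z" "0 \<le> \<alpha>" "0 < \<beta>" "\<alpha> + 2 * \<beta> = 1"
  shows "X powr \<alpha> * Y powr \<beta> * Z powr \<beta> \<le> X + Y + Z"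
proof -
  let ?M = "max X (max Y Z)"
  have "X powr \<alpha> * Y powr \<beta> * Z powr \<beta> \<le> ?M powr \<alpha> * ?M powr \<beta> * ?M powr \<beta>"
    using assms by (intro mult_mono powr_mono2) auto
  also have "\<dots> = ?M powr (\<alpha> + 2 * \<beta>)" by (simp add: powr_add[symmetric] field_simps)
  also have "\<dots> \<le> X + Y + Z" using assms by auto
  finally show ?thesis .
qed

text \<open>
  A pointwise Young inequality. With \<open>a = r / (2 (r - 1))\<close>, that is \<open>1 / a + 2 / r = 2\<close>, the product
  \<open>k f g\<close> is a geometric mean of \<open>f\<^sup>r g\<^sup>r\<close>, \<open>k\<^sup>a f\<^sup>r\<close> and \<open>k\<^sup>a g\<^sup>r\<close>. For \<open>k\<close> a convolution kernel all three
  have finite double integrals once \<open>k\<^sup>a\<close>, \<open>f\<^sup>r\<close> and \<open>g\<^sup>r\<close> are integrable. The parameter \<open>\<eta>\<close> shifts the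
  weight to the last term, the one that does not contain \<open>f\<close>.
\<close>
lemma kernel_product_bound:
  fixes k f g r \<eta> :: real
  assumes "0 \<le> k" "0 \<le> f" "0 \<le> g" and r: "1 < r" "r \<le> 2" and eta: "0 < \<eta>"
  shows "k * f * g \<le> \<eta> * (f powr r * g powr r + k powr (r / (2 * (r - 1))) * f powr r)
      + \<eta> powr (- (1 / (r - 1))) * (k powr (r / (2 * (r - 1))) * g powr r)"
proof -
  define a \<alpha> \<beta> where "a = r / (2 * (r - 1))" and "\<alpha> = 2 / r - 1" and "\<beta> = 1 - 1 / r"
  have par: "0 \<le> \<alpha>" "0 < \<beta>" "\<alpha> + 2 * \<beta> = 1" using r by (auto simp: \<alpha>_def \<beta>_def field_simps)
  \<comment> \<open>The value of \<open>C\<close> makes the weights cancel: \<open>\<eta>\<^sup>\<alpha> \<eta>\<^sup>\<beta> C\<^sup>\<beta> = 1\<close>.\<close>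
  define C where "C = \<eta> powr (- (1 / (r - 1)))"
  define X Y Z where "X = \<eta> * (f powr r * g powr r)" and "Y = \<eta> * (k powr a * f powr r)"
    and "Z = C * (k powr a * g powr r)"
  have e: "a * \<beta> + a * \<beta> = 1" "r * \<alpha> + r * \<beta> = 1" "\<alpha> + \<beta> - \<beta> / (r - 1) = 0"
  proof -
    have b: "\<beta> = (r - 1) / r" using r by (simp add: \<beta>_def field_simps)
    show "a * \<beta> + a * \<beta> = 1" using r by (simp add: b a_def)
    show "r * \<alpha> + r * \<beta> = 1" using r by (simp add: \<alpha>_def \<beta>_def algebra_simps)
    have "\<beta> / (r - 1) = 1 / r" using r by (simp add: b)
    then show "\<alpha> + \<beta> - \<beta> / (r - 1) = 0" using r by (simp add: \<alpha>_def \<beta>_def)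
  qed
  have "X powr \<alpha> * Y powr \<beta> * Z powr \<beta> =
     (\<eta> powr \<alpha> * \<eta> powr \<beta> * C powr \<beta>) * (k powr (a * \<beta>) * k powr (a * \<beta>))
       * (f powr (r * \<alpha>) * f powr (r * \<beta>)) * (g powr (r * \<alpha>) * g powr (r * \<beta>))"
    using assms by (simp add: X_def Y_def Z_def powr_mult powr_powr C_def)
  also have "\<eta> powr \<alpha> * \<eta> powr \<beta> * C powr \<beta> = \<eta> powr (\<alpha> + \<beta> - \<beta> / (r - 1))"
    by (simp add: C_def powr_powr powr_add[symmetric])
  also have "\<dots> = 1" using e(3) eta by simp
  finally have "X powr \<alpha> * Y powr \<beta> * Z powr \<beta> = k * f * g"
    using assms by (simp add: powr_add[symmetric] e)
  moreover have "X powr \<alpha> * Y powr \<beta> * Z powr \<beta> \<le> X + Y + Z"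
    using assms par by (intro powr_three_product_le_sum) (auto simp: X_def Y_def Z_def C_def)
  ultimately show ?thesis by (simp add: X_def Y_def Z_def C_def a_def algebra_simps)
qed

section \<open>Interactions with an integrable kernel\<close>
lemma nn_integral_lborel_diff:
  fixes f :: "'a::euclidean_space \<Rightarrow> ennreal"
  assumes [measurable]: "f \<in> borel_measurable borel"
  shows "(\<integral>\<^sup>+y. f (x - y) \<partial>lborel) = (\<integral>\<^sup>+z. f z \<partial>lborel)"
    and "(\<integral>\<^sup>+y. f (y - x) \<partial>lborel) = (\<integral>\<^sup>+z. f z \<partial>lborel)"
    and "(\<integral>\<^sup>+y. f (y + x) \<partial>lborel) = (\<integral>\<^sup>+z. f z \<partial>lborel)"
proof -
  have "(lborel :: 'a measure) = density (distr lborel borel (\<lambda>y. x - y)) (\<lambda>_. 1)"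
    using lborel_affine[of "-1" x] by simp
  then have "(\<integral>\<^sup>+z. f z \<partial>lborel) = (\<integral>\<^sup>+z. f z \<partial>density (distr lborel borel (\<lambda>y. x - y)) (\<lambda>_. 1))"
    by (rule arg_cong)
  also have "\<dots> = (\<integral>\<^sup>+y. f (x - y) \<partial>lborel)"
    by (simp add: nn_integral_density nn_integral_distr)
  finally show "(\<integral>\<^sup>+y. f (x - y) \<partial>lborel) = (\<integral>\<^sup>+z. f z \<partial>lborel)" ..
  have *: "(\<integral>\<^sup>+z. f z \<partial>lborel) = (\<integral>\<^sup>+y. f (y + t) \<partial>lborel)" for t
  proof -
    have "(\<integral>\<^sup>+z. f z \<partial>lborel) = (\<integral>\<^sup>+z. f z \<partial>(distr lborel borel ((+) t)))"
      by (simp add: lborel_distr_plus)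
    then show ?thesis by (simp add: nn_integral_distr add.commute)
  qed
  show "(\<integral>\<^sup>+y. f (y - x) \<partial>lborel) = (\<integral>\<^sup>+z. f z \<partial>lborel)"
    using *[of "-x"] by simp
  show "(\<integral>\<^sup>+y. f (y + x) \<partial>lborel) = (\<integral>\<^sup>+z. f z \<partial>lborel)"
    using *[of x] by simp
qed

lemma nn_integral_pair_kernel:
  fixes k f :: "'a::euclidean_space \<Rightarrow> ennreal"
  assumes [measurable]: "k \<in> borel_measurable borel" "f \<in> borel_measurable borel"
  shows "(\<integral>\<^sup>+(x, y). k (x - y) * f x \<partial>(lborel \<Otimes>\<^sub>M lborel)) = (\<integral>\<^sup>+z. k z \<partial>lborel) * (\<integral>\<^sup>+x. f x \<partial>lborel)"
    and "(\<integral>\<^sup>+(x, y). k (x - y) * f y \<partial>(lborel \<Otimes>\<^sub>M lborel)) = (\<integral>\<^sup>+z. k z \<partial>lborel) * (\<integral>\<^sup>+x. f x \<partial>lborel)"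
proof -
  have "(\<integral>\<^sup>+(x, y). k (x - y) * f x \<partial>(lborel \<Otimes>\<^sub>M lborel)) = (\<integral>\<^sup>+x. \<integral>\<^sup>+y. k (x - y) * f x \<partial>lborel \<partial>lborel)"
    by (subst lborel.nn_integral_fst[symmetric]) auto
  also have "\<dots> = (\<integral>\<^sup>+z. k z \<partial>lborel) * (\<integral>\<^sup>+x. f x \<partial>lborel)"
    by (simp add: nn_integral_multc nn_integral_lborel_diff nn_integral_cmult)
  finally show "(\<integral>\<^sup>+(x, y). k (x - y) * f x \<partial>(lborel \<Otimes>\<^sub>M lborel)) = (\<integral>\<^sup>+z. k z \<partial>lborel) * (\<integral>\<^sup>+x. f x \<partial>lborel)" .
  have "(\<integral>\<^sup>+(x, y). k (x - y) * f y \<partial>(lborel \<Otimes>\<^sub>M lborel)) = (\<integral>\<^sup>+y. \<integral>\<^sup>+x. k (x - y) * f y \<partial>lborel \<partial>lborel)"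
    by (subst lborel_pair.nn_integral_snd[symmetric]) auto
  also have "\<dots> = (\<integral>\<^sup>+z. k z \<partial>lborel) * (\<integral>\<^sup>+x. f x \<partial>lborel)"
    by (simp add: nn_integral_multc nn_integral_lborel_diff nn_integral_cmult)
  finally show "(\<integral>\<^sup>+(x, y). k (x - y) * f y \<partial>(lborel \<Otimes>\<^sub>M lborel)) = (\<integral>\<^sup>+z. k z \<partial>lborel) * (\<integral>\<^sup>+x. f x \<partial>lborel)" .
qed

lemma nn_integral_pair_product:
  fixes f g :: "'a::euclidean_space \<Rightarrow> ennreal"
  assumes [measurable]: "g \<in> borel_measurable borel" "f \<in> borel_measurable borel"
  shows "(\<integral>\<^sup>+(x, y). f x * g y \<partial>(lborel \<Otimes>\<^sub>M lborel)) = (\<integral>\<^sup>+z. f z \<partial>lborel) * (\<integral>\<^sup>+x. g x \<partial>lborel)"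
proof -
  have "(\<integral>\<^sup>+(x, y). f x * g y \<partial>(lborel \<Otimes>\<^sub>M lborel)) = (\<integral>\<^sup>+x. \<integral>\<^sup>+y. f x * g y \<partial>lborel \<partial>lborel)"
    by (subst lborel.nn_integral_fst[symmetric]) auto
  also have "\<dots> = (\<integral>\<^sup>+z. f z \<partial>lborel) * (\<integral>\<^sup>+x. g x \<partial>lborel)"
    by (simp add: nn_integral_multc nn_integral_cmult)
  finally show ?thesis .
qed

lemma AE_lborel_pairI:
  fixes P :: "'a::euclidean_space \<Rightarrow> bool"
  assumes "AE x in lborel. P x"
  shows "AE z in lborel \<Otimes>\<^sub>M lborel. P (fst z) \<and> P (snd z)"
proof -
  from AE_E3[OF assms] obtain N where N: "N \<in> null_sets lborel" "\<And>x. x \<notin> N \<Longrightarrow> P x" by auto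
  then have [measurable]: "N \<in> sets borel" by auto
  have *: "AE x in lborel. x \<notin> N" using N(1) by (rule AE_not_in)
  have "AE z in lborel \<Otimes>\<^sub>M lborel. fst z \<notin> N \<and> snd z \<notin> N"
  proof (rule lborel_pair.AE_pair_measure)
    show "AE x in lborel. AE y in lborel. fst (x, y) \<notin> N \<and> snd (x, y) \<notin> N"
      using *
    proof eventually_elim
      case (elim x) then show ?case using * by auto
    qed
  qed measurable
  then show ?thesis by eventually_elim (use N in auto)
qed

text \<open>
  The Brezis--Lieb lemma in \<open>L\<^sup>2\<close>, where the middle term \<open>2 \<langle>B, W\<^sub>n\<rangle>\<close> is handled by
  \<open>2 \<bar>B\<bar> \<bar>W\<bar> \<le> \<eta> \<bar>W\<bar>\<^sup>2 + \<bar>B\<bar>\<^sup>2 / \<eta>\<close>. It stands in for weak convergence in the energy space.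
\<close>
lemma square_split_tendsto_0:
  fixes W :: "nat \<Rightarrow> 'a \<Rightarrow> complex" and B :: "'a \<Rightarrow> complex" and K :: ennreal
  assumes [measurable]: "\<And>n. W n \<in> borel_measurable M" "B \<in> borel_measurable M"
    and lim: "AE x in M. (\<lambda>n. W n x) \<longlonglongrightarrow> 0"
    and K: "K < \<infinity>" "\<And>n. (\<integral>\<^sup>+x. (cmod (W n x))\<^sup>2 \<partial>M) \<le> K"
    and B: "(\<integral>\<^sup>+x. (cmod (B x))\<^sup>2 \<partial>M) < \<infinity>"
  shows "(\<lambda>n. \<integral>\<^sup>+x. \<bar>(cmod (B x + W n x))\<^sup>2 - (cmod (W n x))\<^sup>2 - (cmod (B x))\<^sup>2\<bar> \<partial>M) \<longlonglongrightarrow> 0"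
proof (rule nn_integral_tendsto_0_almost_dominated[where R = "\<lambda>n x. (cmod (W n x))\<^sup>2", OF _ _ _ _ _ K])
  show "AE x in M. (\<lambda>n. \<bar>(cmod (B x + W n x))\<^sup>2 - (cmod (W n x))\<^sup>2 - (cmod (B x))\<^sup>2\<bar>) \<longlonglongrightarrow> 0"
    using lim
  proof eventually_elim
    case (elim x)
    have "(\<lambda>n. \<bar>(cmod (B x + W n x))\<^sup>2 - (cmod (W n x))\<^sup>2 - (cmod (B x))\<^sup>2\<bar>)
        \<longlonglongrightarrow> \<bar>(cmod (B x + 0))\<^sup>2 - (cmod 0)\<^sup>2 - (cmod (B x))\<^sup>2\<bar>"
      by (intro tendsto_intros elim)
    then show ?case by simp
  qed
  fix \<eta> :: real assume eta: "0 < \<eta>"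
  have key: "\<bar>(cmod (b + w))\<^sup>2 - (cmod w)\<^sup>2 - (cmod b)\<^sup>2\<bar> \<le> \<eta> * (cmod w)\<^sup>2 + 1 / \<eta> * (cmod b)\<^sup>2" for b w
  proof -
    have "\<bar>(cmod (b + w))\<^sup>2 - (cmod w)\<^sup>2 - (cmod b)\<^sup>2\<bar> = \<bar>2 * (b \<bullet> w)\<bar>"
      by (simp add: power2_norm_eq_inner inner_add_left inner_add_right inner_commute)
    also have "\<dots> \<le> 2 * (cmod b * cmod w)" using Cauchy_Schwarz_ineq2[of b w] by simp
    also have "\<dots> \<le> \<eta> * (cmod w)\<^sup>2 + 1 / \<eta> * (cmod b)\<^sup>2"
    proof -
      have "0 \<le> (\<eta> * cmod w - cmod b)\<^sup>2 / \<eta>" using eta by simp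
      also have "\<dots> = \<eta> * (cmod w)\<^sup>2 + 1 / \<eta> * (cmod b)\<^sup>2 - 2 * (cmod b * cmod w)"
        using eta by (simp add: field_simps power2_eq_square)
      finally show ?thesis by simp
    qed
    finally show ?thesis .
  qed
  show "\<exists>g\<in>borel_measurable M. (\<forall>x. 0 \<le> g x) \<and> (\<integral>\<^sup>+x. ennreal (g x) \<partial>M) < \<infinity> \<and>
      (\<forall>n x. \<bar>(cmod (B x + W n x))\<^sup>2 - (cmod (W n x))\<^sup>2 - (cmod (B x))\<^sup>2\<bar> \<le> \<eta> * (cmod (W n x))\<^sup>2 + g x)"
  proof (rule bexI[of _ "\<lambda>x. 1 / \<eta> * (cmod (B x))\<^sup>2"], intro conjI allI)
    have "(\<integral>\<^sup>+x. ennreal (1 / \<eta> * (cmod (B x))\<^sup>2) \<partial>M) = ennreal (1 / \<eta>) * (\<integral>\<^sup>+x. (cmod (B x))\<^sup>2 \<partial>M)"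
      using eta by (subst nn_integral_cmult[symmetric]) (auto simp: ennreal_mult simp del: times_divide_eq_left)
    then show "(\<integral>\<^sup>+x. ennreal (1 / \<eta> * (cmod (B x))\<^sup>2) \<partial>M) < \<infinity>"
      using B by (auto simp: ennreal_mult_less_top)
  qed (use key eta in auto)
qed auto

definition interaction :: "('a::euclidean_space \<Rightarrow> real) \<Rightarrow> real \<Rightarrow> ('a \<Rightarrow> complex) \<Rightarrow> ennreal" where
  "interaction k p u =
     (\<integral>\<^sup>+(x, y). ennreal (k (x - y) * (cmod (u x) powr p * cmod (u y) powr p)) \<partial>(lborel \<Otimes>\<^sub>M lborel))"

lemma cmod_add_powr_le:
  assumes "0 \<le> q"
  shows "cmod (a + b) powr q \<le> 2 powr q * (cmod a powr q + cmod b powr q)"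
proof -
  have "cmod (a + b) \<le> 2 * max (cmod a) (cmod b)" using norm_triangle_ineq[of a b] by auto
  then have "cmod (a + b) powr q \<le> (2 * max (cmod a) (cmod b)) powr q"
    using assms by (intro powr_mono2) auto
  also have "\<dots> = 2 powr q * max (cmod a) (cmod b) powr q" by (subst powr_mult) auto
  also have "max (cmod a) (cmod b) powr q \<le> cmod a powr q + cmod b powr q" by (auto simp: max_def)
  finally show ?thesis by simp
qed

lemma nn_integral_add_powr_finite:
  assumes [measurable]: "u \<in> borel_measurable M" "v \<in> borel_measurable M"
    and "0 \<le> q" "(\<integral>\<^sup>+x. cmod (u x) powr q \<partial>M) < \<infinity>" "(\<integral>\<^sup>+x. cmod (v x) powr q \<partial>M) < \<infinity>"
  shows "(\<integral>\<^sup>+x. cmod (u x + v x) powr q \<partial>M) < \<infinity>"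
proof -
  have "(\<integral>\<^sup>+x. cmod (u x + v x) powr q \<partial>M)
      \<le> (\<integral>\<^sup>+x. ennreal (2 powr q) * (ennreal (cmod (u x) powr q) + ennreal (cmod (v x) powr q)) \<partial>M)"
    using cmod_add_powr_le[OF assms(3)]
    by (intro nn_integral_mono) (simp add: ennreal_mult[symmetric] ennreal_plus[symmetric] del: ennreal_plus)
  also have "\<dots> = ennreal (2 powr q) * ((\<integral>\<^sup>+x. cmod (u x) powr q \<partial>M) + (\<integral>\<^sup>+x. cmod (v x) powr q \<partial>M))"
    by (simp add: nn_integral_cmult nn_integral_add)
  also have "\<dots> < \<infinity>" using assms by (auto simp: ennreal_mult_less_top)
  finally show ?thesis .
qed

text \<open>
  A kernel with the integrable power that \<open>kernel_product_bound\<close> asks for. The near and the far part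
  of the Riesz potential are of this kind, with different exponents \<open>r\<close>.
\<close>
locale integrable_power_kernel =
  fixes k :: "'a::euclidean_space \<Rightarrow> real" and r p a :: real
  assumes k_meas [measurable]: "k \<in> borel_measurable borel" and k_nonneg: "\<And>z. 0 \<le> k z"
    and r: "1 < r" "r \<le> 2" and p: "1 \<le> p"
    and a_def: "a = r / (2 * (r - 1))"
    and k_int: "(\<integral>\<^sup>+z. k z powr a \<partial>lborel) < \<infinity>"
begin

text \<open>
  \<open>T\<close> and \<open>S\<close> are the two parts of the right-hand side of \<open>kernel_product_bound\<close> for \<open>\<bar>f\<bar>\<^sup>p\<close> at
  the first and \<open>\<bar>g\<bar>\<^sup>p\<close> at the second point of a pair; \<open>T'\<close> and \<open>S'\<close> are the same with the roles
  of the points exchanged.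
\<close>
abbreviation T :: "('a \<Rightarrow> complex) \<Rightarrow> ('a \<Rightarrow> complex) \<Rightarrow> 'a \<times> 'a \<Rightarrow> real" where
  "T f g \<equiv> \<lambda>z. cmod (f (fst z)) powr (p * r) * cmod (g (snd z)) powr (p * r)
     + k (fst z - snd z) powr a * cmod (f (fst z)) powr (p * r)"

abbreviation S :: "('a \<Rightarrow> complex) \<Rightarrow> 'a \<times> 'a \<Rightarrow> real" where
  "S g \<equiv> \<lambda>z. k (fst z - snd z) powr a * cmod (g (snd z)) powr (p * r)"

abbreviation T' :: "('a \<Rightarrow> complex) \<Rightarrow> ('a \<Rightarrow> complex) \<Rightarrow> 'a \<times> 'a \<Rightarrow> real" where
  "T' f g \<equiv> \<lambda>z. cmod (g (fst z)) powr (p * r) * cmod (f (snd z)) powr (p * r)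
     + k (fst z - snd z) powr a * cmod (f (snd z)) powr (p * r)"

abbreviation S' :: "('a \<Rightarrow> complex) \<Rightarrow> 'a \<times> 'a \<Rightarrow> real" where
  "S' g \<equiv> \<lambda>z. k (fst z - snd z) powr a * cmod (g (fst z)) powr (p * r)"

abbreviation "\<kappa> \<equiv> \<integral>\<^sup>+z. k z powr a \<partial>lborel"
abbreviation pint :: "('a \<Rightarrow> complex) \<Rightarrow> ennreal" where
  "pint f \<equiv> \<integral>\<^sup>+x. cmod (f x) powr (p * r) \<partial>lborel"

lemma nn_integral_S:
  assumes [measurable]: "g \<in> borel_measurable borel"
  shows "(\<integral>\<^sup>+z. S g z \<partial>(lborel \<Otimes>\<^sub>M lborel)) = \<kappa> * pint g"
    and "(\<integral>\<^sup>+z. S' g z \<partial>(lborel \<Otimes>\<^sub>M lborel)) = \<kappa> * pint g"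
  using nn_integral_pair_kernel[of "\<lambda>z. ennreal (k z powr a)" "\<lambda>x. ennreal (cmod (g x) powr (p * r))"]
  by (simp_all add: ennreal_mult split_beta')

lemma nn_integral_T:
  assumes [measurable]: "f \<in> borel_measurable borel" "g \<in> borel_measurable borel"
  shows "(\<integral>\<^sup>+z. T f g z \<partial>(lborel \<Otimes>\<^sub>M lborel)) = pint f * pint g + \<kappa> * pint f"
    and "(\<integral>\<^sup>+z. T' f g z \<partial>(lborel \<Otimes>\<^sub>M lborel)) = pint g * pint f + \<kappa> * pint f"
proof -
  have 1: "(\<integral>\<^sup>+z. ennreal (cmod (f (fst z)) powr (p * r) * cmod (g (snd z)) powr (p * r)) \<partial>(lborel \<Otimes>\<^sub>M lborel)) = pint f * pint g"
    if [measurable]: "f \<in> borel_measurable borel" "g \<in> borel_measurable borel" for f g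
    using nn_integral_pair_product[of "\<lambda>x. ennreal (cmod (g x) powr (p * r))" "\<lambda>x. ennreal (cmod (f x) powr (p * r))"]
    by (simp add: ennreal_mult split_beta')

  show "(\<integral>\<^sup>+z. T f g z \<partial>(lborel \<Otimes>\<^sub>M lborel)) = pint f * pint g + \<kappa> * pint f"
    by (simp add: nn_integral_add 1 nn_integral_S)
  show "(\<integral>\<^sup>+z. T' f g z \<partial>(lborel \<Otimes>\<^sub>M lborel)) = pint g * pint f + \<kappa> * pint f"
    by (simp add: nn_integral_add 1 nn_integral_S)
qed

lemma kernel_bound:
  assumes "0 < \<eta>"
  shows "k (fst z - snd z) * (cmod (f (fst z)) powr p * cmod (g (snd z)) powr p)
      \<le> \<eta> * T f g z + \<eta> powr (- (1 / (r - 1))) * S g z"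
    and "k (fst z - snd z) * (cmod (f (fst z)) powr p * cmod (g (snd z)) powr p)
      \<le> \<eta> * T' g f z + \<eta> powr (- (1 / (r - 1))) * S' f z"
  using kernel_product_bound[OF k_nonneg _ _ r assms, of "cmod (f (fst z)) powr p" "cmod (g (snd z)) powr p" "fst z - snd z"]
    kernel_product_bound[OF k_nonneg _ _ r assms, of "cmod (g (snd z)) powr p" "cmod (f (fst z)) powr p" "fst z - snd z"]
  by (simp_all add: powr_powr a_def mult_ac)

text \<open>
  The substitute for the Hardy--Littlewood--Sobolev inequality. It is not homogeneous, but it is
  finite and tends to zero together with the integral of \<open>\<bar>u\<bar>\<^sup>p\<^sup>r\<close>, which is what the argument uses.
\<close>
lemma interaction_le:
  assumes [measurable]: "u \<in> borel_measurable borel"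
  shows "interaction k p u \<le> pint u * pint u + 2 * \<kappa> * pint u"
proof -
  have "interaction k p u \<le> (\<integral>\<^sup>+z. ennreal (T u u z) + ennreal (S u z) \<partial>(lborel \<Otimes>\<^sub>M lborel))"
    unfolding interaction_def split_beta'
    using kernel_bound(1)[of 1 _ u u]
    by (intro nn_integral_mono) (simp add: ennreal_plus[symmetric] del: ennreal_plus)
  also have "\<dots> = (\<integral>\<^sup>+z. T u u z \<partial>(lborel \<Otimes>\<^sub>M lborel)) + (\<integral>\<^sup>+z. S u z \<partial>(lborel \<Otimes>\<^sub>M lborel))"
    by (intro nn_integral_add) auto
  also have "\<dots> = pint u * pint u + 2 * \<kappa> * pint u"
    by (simp only: nn_integral_T nn_integral_S assms) (simp add: algebra_simps mult_2 distrib_right)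
  finally show ?thesis .
qed

text \<open>
  A nonlocal Brezis--Lieb lemma. With \<open>f\<^sub>n = \<bar>v + w\<^sub>n\<bar>\<^sup>p\<close>, \<open>g\<^sub>n = \<bar>w\<^sub>n\<bar>\<^sup>p\<close>, \<open>f = \<bar>v\<bar>\<^sup>p\<close>, the difference
  \<open>f\<^sub>n \<otimes> f\<^sub>n - g\<^sub>n \<otimes> g\<^sub>n - f \<otimes> f\<close> is bounded by a small multiple of \<open>g\<^sub>n \<otimes> g\<^sub>n\<close>, by the mixed products of
  \<open>f\<close> and \<open>g\<^sub>n\<close>, and by \<open>f \<otimes> f\<close>. In the mixed products \<open>kernel_product_bound\<close> puts the large weight on
  the term without \<open>w\<^sub>n\<close>, which is a fixed integrable function.
\<close>
lemma interaction_split: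
  assumes [measurable]: "v \<in> borel_measurable borel" "\<And>n. w n \<in> borel_measurable borel"
    and v: "pint v < \<infinity>" and w: "\<And>n. pint (w n) \<le> K" and K: "K < \<infinity>"
    and lim: "AE x in lborel. (\<lambda>n. w n x) \<longlonglongrightarrow> 0"
  shows "(\<lambda>n. enn2real (interaction k p (\<lambda>x. v x + w n x)) - enn2real (interaction k p (w n)))
      \<longlonglongrightarrow> enn2real (interaction k p v)"
proof -
  let ?P = "lborel \<Otimes>\<^sub>M lborel :: ('a \<times> 'a) measure"
  define Q where "Q u z = k (fst z - snd z) * (cmod (u (fst z)) powr p * cmod (u (snd z)) powr p)"
    for u :: "'a \<Rightarrow> complex" and z
  have Qint: "interaction k p u = (\<integral>\<^sup>+z. Q u z \<partial>?P)" for u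
    by (simp add: interaction_def Q_def split_beta')
  have Q0: "0 \<le> Q u z" for u z by (simp add: Q_def k_nonneg)
  have Qm [measurable]: "Q u \<in> borel_measurable ?P" if [measurable]: "u \<in> borel_measurable borel" for u
    unfolding Q_def by measurable
  have wfin: "pint (w n) < \<infinity>" for n using w[of n] K by (rule le_less_trans)
  have sfin: "pint (\<lambda>x. v x + w n x) < \<infinity>" for n
    using v wfin p r by (intro nn_integral_add_powr_finite) auto
  have fin: "interaction k p u < \<infinity>" if "u \<in> borel_measurable borel" "pint u < \<infinity>" for u
    using that k_int by (intro le_less_trans[OF interaction_le]) (auto simp: ennreal_mult_less_top)
  define R where "R n z = T (w n) (w n) z + S (w n) z + T (w n) v z + T' (w n) v z" for n z
  have R0: "0 \<le> R n z" for n z by (simp add: R_def)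
  have [measurable]: "R n \<in> borel_measurable ?P" for n unfolding R_def by measurable
  have Rint: "(\<integral>\<^sup>+z. R n z \<partial>?P) \<le> (K * K + \<kappa> * K) + \<kappa> * K + (K * pint v + \<kappa> * K) + (pint v * K + \<kappa> * K)" for n
  proof -
    have "(\<integral>\<^sup>+z. R n z \<partial>?P) = (\<integral>\<^sup>+z. T (w n) (w n) z \<partial>?P) + (\<integral>\<^sup>+z. S (w n) z \<partial>?P)
        + (\<integral>\<^sup>+z. T (w n) v z \<partial>?P) + (\<integral>\<^sup>+z. T' (w n) v z \<partial>?P)"
      unfolding R_def by (subst nn_integral_add[symmetric], simp, simp)+
        (auto intro!: nn_integral_cong simp: ennreal_plus[symmetric] simp del: ennreal_plus)
    also have "\<dots> = (pint (w n) * pint (w n) + \<kappa> * pint (w n)) + \<kappa> * pint (w n)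
        + (pint (w n) * pint v + \<kappa> * pint (w n)) + (pint v * pint (w n) + \<kappa> * pint (w n))"
      by (simp only: nn_integral_T nn_integral_S assms)
    also have "\<dots> \<le> (K * K + \<kappa> * K) + \<kappa> * K + (K * pint v + \<kappa> * K) + (pint v * K + \<kappa> * K)"
      using w[of n] by (intro add_mono mult_mono order_refl) auto
    finally show ?thesis .
  qed
  have "(\<lambda>n. \<integral>\<^sup>+z. \<bar>Q (\<lambda>x. v x + w n x) z - Q (w n) z - Q v z\<bar> \<partial>?P) \<longlonglongrightarrow> 0"
  proof (rule nn_integral_tendsto_0_almost_dominated[OF _ _ _ R0 _ _ Rint])
    show "AE z in ?P. (\<lambda>n. \<bar>Q (\<lambda>x. v x + w n x) z - Q (w n) z - Q v z\<bar>) \<longlonglongrightarrow> 0"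
      using AE_lborel_pairI[OF lim]
    proof eventually_elim
      case (elim z)
      have "(\<lambda>n. \<bar>Q (\<lambda>x. v x + w n x) z - Q (w n) z - Q v z\<bar>) \<longlonglongrightarrow>
         \<bar>k (fst z - snd z) * (cmod (v (fst z) + 0) powr p * cmod (v (snd z) + 0) powr p)
           - k (fst z - snd z) * (cmod 0 powr p * cmod 0 powr p) - Q v z\<bar>"
        unfolding Q_def using elim p
        by (intro tendsto_intros) auto
      then show ?case by (simp add: Q_def)
    qed
    show "K * K + \<kappa> * K + \<kappa> * K + (K * pint v + \<kappa> * K) + (pint v * K + \<kappa> * K) < \<infinity>"
      using K v k_int by (auto simp: ennreal_mult_less_top)
    fix \<eta> :: real assume eta: "0 < \<eta>"
    \<comment> \<open>\<open>\<epsilon>\<close> controls the products of \<open>w\<^sub>n\<close> with itself, \<open>\<delta>\<close> below the mixed ones.\<close>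
    define \<epsilon> where "\<epsilon> = min 1 (\<eta> / 3)"
    have eps: "0 < \<epsilon>" "\<epsilon> \<le> 1" "3 * \<epsilon> \<le> \<eta>" using eta by (auto simp: \<epsilon>_def)
    obtain C where C: "1 \<le> C" "\<And>a b :: complex. \<bar>cmod (a + b) powr p - cmod a powr p\<bar> \<le> \<epsilon> * cmod a powr p + C * cmod b powr p"
      using norm_powr_add_diff_bound[OF p eps(1)] by blast
    define \<delta> where "\<delta> = \<eta> / (2 * C)"
    have delta: "0 < \<delta>" "2 * C * \<delta> = \<eta>" using eta C by (auto simp: \<delta>_def)
    define L where "L = \<delta> powr (- (1 / (r - 1)))"
    define g where "g z = 2 * C * L * (S v z + S' v z) + (C\<^sup>2 + 1) * (T v v z + S v z)" for z
    have L0: "0 \<le> L" by (simp add: L_def)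
    show "\<exists>g\<in>borel_measurable ?P. (\<forall>x. 0 \<le> g x) \<and> (\<integral>\<^sup>+ x. ennreal (g x) \<partial>?P) < \<infinity> \<and>
        (\<forall>n z. \<bar>Q (\<lambda>x. v x + w n x) z - Q (w n) z - Q v z\<bar> \<le> \<eta> * R n z + g z)"
    proof (rule bexI[of _ g], intro conjI allI)
      show "0 \<le> g z" for z using C L0 by (simp add: g_def)
      have "(\<integral>\<^sup>+z. ennreal (g z) \<partial>?P) =
          (\<integral>\<^sup>+z. ennreal (2 * C * L) * (ennreal (S v z) + ennreal (S' v z))
             + ennreal (C\<^sup>2 + 1) * (ennreal (T v v z) + ennreal (S v z)) \<partial>?P)"
        unfolding g_def using C L0
        by (intro nn_integral_cong)
          (auto simp: ennreal_mult[symmetric] ennreal_plus[symmetric] simp del: ennreal_plus)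
      also have "\<dots> = ennreal (2 * C * L) * ((\<integral>\<^sup>+z. S v z \<partial>?P) + (\<integral>\<^sup>+z. S' v z \<partial>?P))
          + ennreal (C\<^sup>2 + 1) * ((\<integral>\<^sup>+z. T v v z \<partial>?P) + (\<integral>\<^sup>+z. S v z \<partial>?P))"
        by (simp add: nn_integral_add nn_integral_cmult del: ennreal_plus)
      also have "\<dots> < \<infinity>"
        unfolding nn_integral_T[OF assms(1,1)] nn_integral_S[OF assms(1)]
        using v k_int by (auto simp: ennreal_mult_less_top)
      finally show "(\<integral>\<^sup>+z. ennreal (g z) \<partial>?P) < \<infinity>" .
      show "g \<in> borel_measurable ?P" unfolding g_def by measurable
      fix n z
      define K' V V' W W' X X' where "K' = k (fst z - snd z)" and "V = cmod (v (fst z)) powr p"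
        and "V' = cmod (v (snd z)) powr p" and "W = cmod (w n (fst z)) powr p"
        and "W' = cmod (w n (snd z)) powr p" and "X = cmod (v (fst z) + w n (fst z)) powr p"
        and "X' = cmod (v (snd z) + w n (snd z)) powr p"
      note defs = K'_def V_def V'_def W_def W'_def X_def X'_def
      have nn: "0 \<le> K'" "0 \<le> V" "0 \<le> V'" "0 \<le> W" "0 \<le> W'" "0 \<le> X" "0 \<le> X'"
        by (auto simp: defs k_nonneg)
      have x: "\<bar>X - W\<bar> \<le> \<epsilon> * W + C * V" "\<bar>X' - W'\<bar> \<le> \<epsilon> * W' + C * V'"
        using C(2)[of "w n (fst z)" "v (fst z)"] C(2)[of "w n (snd z)" "v (snd z)"]
        by (auto simp: defs add.commute)
      have eW: "\<epsilon> * W' \<le> W'" using eps nn by (simp add: mult_left_le_one_le)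
      have x': "X' \<le> 2 * W' + C * V'" using x(2) eW by linarith
      have "\<bar>X * X' - W * W' - V * V'\<bar> \<le> \<bar>X - W\<bar> * X' + W * \<bar>X' - W'\<bar> + V * V'"
      proof -
        have "X * X' - W * W' - V * V' = (X - W) * X' + W * (X' - W') - V * V'"
          by (simp add: algebra_simps)
        also have "\<bar>\<dots>\<bar> \<le> \<bar>(X - W) * X'\<bar> + \<bar>W * (X' - W')\<bar> + \<bar>V * V'\<bar>" by linarith
        finally show ?thesis using nn by (simp add: abs_mult)
      qed
      also have "\<dots> \<le> (\<epsilon> * W + C * V) * (2 * W' + C * V') + W * (\<epsilon> * W' + C * V') + V * V'"
        using x x' nn eps C by (intro add_mono mult_mono order_refl) auto
      also have "\<dots> = 3 * \<epsilon> * (W * W') + (\<epsilon> * C + C) * (W * V') + 2 * C * (V * W') + (C\<^sup>2 + 1) * (V * V')"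
        by (simp add: algebra_simps power2_eq_square)
      also have "\<dots> \<le> \<eta> * (W * W') + (2 * C) * (W * V') + 2 * C * (V * W') + (C\<^sup>2 + 1) * (V * V')"
      proof -
        have "\<epsilon> * C \<le> C" using eps C by (simp add: mult_left_le_one_le)
        then show ?thesis
          using eps nn by (intro add_mono mult_right_mono order_refl) auto
      qed
      finally have "K' * \<bar>X * X' - W * W' - V * V'\<bar> \<le> K' *
          (\<eta> * (W * W') + (2 * C) * (W * V') + 2 * C * (V * W') + (C\<^sup>2 + 1) * (V * V'))"
        using nn by (intro mult_left_mono)
      also have "\<dots> = \<eta> * (K' * (W * W')) + 2 * C * (K' * (W * V')) + 2 * C * (K' * (V * W'))
          + (C\<^sup>2 + 1) * (K' * (V * V'))"
        by (simp add: algebra_simps)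
      also have "\<dots> \<le> \<eta> * (T (w n) (w n) z + S (w n) z) + 2 * C * (\<delta> * T (w n) v z + L * S v z)
          + 2 * C * (\<delta> * T' (w n) v z + L * S' v z) + (C\<^sup>2 + 1) * (T v v z + S v z)"
        using kernel_bound(1)[of 1 z "w n" "w n"] kernel_bound(1)[OF delta(1), of z "w n" v]
          kernel_bound(2)[OF delta(1), of z v "w n"] kernel_bound(1)[of 1 z v v] eta C
        by (intro add_mono mult_left_mono) (simp_all add: defs L_def)
      also have "\<dots> = \<eta> * R n z + g z"
      proof -
        have eq: "2 * C * (\<delta> * t + L * t') = \<eta> * t + 2 * C * L * t'" for t t'
          unfolding delta(2)[symmetric] by (simp add: algebra_simps)
        show ?thesis unfolding eq R_def g_def by (simp add: algebra_simps)
      qed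
      also have "K' * \<bar>X * X' - W * W' - V * V'\<bar> = \<bar>Q (\<lambda>x. v x + w n x) z - Q (w n) z - Q v z\<bar>"
        using nn(1) unfolding Q_def defs[symmetric]
        by (simp add: right_diff_distrib[symmetric] abs_mult)
      finally show "\<bar>Q (\<lambda>x. v x + w n x) z - Q (w n) z - Q v z\<bar> \<le> \<eta> * R n z + g z" .
    qed
  qed auto
  then show ?thesis
    unfolding Qint
    using fin[unfolded Qint] sfin wfin v
    by (intro enn2real_nn_integral_split_tendsto) (auto simp: Q0)
qed

end

section \<open>Fractional Sobolev embedding and vanishing\<close>
text \<open>
  A jump kernel at least as singular as that of the fractional Laplacian near the origin. The bound is
  required up to distance \<open>2\<close> so that it covers the unit balls and the cells of side at most \<open>1\<close>
  that occur below.
\<close>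
locale gagliardo_energy =
  fixes J :: "real^3 \<Rightarrow> real" and s c\<^sub>0 :: real
  assumes J_meas [measurable]: "J \<in> borel_measurable borel" and J_nonneg: "\<And>z. 0 \<le> J z"
    and s: "0 < s" "s < 1" and c0: "0 < c\<^sub>0"
    and J_lower: "\<And>z. 0 < norm z \<Longrightarrow> norm z < 2 \<Longrightarrow> c\<^sub>0 * norm z powr - (3 + 2 * s) \<le> J z"
begin

definition density :: "(real^3 \<Rightarrow> complex) \<Rightarrow> real^3 \<Rightarrow> ennreal" where
  "density u x = (\<integral>\<^sup>+y. ennreal ((cmod (u x - u y))\<^sup>2 * J (x - y)) \<partial>lborel)"

definition energy :: "(real^3 \<Rightarrow> complex) \<Rightarrow> ennreal" where
  "energy u = (\<integral>\<^sup>+(x, y). ennreal ((cmod (u x - u y))\<^sup>2 * J (x - y)) \<partial>(lborel \<Otimes>\<^sub>M lborel))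
     + (\<integral>\<^sup>+x. ennreal ((cmod (u x))\<^sup>2) \<partial>lborel)"

lemma density_measurable [measurable]:
  assumes [measurable]: "u \<in> borel_measurable borel"
  shows "density u \<in> borel_measurable borel"
  unfolding density_def[abs_def] by measurable

lemma nn_integral_density_energy:
  assumes [measurable]: "u \<in> borel_measurable borel"
  shows "(\<integral>\<^sup>+x. density u x + ennreal ((cmod (u x))\<^sup>2) \<partial>lborel) = energy u"
proof -
  have "(\<integral>\<^sup>+x. density u x \<partial>lborel) =
      (\<integral>\<^sup>+(x, y). ennreal ((cmod (u x - u y))\<^sup>2 * J (x - y)) \<partial>(lborel \<Otimes>\<^sub>M lborel))"
    unfolding density_def by (subst lborel.nn_integral_fst[symmetric]) auto
  then show ?thesis by (simp add: nn_integral_add energy_def)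
qed

definition V :: real where "V = unit_ball_vol 3"

lemma V_pos: "0 < V" by (simp add: V_def)

lemma emeasure_ball3: "0 \<le> \<rho> \<Longrightarrow> emeasure lborel (ball (x :: real^3) \<rho>) = ennreal (V * \<rho> ^ 3)"
  by (subst emeasure_ball) (auto simp: V_def)

text \<open>
  The constant produced by the two cases in the proof of \<open>power_le_density\<close>.
\<close>
definition sob_const :: "real \<Rightarrow> real" where
  "sob_const q = (2 powr (q + 1) / V) powr (2 * s / 3) * max 1 (8 / (c\<^sub>0 * V))"

lemma sob_const_pos: "0 < sob_const q"
  using V_pos c0 by (auto simp: sob_const_def)

text \<open>
  Let \<open>t = \<bar>u(x)\<bar>\<close>. By Chebyshev's inequality \<open>\<bar>u\<bar> \<ge> t / 2\<close> can hold only on a set of measure at most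
  \<open>2\<^sup>q \<delta> / t\<^sup>q\<close>. On a ball around \<open>x\<close> of twice that measure, \<open>\<bar>u(x) - u(y)\<bar> \<ge> t / 2\<close> for at
  least half of the points \<open>y\<close>, and the lower bound on \<open>J\<close> turns this into a lower bound for the energy
  density at \<open>x\<close>. If that ball has radius above \<open>1\<close>, then \<open>t\<^sup>q\<close> is at most a multiple of \<open>\<delta>\<close> and the
  claim is immediate.

  For \<open>\<delta>\<close> a bound on the whole integral of \<open>\<bar>u\<bar>\<^sup>q\<close> this is a step of the Sobolev embedding; for \<open>\<delta>\<close>
  small and \<open>q = 2\<close> it is the vanishing lemma.
\<close>
lemma power_le_density:
  assumes [measurable]: "u \<in> borel_measurable borel" and q: "0 < q" and \<delta>: "0 < \<delta>"
    and loc: "(\<integral>\<^sup>+y\<in>ball x 1. cmod (u y) powr q \<partial>lborel) \<le> ennreal \<delta>"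
  shows "ennreal (cmod (u x) powr (2 + 2 * s * q / 3))
    \<le> ennreal (sob_const q * \<delta> powr (2 * s / 3)) * (density u x + ennreal ((cmod (u x))\<^sup>2))"
proof -
  define t where "t = cmod (u x)"
  define C where "C = 2 powr (q + 1) / V"
  have C: "0 < C" using V_pos by (simp add: C_def)
  have base: "t powr (2 + 2 * s * q / 3) = t\<^sup>2 * (t powr q) powr (2 * s / 3)" if "0 < t"
    using that by (simp add: powr_add powr_powr mult_ac)
  consider "t = 0" | "0 < t" "t powr q \<le> C * \<delta>" | "0 < t" "C * \<delta> < t powr q"
    by (fastforce simp: t_def)
  then show ?thesis
  proof cases
    case 1
    then show ?thesis by (simp add: t_def)
  next
    case 2
    have "t powr (2 + 2 * s * q / 3) \<le> t\<^sup>2 * (C * \<delta>) powr (2 * s / 3)"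
      unfolding base[OF 2(1)] using 2 s by (intro mult_left_mono powr_mono2) auto
    also have "\<dots> = C powr (2 * s / 3) * 1 * \<delta> powr (2 * s / 3) * t\<^sup>2"
      using C \<delta> by (simp add: powr_mult)
    also have "\<dots> \<le> C powr (2 * s / 3) * max 1 (8 / (c\<^sub>0 * V)) * \<delta> powr (2 * s / 3) * t\<^sup>2"
      by (intro mult_right_mono mult_left_mono) auto
    finally have "ennreal (t powr (2 + 2 * s * q / 3)) \<le> ennreal (sob_const q * \<delta> powr (2 * s / 3)) * ennreal (t\<^sup>2)"
      unfolding sob_const_def C_def
      by (subst ennreal_mult[symmetric]) (auto intro!: ennreal_leI)
    also have "\<dots> \<le> ennreal (sob_const q * \<delta> powr (2 * s / 3)) * (density u x + ennreal (t\<^sup>2))"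
      by (intro mult_left_mono) auto
    finally show ?thesis by (simp add: t_def)
  next
    case 3
    \<comment> \<open>The radius for which the ball has twice the measure that Chebyshev allows to \<open>A\<close> below.\<close>
    define \<rho> where "\<rho> = (C * \<delta> / t powr q) powr (1/3)"
    have r3: "\<rho> ^ 3 = C * \<delta> / t powr q"
    proof -
      have "\<rho> ^ 3 = \<rho> powr 3" using C \<delta> 3(1) by (simp add: \<rho>_def)
      also have "\<dots> = C * \<delta> / t powr q" using C \<delta> by (simp add: \<rho>_def powr_powr)
      finally show ?thesis .
    qed
    have rho: "0 < \<rho>" "\<rho> < 1"
    proof -
      show "0 < \<rho>" using C \<delta> 3(1) by (simp add: \<rho>_def)
      have "C * \<delta> / t powr q < 1" using 3 by simp
      then show "\<rho> < 1" using one_le_power[of \<rho> 3] r3 by linarith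
    qed
    define B where "B = ball x \<rho>"
    define A where "A = {y\<in>B. t / 2 \<le> cmod (u y)}"
    have [measurable]: "B \<in> sets borel" "A \<in> sets borel" by (auto simp: A_def B_def)
    have "ennreal ((t / 2) powr q) * emeasure lborel A = (\<integral>\<^sup>+y\<in>A. ennreal ((t / 2) powr q) \<partial>lborel)"
      by (simp add: nn_integral_cmult_indicator)
    also have "\<dots> \<le> (\<integral>\<^sup>+y\<in>ball x 1. cmod (u y) powr q \<partial>lborel)"
      using rho q 3(1) by (intro nn_integral_mono)
        (auto simp: A_def B_def indicator_def intro!: ennreal_leI powr_mono2)
    also note loc
    finally have "ennreal ((t / 2) powr q) * emeasure lborel A \<le> ennreal \<delta>" .
    then have "ennreal (2 powr q / t powr q) * (ennreal ((t / 2) powr q) * emeasure lborel A)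
        \<le> ennreal (2 powr q / t powr q) * ennreal \<delta>" by (intro mult_left_mono) auto
    also have "ennreal (2 powr q / t powr q) * (ennreal ((t / 2) powr q) * emeasure lborel A) = emeasure lborel A"
      using 3(1) by (simp add: mult.assoc[symmetric] ennreal_mult[symmetric] powr_divide)
    also have "ennreal (2 powr q / t powr q) * ennreal \<delta> = ennreal (V * \<rho> ^ 3 / 2)"
      using \<delta> V_pos unfolding r3 C_def by (simp add: ennreal_mult[symmetric] powr_add field_simps)
    finally have A: "emeasure lborel A \<le> ennreal (V * \<rho> ^ 3 / 2)" .
    have BA: "ennreal (V * \<rho> ^ 3 / 2) \<le> emeasure lborel (B - A)"
    proof (rule ccontr)
      assume "\<not> ?thesis"
      then have less: "emeasure lborel (B - A) < ennreal (V * \<rho> ^ 3 / 2)" by simp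
      have "ennreal (V * \<rho> ^ 3) = emeasure lborel B" using rho by (simp add: B_def emeasure_ball3)
      also have "\<dots> \<le> emeasure lborel A + emeasure lborel (B - A)"
        by (rule order_trans[OF emeasure_mono emeasure_subadditive]) auto
      also have "\<dots> \<le> ennreal (V * \<rho> ^ 3 / 2) + emeasure lborel (B - A)"
        by (intro add_right_mono A)
      also have "\<dots> < ennreal (V * \<rho> ^ 3 / 2) + ennreal (V * \<rho> ^ 3 / 2)"
        using less by (simp add: ennreal_add_left_cancel_less)
      also have "\<dots> = ennreal (V * \<rho> ^ 3)" using V_pos rho by (simp flip: ennreal_plus)
      finally show False by simp
    qed
    define D where "D = t\<^sup>2 / 4 * (c\<^sub>0 * \<rho> powr - (3 + 2 * s))"
    have D: "0 \<le> D" using c0 by (simp add: D_def)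
    have "ennreal (D * (V * \<rho> ^ 3 / 2)) \<le> ennreal D * emeasure lborel (B - A)"
      unfolding ennreal_mult'[OF D] by (intro mult_left_mono BA) simp
    also have "\<dots> = (\<integral>\<^sup>+y\<in>B - A. ennreal D \<partial>lborel)" by (simp add: nn_integral_cmult_indicator)
    also have "\<dots> \<le> density u x"
      unfolding density_def
    proof (intro nn_integral_mono)
      fix y
      show "ennreal D * indicator (B - A) y \<le> ennreal ((cmod (u x - u y))\<^sup>2 * J (x - y))"
      proof (cases "y \<in> B - A")
        case True
        then have y: "cmod (u y) < t / 2" "norm (x - y) < \<rho>" by (auto simp: A_def B_def dist_norm)
        have "t \<le> cmod (u x - u y) + cmod (u y)" unfolding t_def using norm_triangle_ineq[of "u x - u y" "u y"] by simp
        then have d: "t / 2 \<le> cmod (u x - u y)" using y by simp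
        have ne: "0 < norm (x - y)" using y 3(1) by (auto simp: t_def)
        have "(t / 2)\<^sup>2 * (c\<^sub>0 * \<rho> powr - (3 + 2 * s)) \<le> (cmod (u x - u y))\<^sup>2 * (c\<^sub>0 * norm (x - y) powr - (3 + 2 * s))"
          using d y ne s c0 3(1) by (intro mult_mono power_mono powr_mono2') auto
        also have "\<dots> \<le> (cmod (u x - u y))\<^sup>2 * J (x - y)"
          using ne y rho by (intro mult_left_mono J_lower) auto
        finally show ?thesis using True by (auto simp: D_def power_divide intro!: ennreal_leI)
      qed simp
    qed
    finally have dens: "ennreal (D * (V * \<rho> ^ 3 / 2)) \<le> density u x" .
    have rp: "\<rho> powr - (3 + 2 * s) * \<rho> ^ 3 = (C * \<delta> / t powr q) powr (- (2 * s / 3))"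
    proof -
      have "\<rho> ^ 3 = \<rho> powr 3" using rho by simp
      then have "\<rho> powr - (3 + 2 * s) * \<rho> ^ 3 = \<rho> powr (- (2 * s))"
        by (simp only: powr_add[symmetric]) simp
      also have "\<dots> = (C * \<delta> / t powr q) powr (- (2 * s / 3))"
        by (simp add: \<rho>_def powr_powr)
      finally show ?thesis .
    qed
    have "t powr (2 + 2 * s * q / 3) = (8 / (c\<^sub>0 * V)) * (C * \<delta>) powr (2 * s / 3) * (D * (V * \<rho> ^ 3 / 2))"
    proof -
      have "D * (V * \<rho> ^ 3 / 2) = t\<^sup>2 * c\<^sub>0 * V / 8 * (\<rho> powr - (3 + 2 * s) * \<rho> ^ 3)"
        by (simp add: D_def)
      also have "\<dots> = t\<^sup>2 * c\<^sub>0 * V / 8 * ((t powr q) powr (2 * s / 3) / (C * \<delta>) powr (2 * s / 3))"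
        unfolding rp using C \<delta> 3(1) by (simp add: powr_minus powr_divide)
      finally show ?thesis
        unfolding base[OF 3(1)] using c0 V_pos C \<delta> by simp
    qed
    also have "\<dots> \<le> sob_const q * \<delta> powr (2 * s / 3) * (D * (V * \<rho> ^ 3 / 2))"
    proof (rule mult_right_mono)
      have "8 / (c\<^sub>0 * V) * (C * \<delta>) powr (2 * s / 3) \<le> max 1 (8 / (c\<^sub>0 * V)) * (C powr (2 * s / 3) * \<delta> powr (2 * s / 3))"
        unfolding powr_mult by (rule mult_right_mono) auto
      then show "8 / (c\<^sub>0 * V) * (C * \<delta>) powr (2 * s / 3) \<le> sob_const q * \<delta> powr (2 * s / 3)"
        by (simp add: sob_const_def C_def mult_ac)
      show "0 \<le> D * (V * \<rho> ^ 3 / 2)" using D V_pos rho by simp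
    qed
    finally have "ennreal (t powr (2 + 2 * s * q / 3)) \<le> ennreal (sob_const q * \<delta> powr (2 * s / 3)) * ennreal (D * (V * \<rho> ^ 3 / 2))"
      using sob_const_pos[of q] D V_pos rho
      by (subst ennreal_mult[symmetric]) (auto intro!: ennreal_leI)
    also have "\<dots> \<le> ennreal (sob_const q * \<delta> powr (2 * s / 3)) * (density u x + ennreal (t\<^sup>2))"
      using dens by (intro mult_left_mono order_trans[OF dens]) auto
    finally show ?thesis by (simp add: t_def)
  qed
qed

lemma nn_integral_power_le_energy:
  assumes [measurable]: "u \<in> borel_measurable borel" and q: "0 < q" and \<delta>: "0 < \<delta>"
    and loc: "\<And>x. (\<integral>\<^sup>+y\<in>ball x 1. cmod (u y) powr q \<partial>lborel) \<le> ennreal \<delta>"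
  shows "(\<integral>\<^sup>+x. cmod (u x) powr (2 + 2 * s * q / 3) \<partial>lborel)
      \<le> ennreal (sob_const q * \<delta> powr (2 * s / 3)) * energy u"
proof -
  have "(\<integral>\<^sup>+x. cmod (u x) powr (2 + 2 * s * q / 3) \<partial>lborel) \<le>
     (\<integral>\<^sup>+x. ennreal (sob_const q * \<delta> powr (2 * s / 3)) * (density u x + ennreal ((cmod (u x))\<^sup>2)) \<partial>lborel)"
    by (intro nn_integral_mono power_le_density assms)
  also have "\<dots> = ennreal (sob_const q * \<delta> powr (2 * s / 3)) * energy u"
    by (simp add: nn_integral_cmult nn_integral_density_energy)
  finally show ?thesis .
qed

text \<open>
  The exponents reached by iterating \<open>nn_integral_power_le_energy\<close> from \<open>L\<^sup>2\<close>. The fixed point of the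
  recursion is the critical exponent \<open>6 / (3 - 2 s)\<close>.
\<close>
primrec sob_exp :: "nat \<Rightarrow> real" where
  "sob_exp 0 = 2"
| "sob_exp (Suc k) = 2 + 2 * s * sob_exp k / 3"

lemma sob_exp_pos: "0 < sob_exp k"
  using s by (induction k) (auto intro: add_pos_pos)

lemma sob_exp_tendsto: "sob_exp \<longlonglongrightarrow> 6 / (3 - 2 * s)"
proof -
  define L where "L = 6 / (3 - 2 * s)"
  have L: "2 + (2 * s / 3) * L = L" using s by (simp add: L_def field_simps)
  have eq: "sob_exp k = 6 / (3 - 2 * s) * (1 - (2 * s / 3) ^ Suc k)" for k
    unfolding L_def[symmetric]
  proof (induction k)
    case 0
    show ?case using L by (simp add: algebra_simps)
  next
    case (Suc k)
    have "sob_exp (Suc k) = 2 + (2 * s / 3) * (L * (1 - (2 * s / 3) ^ Suc k))"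
      using Suc by simp
    also have "\<dots> = (2 + (2 * s / 3) * L) - L * (2 * s / 3) ^ Suc (Suc k)" by (simp add: algebra_simps)
    also have "\<dots> = L * (1 - (2 * s / 3) ^ Suc (Suc k))" unfolding L by (simp add: algebra_simps)
    finally show ?case .
  qed
  have "(\<lambda>k. 6 / (3 - 2 * s) * (1 - (2 * s / 3) ^ Suc k)) \<longlonglongrightarrow> 6 / (3 - 2 * s) * (1 - 0)"
    using s by (intro tendsto_intros LIMSEQ_Suc LIMSEQ_power_zero) auto
  then show ?thesis unfolding eq[symmetric] by simp
qed

lemma sobolev_exp:
  assumes "0 \<le> K"
  shows "\<exists>B\<ge>0. \<forall>u\<in>borel_measurable borel. energy u \<le> ennreal K \<longrightarrow>
     (\<integral>\<^sup>+x. cmod (u x) powr sob_exp k \<partial>lborel) \<le> ennreal B"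
proof (induction k)
  case 0
  have "(\<integral>\<^sup>+x. cmod (u x) powr 2 \<partial>lborel) \<le> energy u" for u
    unfolding energy_def by simp
  then show ?case using assms by (intro exI[of _ K]) (auto intro: order_trans)
next
  case (Suc k)
  then obtain B where B: "0 \<le> B" "\<And>u. u \<in> borel_measurable borel \<Longrightarrow> energy u \<le> ennreal K \<Longrightarrow>
     (\<integral>\<^sup>+x. cmod (u x) powr sob_exp k \<partial>lborel) \<le> ennreal B" by blast
  let ?C = "sob_const (sob_exp k) * (B + 1) powr (2 * s / 3)"
  show ?case
  proof (intro exI[of _ "?C * K"] conjI ballI impI)
    show "0 \<le> ?C * K" using assms sob_const_pos[of "sob_exp k"] by simp
    fix u assume u: "u \<in> borel_measurable borel" "energy u \<le> ennreal K"
    have "(\<integral>\<^sup>+y\<in>ball x 1. cmod (u y) powr sob_exp k \<partial>lborel) \<le> ennreal (B + 1)" for x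
    proof -
      have "(\<integral>\<^sup>+y\<in>ball x 1. cmod (u y) powr sob_exp k \<partial>lborel) \<le> (\<integral>\<^sup>+y. cmod (u y) powr sob_exp k \<partial>lborel)"
        by (intro nn_integral_mono) (auto simp: indicator_def)
      also have "\<dots> \<le> ennreal B" by (rule B(2)[OF u])
      also have "\<dots> \<le> ennreal (B + 1)" by (intro ennreal_leI) simp
      finally show ?thesis .
    qed
    then have "(\<integral>\<^sup>+x. cmod (u x) powr (2 + 2 * s * sob_exp k / 3) \<partial>lborel) \<le> ennreal ?C * energy u"
      using u B(1) sob_exp_pos by (intro nn_integral_power_le_energy) auto
    also have "\<dots> \<le> ennreal ?C * ennreal K" using u by (intro mult_left_mono) auto
    also have "\<dots> = ennreal (?C * K)" using assms sob_const_pos[of "sob_exp k"] by (simp add: ennreal_mult)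
    finally show "(\<integral>\<^sup>+x. cmod (u x) powr sob_exp (Suc k) \<partial>lborel) \<le> ennreal (?C * K)" by simp
  qed
qed

lemma powr_interpolation:
  fixes t :: real
  assumes "0 \<le> t" "a \<le> q" "q \<le> b"
  shows "t powr q \<le> t powr a + t powr b"
proof (cases "t \<le> 1")
  case True
  then have "t powr q \<le> t powr a" using assms by (intro powr_mono') auto
  then show ?thesis by (simp add: add_increasing2)
next
  case False
  then have "t powr q \<le> t powr b" using assms by (intro powr_mono) auto
  then show ?thesis by (simp add: add_increasing)
qed

lemma sobolev_embedding:
  assumes "0 \<le> K" and q: "2 \<le> q" "q < 6 / (3 - 2 * s)"
  shows "\<exists>B\<ge>0. \<forall>u\<in>borel_measurable borel. energy u \<le> ennreal K \<longrightarrow>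
     (\<integral>\<^sup>+x. cmod (u x) powr q \<partial>lborel) \<le> ennreal B"
proof -
  obtain k where k: "q < sob_exp k"
    using order_tendstoD(1)[OF sob_exp_tendsto q(2)] eventually_happens by fastforce
  obtain B where B: "0 \<le> B" "\<And>u. u \<in> borel_measurable borel \<Longrightarrow> energy u \<le> ennreal K \<Longrightarrow>
     (\<integral>\<^sup>+x. cmod (u x) powr sob_exp k \<partial>lborel) \<le> ennreal B" using sobolev_exp[OF assms(1)] by blast
  show ?thesis
  proof (intro exI[of _ "K + B"] conjI ballI impI)
    show "0 \<le> K + B" using assms B by simp
    fix u assume u [measurable]: "u \<in> borel_measurable borel" and uK: "energy u \<le> ennreal K"
    have "(\<integral>\<^sup>+x. cmod (u x) powr q \<partial>lborel) \<le> (\<integral>\<^sup>+x. ennreal (cmod (u x) powr 2) + ennreal (cmod (u x) powr sob_exp k) \<partial>lborel)"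
      using powr_interpolation[OF norm_ge_zero q(1) less_imp_le[OF k]]
      by (intro nn_integral_mono) (simp flip: ennreal_plus)
    also have "\<dots> = (\<integral>\<^sup>+x. ennreal (cmod (u x) powr 2) \<partial>lborel) + (\<integral>\<^sup>+x. ennreal (cmod (u x) powr sob_exp k) \<partial>lborel)"
      by (intro nn_integral_add) auto
    also have "\<dots> \<le> ennreal K + ennreal B"
      using B(2)[OF u uK] uK by (intro add_mono order_trans[OF _ uK]) (auto simp: energy_def)
    also have "\<dots> = ennreal (K + B)" using assms B by simp
    finally show "(\<integral>\<^sup>+x. cmod (u x) powr q \<partial>lborel) \<le> ennreal (K + B)" .
  qed
qed

lemma powr_interpolation_small:
  fixes \<eta> :: real
  assumes eta: "0 < \<eta>" and q: "a < q" "q < b" "0 < c"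
  shows "\<exists>C\<ge>0. \<forall>t\<ge>0. t powr q \<le> \<eta> * t powr a + \<eta> * t powr b + C * t powr c"
proof -
  define t0 t1 where "t0 = \<eta> powr (1 / (q - a))" and "t1 = \<eta> powr (- 1 / (b - q))"
  have t01: "0 < t0" "0 < t1" using eta by (auto simp: t0_def t1_def)
  have t0: "t0 powr (q - a) = \<eta>" and t1: "t1 powr (q - b) = \<eta>"
  proof -
    show "t0 powr (q - a) = \<eta>" using eta q by (simp add: t0_def powr_powr)
    have "- 1 / (b - q) * (q - b) = 1" using q by (simp add: field_simps)
    then show "t1 powr (q - b) = \<eta>" using eta by (simp add: t1_def powr_powr)
  qed
  define C where "C = max (t0 powr (q - c)) (t1 powr (q - c))"
  show ?thesis
  proof (intro exI[of _ C] conjI allI impI)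
    show "0 \<le> C" by (simp add: C_def max_def)
    fix t :: real assume t: "0 \<le> t"
    have nn: "0 \<le> \<eta> * t powr a" "0 \<le> \<eta> * t powr b" "0 \<le> C * t powr c"
      using eta \<open>0 \<le> C\<close> by auto
    consider "t = 0" | "0 < t" "t \<le> t0" | "0 < t" "t1 \<le> t" | "t0 < t" "t < t1" using t by linarith
    then show "t powr q \<le> \<eta> * t powr a + \<eta> * t powr b + C * t powr c"
    proof cases
      case 1 then show ?thesis using nn by simp
    next
      case 2
      have "t powr q = t powr (q - a) * t powr a" by (simp add: powr_add[symmetric])
      also have "\<dots> \<le> t0 powr (q - a) * t powr a" using 2 q by (intro mult_right_mono powr_mono2) auto
      finally show ?thesis using nn t0 by simp
    next
      case 3
      have "t powr q = t powr (q - b) * t powr b" by (simp add: powr_add[symmetric])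
      also have "\<dots> \<le> t1 powr (q - b) * t powr b" using 3 q t01 by (intro mult_right_mono powr_mono2') auto
      finally show ?thesis using nn t1 by simp
    next
      case 4
      have "t powr (q - c) \<le> C"
      proof (cases "0 \<le> q - c")
        case True
        then have "t powr (q - c) \<le> t1 powr (q - c)" using 4 t by (intro powr_mono2) auto
        then show ?thesis by (simp add: C_def)
      next
        case False
        then have "t powr (q - c) \<le> t0 powr (q - c)" using 4 t t01 by (intro powr_mono2') auto
        then show ?thesis by (simp add: C_def)
      qed
      then have "t powr (q - c) * t powr c \<le> C * t powr c" by (intro mult_right_mono) auto
      then show ?thesis using nn by (simp add: powr_add[symmetric])
    qed
  qed
qed

text \<open>
  If no unit ball carries more than \<open>\<delta>\<close> of the mass, one step from \<open>q = 2\<close> bounds the integral of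
  \<open>\<bar>u\<bar>\<^sup>c\<close>, \<open>c = 2 + 4 s / 3\<close>, by a multiple of \<open>\<delta>\<^sup>2\<^sup>s\<^sup>/\<^sup>3\<close>. Interpolation between \<open>2\<close>, \<open>c\<close> and a
  subcritical \<open>b > q\<close> carries the smallness to all exponents in between.
\<close>
lemma vanishing:
  assumes "0 \<le> K" and q: "2 < q" "q < 6 / (3 - 2 * s)" and eps: "0 < \<epsilon>"
  shows "\<exists>\<delta>>0. \<forall>u\<in>borel_measurable borel. energy u \<le> ennreal K \<longrightarrow>
     (\<forall>x. (\<integral>\<^sup>+y\<in>ball x 1. (cmod (u y))\<^sup>2 \<partial>lborel) \<le> ennreal \<delta>) \<longrightarrow>
     (\<integral>\<^sup>+x. cmod (u x) powr q \<partial>lborel) \<le> ennreal \<epsilon>"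
proof -
  define b where "b = (q + 6 / (3 - 2 * s)) / 2"
  have b: "q < b" "b < 6 / (3 - 2 * s)" using q(2) by (auto simp: b_def)
  define c where "c = 2 + 2 * s * 2 / 3"
  have c: "0 < c" using s by (simp add: c_def)
  obtain B where B: "0 \<le> B" "\<And>u. u \<in> borel_measurable borel \<Longrightarrow> energy u \<le> ennreal K \<Longrightarrow>
     (\<integral>\<^sup>+x. cmod (u x) powr b \<partial>lborel) \<le> ennreal B" using sobolev_embedding[OF assms(1), of b] q b by auto
  define \<eta> where "\<eta> = \<epsilon> / (2 * (K + B + 1))"
  have eta: "0 < \<eta>" "\<eta> * K + \<eta> * B \<le> \<epsilon> / 2"
  proof -
    show "0 < \<eta>" using eps assms B by (simp add: \<eta>_def)
    have "\<eta> * K + \<eta> * B \<le> \<eta> * (K + B + 1)" using \<open>0 < \<eta>\<close> by (simp add: algebra_simps)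
    also have "\<dots> = \<epsilon> / 2" using assms B by (simp add: \<eta>_def field_simps)
    finally show "\<eta> * K + \<eta> * B \<le> \<epsilon> / 2" .
  qed
  obtain C where C: "0 \<le> C" "\<And>t. 0 \<le> t \<Longrightarrow> t powr q \<le> \<eta> * t powr 2 + \<eta> * t powr b + C * t powr c"
    using powr_interpolation_small[OF eta(1) q(1) b(1) c] by blast
  define D where "D = C * sob_const 2 * K + 1"
  have D: "0 < D" using C sob_const_pos[of 2] assms by (auto simp: D_def intro!: add_nonneg_pos)
  define \<delta> where "\<delta> = (\<epsilon> / (2 * D)) powr (3 / (2 * s))"
  have delta: "0 < \<delta>" "\<delta> powr (2 * s / 3) = \<epsilon> / (2 * D)"
    using eps D s by (auto simp: \<delta>_def powr_powr)
  show ?thesis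
  proof (intro exI[of _ \<delta>] conjI ballI impI delta)
    fix u assume u [measurable]: "u \<in> borel_measurable borel" and uK: "energy u \<le> ennreal K"
      and loc: "\<forall>x. (\<integral>\<^sup>+y\<in>ball x 1. (cmod (u y))\<^sup>2 \<partial>lborel) \<le> ennreal \<delta>"
    have loc': "(\<integral>\<^sup>+y\<in>ball x 1. cmod (u y) powr 2 \<partial>lborel) \<le> ennreal \<delta>" for x
      using loc by simp
    have "(\<integral>\<^sup>+x. cmod (u x) powr c \<partial>lborel) \<le> ennreal (sob_const 2 * \<delta> powr (2 * s / 3)) * energy u"
      unfolding c_def by (intro nn_integral_power_le_energy loc' delta) auto
    also have "\<dots> \<le> ennreal (sob_const 2 * (\<epsilon> / (2 * D))) * ennreal K"
      unfolding delta by (intro mult_left_mono uK) auto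
    finally have c1: "(\<integral>\<^sup>+x. cmod (u x) powr c \<partial>lborel) \<le> ennreal (sob_const 2 * (\<epsilon> / (2 * D)) * K)"
      by (subst (asm) ennreal_mult''[symmetric]) (use assms in auto)
    have "(\<integral>\<^sup>+x. cmod (u x) powr q \<partial>lborel) \<le>
        (\<integral>\<^sup>+x. ennreal \<eta> * ennreal (cmod (u x) powr 2) + ennreal \<eta> * ennreal (cmod (u x) powr b)
           + ennreal C * ennreal (cmod (u x) powr c) \<partial>lborel)"
      using C eta(1) by (intro nn_integral_mono) (simp add: ennreal_mult[symmetric] ennreal_plus[symmetric] del: ennreal_plus)
    also have "\<dots> = ennreal \<eta> * (\<integral>\<^sup>+x. ennreal (cmod (u x) powr 2) \<partial>lborel) +
       ennreal \<eta> * (\<integral>\<^sup>+x. ennreal (cmod (u x) powr b) \<partial>lborel) + ennreal C * (\<integral>\<^sup>+x. ennreal (cmod (u x) powr c) \<partial>lborel)"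
      by (subst nn_integral_add, simp, simp)+ (simp add: nn_integral_cmult)
    also have "\<dots> \<le> ennreal \<eta> * ennreal K + ennreal \<eta> * ennreal B + ennreal C * ennreal (sob_const 2 * (\<epsilon> / (2 * D)) * K)"
      using B(2)[OF u uK] uK c1
      by (intro add_mono mult_left_mono) (auto simp: energy_def intro: order_trans[OF _ uK])
    also have "\<dots> = ennreal (\<eta> * K + \<eta> * B + C * (sob_const 2 * (\<epsilon> / (2 * D)) * K))"
      using C assms B eta(1) eps D sob_const_pos[of 2] by (simp add: ennreal_mult[symmetric] ennreal_plus[symmetric] del: ennreal_plus)
    also have "\<dots> \<le> ennreal \<epsilon>"
    proof (intro ennreal_leI)
      have "C * (sob_const 2 * (\<epsilon> / (2 * D)) * K) = (C * sob_const 2 * K) * (\<epsilon> / (2 * D))" by simp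
      also have "\<dots> \<le> D * (\<epsilon> / (2 * D))" using eps D by (intro mult_right_mono) (auto simp: D_def)
      also have "\<dots> = \<epsilon> / 2" using D by simp
      finally show "\<eta> * K + \<eta> * B + C * (sob_const 2 * (\<epsilon> / (2 * D)) * K) \<le> \<epsilon>" using eta(2) by linarith
    qed
    finally show "(\<integral>\<^sup>+x. cmod (u x) powr q \<partial>lborel) \<le> ennreal \<epsilon>" .
  qed
qed

end

section \<open>Calculus of the energy\<close>
lemma liminf_add_ennreal:
  fixes a b :: "nat \<Rightarrow> ennreal"
  shows "liminf a + liminf b \<le> liminf (\<lambda>n. a n + b n)"
proof -
  have inc: "incseq (\<lambda>n. INF m\<in>{n..}. c m)" for c :: "nat \<Rightarrow> ennreal"
    by (intro monoI INF_superset_mono) auto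
  have "liminf a + liminf b = (SUP n. (INF m\<in>{n..}. a m) + (INF m\<in>{n..}. b m))"
    unfolding liminf_SUP_INF by (rule ennreal_SUP_add[symmetric]) (rule inc)+
  also have "\<dots> \<le> liminf (\<lambda>n. a n + b n)"
    unfolding liminf_SUP_INF
    by (intro SUP_mono bexI INF_greatest add_mono INF_lower) auto
  finally show ?thesis .
qed

context gagliardo_energy
begin

lemma energy_cmult:
  assumes [measurable]: "u \<in> borel_measurable borel"
  shows "energy (\<lambda>x. c * u x) = ennreal ((cmod c)\<^sup>2) * energy u"
proof -
  have 1: "ennreal ((cmod (c * u x - c * u y))\<^sup>2 * J (x - y)) = ennreal ((cmod c)\<^sup>2) * ennreal ((cmod (u x - u y))\<^sup>2 * J (x - y))" for x y
    using J_nonneg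
    by (subst ennreal_mult[symmetric]) (auto simp: right_diff_distrib[symmetric] norm_mult power_mult_distrib)
  have 2: "ennreal ((cmod (c * u x))\<^sup>2) = ennreal ((cmod c)\<^sup>2) * ennreal ((cmod (u x))\<^sup>2)" for x
    by (simp add: norm_mult power_mult_distrib ennreal_mult)
  show ?thesis
    unfolding energy_def 1 2 split_beta' distrib_left by (simp add: nn_integral_cmult)
qed

lemma energy_add_le:
  assumes [measurable]: "u \<in> borel_measurable borel" "v \<in> borel_measurable borel"
  shows "energy (\<lambda>x. u x + v x) \<le> 2 * energy u + 2 * energy v"
proof -
  have sq: "(cmod (a + b))\<^sup>2 \<le> 2 * (cmod a)\<^sup>2 + 2 * (cmod b)\<^sup>2" for a b
  proof -
    have "(cmod (a + b))\<^sup>2 \<le> (cmod a + cmod b)\<^sup>2" by (intro power_mono norm_triangle_ineq) auto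
    also have "\<dots> \<le> 2 * (cmod a)\<^sup>2 + 2 * (cmod b)\<^sup>2"
      using zero_le_power2[of "cmod a - cmod b"] by (simp add: power2_eq_square algebra_simps)
    finally show ?thesis .
  qed
  have "(\<integral>\<^sup>+(x, y). ennreal ((cmod (u x + v x - (u y + v y)))\<^sup>2 * J (x - y)) \<partial>(lborel \<Otimes>\<^sub>M lborel))
      \<le> (\<integral>\<^sup>+z. 2 * ennreal ((cmod (u (fst z) - u (snd z)))\<^sup>2 * J (fst z - snd z))
          + 2 * ennreal ((cmod (v (fst z) - v (snd z)))\<^sup>2 * J (fst z - snd z)) \<partial>(lborel \<Otimes>\<^sub>M lborel))"
    unfolding split_beta'
  proof (intro nn_integral_mono)
    fix z :: "(real^3) \<times> (real^3)"
    have "(cmod (u (fst z) + v (fst z) - (u (snd z) + v (snd z))))\<^sup>2 * J (fst z - snd z) \<le>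
      (2 * (cmod (u (fst z) - u (snd z)))\<^sup>2 + 2 * (cmod (v (fst z) - v (snd z)))\<^sup>2) * J (fst z - snd z)"
      using sq[of "u (fst z) - u (snd z)" "v (fst z) - v (snd z)"] J_nonneg
      by (intro mult_right_mono) (auto simp: algebra_simps)
    then have "ennreal ((cmod (u (fst z) + v (fst z) - (u (snd z) + v (snd z))))\<^sup>2 * J (fst z - snd z)) \<le>
      ennreal (2 * ((cmod (u (fst z) - u (snd z)))\<^sup>2 * J (fst z - snd z)) + 2 * ((cmod (v (fst z) - v (snd z)))\<^sup>2 * J (fst z - snd z)))"
      by (intro ennreal_leI) (simp add: algebra_simps)
    then show "ennreal ((cmod (u (fst z) + v (fst z) - (u (snd z) + v (snd z))))\<^sup>2 * J (fst z - snd z)) \<le>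
      2 * ennreal ((cmod (u (fst z) - u (snd z)))\<^sup>2 * J (fst z - snd z)) + 2 * ennreal ((cmod (v (fst z) - v (snd z)))\<^sup>2 * J (fst z - snd z))"
      using J_nonneg by (simp add: ennreal_mult')
  qed
  moreover have "(\<integral>\<^sup>+x. (cmod (u x + v x))\<^sup>2 \<partial>lborel) \<le> (\<integral>\<^sup>+x. 2 * ennreal ((cmod (u x))\<^sup>2) + 2 * ennreal ((cmod (v x))\<^sup>2) \<partial>lborel)"
  proof (intro nn_integral_mono)
    fix x
    have "ennreal ((cmod (u x + v x))\<^sup>2) \<le> ennreal (2 * (cmod (u x))\<^sup>2 + 2 * (cmod (v x))\<^sup>2)"
      by (intro ennreal_leI sq)
    then show "ennreal ((cmod (u x + v x))\<^sup>2) \<le> 2 * ennreal ((cmod (u x))\<^sup>2) + 2 * ennreal ((cmod (v x))\<^sup>2)"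
      by (simp add: ennreal_mult')
  qed
  ultimately have "energy (\<lambda>x. u x + v x) \<le>
      (\<integral>\<^sup>+z. 2 * ennreal ((cmod (u (fst z) - u (snd z)))\<^sup>2 * J (fst z - snd z))
          + 2 * ennreal ((cmod (v (fst z) - v (snd z)))\<^sup>2 * J (fst z - snd z)) \<partial>(lborel \<Otimes>\<^sub>M lborel))
      + (\<integral>\<^sup>+x. 2 * ennreal ((cmod (u x))\<^sup>2) + 2 * ennreal ((cmod (v x))\<^sup>2) \<partial>lborel)"
    unfolding energy_def by (rule add_mono)
  also have "\<dots> = 2 * energy u + 2 * energy v"
    unfolding energy_def split_beta'
    by (simp add: nn_integral_add nn_integral_cmult distrib_left add_ac)
  finally show ?thesis .
qed

lemma energy_diff:
  assumes "u \<in> borel_measurable borel" "v \<in> borel_measurable borel"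
  shows "energy (\<lambda>x. u x - v x) \<le> 2 * energy u + 2 * energy v"
proof -
  have "energy (\<lambda>x. - 1 * v x) = energy v" using assms by (subst energy_cmult) auto
  moreover have "(\<lambda>x. - 1 * v x) \<in> borel_measurable borel" using assms by measurable
  ultimately show ?thesis using energy_add_le[OF assms(1), of "\<lambda>x. - 1 * v x"] by simp
qed

lemma energy_diff_finite:
  assumes "u \<in> borel_measurable borel" "v \<in> borel_measurable borel" "energy u < \<infinity>" "energy v < \<infinity>"
  shows "energy (\<lambda>x. u x - v x) < \<infinity>"
  using assms by (intro le_less_trans[OF energy_diff]) (auto simp: ennreal_mult_less_top)

lemma energy_shift:
  assumes [measurable]: "u \<in> borel_measurable borel"
  shows "energy (\<lambda>x. u (x + z)) = energy u"
proof -
  have "density (\<lambda>x. u (x + z)) x = density u (x + z)" for x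
    using nn_integral_lborel_diff(3)[of "\<lambda>y. ennreal ((cmod (u (x + z) - u y))\<^sup>2 * J (x + z - y))" z]
    by (simp add: density_def)
  then have "energy (\<lambda>x. u (x + z)) = (\<integral>\<^sup>+x. density u (x + z) + ennreal ((cmod (u (x + z)))\<^sup>2) \<partial>lborel)"
    by (subst nn_integral_density_energy[symmetric]) simp_all
  also have "\<dots> = energy u"
    using nn_integral_lborel_diff(3)[of "\<lambda>x. density u x + ennreal ((cmod (u x))\<^sup>2)" z]
    by (simp add: nn_integral_density_energy)
  finally show ?thesis .
qed

lemma energy_eq_0D:
  assumes [measurable]: "u \<in> borel_measurable borel" and "energy u = 0"
  shows "AE x in lborel. u x = 0"
proof -
  have "(\<integral>\<^sup>+x. (cmod (u x))\<^sup>2 \<partial>lborel) = 0" using assms(2) by (simp add: energy_def)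
  then have "AE x in lborel. ennreal ((cmod (u x))\<^sup>2) = 0" by (subst (asm) nn_integral_0_iff_AE) auto
  then show ?thesis by eventually_elim simp
qed

lemma energy_liminf:
  assumes [measurable]: "\<And>n. u n \<in> borel_measurable borel" "v \<in> borel_measurable borel"
    and lim: "AE x in lborel. (\<lambda>n. u n x) \<longlonglongrightarrow> v x" and K: "\<And>n. energy (u n) \<le> K"
  shows "energy v \<le> K"
proof -
  let ?P = "lborel \<Otimes>\<^sub>M lborel :: ((real^3) \<times> (real^3)) measure"
  let ?f = "\<lambda>u z. ennreal ((cmod (u (fst z) - u (snd z)))\<^sup>2 * J (fst z - snd z))"
  have "(\<integral>\<^sup>+z. ?f v z \<partial>?P) = (\<integral>\<^sup>+z. liminf (\<lambda>n. ?f (u n) z) \<partial>?P)"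
  proof (intro nn_integral_cong_AE)
    show "AE z in ?P. ?f v z = liminf (\<lambda>n. ?f (u n) z)"
      using AE_lborel_pairI[OF lim]
      by eventually_elim (intro lim_imp_Liminf[symmetric] tendsto_intros; simp)
  qed
  also have "\<dots> \<le> liminf (\<lambda>n. \<integral>\<^sup>+z. ?f (u n) z \<partial>?P)" by (intro nn_integral_liminf) auto
  finally have 1: "(\<integral>\<^sup>+z. ?f v z \<partial>?P) \<le> liminf (\<lambda>n. \<integral>\<^sup>+z. ?f (u n) z \<partial>?P)" .
  have "(\<integral>\<^sup>+x. ennreal ((cmod (v x))\<^sup>2) \<partial>lborel) = (\<integral>\<^sup>+x. liminf (\<lambda>n. ennreal ((cmod (u n x))\<^sup>2)) \<partial>lborel)"
  proof (intro nn_integral_cong_AE)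
    show "AE x in lborel. ennreal ((cmod (v x))\<^sup>2) = liminf (\<lambda>n. ennreal ((cmod (u n x))\<^sup>2))"
      using lim by eventually_elim (intro lim_imp_Liminf[symmetric] tendsto_intros; simp)
  qed
  also have "\<dots> \<le> liminf (\<lambda>n. \<integral>\<^sup>+x. ennreal ((cmod (u n x))\<^sup>2) \<partial>lborel)" by (intro nn_integral_liminf) auto
  finally have 2: "(\<integral>\<^sup>+x. ennreal ((cmod (v x))\<^sup>2) \<partial>lborel) \<le> liminf (\<lambda>n. \<integral>\<^sup>+x. ennreal ((cmod (u n x))\<^sup>2) \<partial>lborel)" .
  have "energy v \<le> liminf (\<lambda>n. \<integral>\<^sup>+z. ?f (u n) z \<partial>?P) + liminf (\<lambda>n. \<integral>\<^sup>+x. ennreal ((cmod (u n x))\<^sup>2) \<partial>lborel)"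
    unfolding energy_def split_beta' by (intro add_mono 1 2)
  also have "\<dots> \<le> liminf (\<lambda>n. energy (u n))"
    unfolding energy_def split_beta'
    by (rule liminf_add_ennreal)
  also have "\<dots> \<le> liminf (\<lambda>n. K)" by (intro Liminf_mono always_eventually allI K)
  also have "\<dots> = K" by (simp add: Liminf_const)
  finally show ?thesis .
qed

text \<open>
  Both parts of the energy are squares of \<open>L\<^sup>2\<close> norms: the double integral is that of
  \<open>(u(x) - u(y)) \<surd>J(x - y)\<close>. So \<open>square_split_tendsto_0\<close> applies to each.
\<close>
lemma energy_split:
  assumes [measurable]: "b \<in> borel_measurable borel" "\<And>n. w n \<in> borel_measurable borel"
    and b: "energy b < \<infinity>" and w: "\<And>n. energy (w n) \<le> K" and K: "K < \<infinity>"
    and lim: "AE x in lborel. (\<lambda>n. w n x) \<longlonglongrightarrow> 0"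
  shows "(\<lambda>n. enn2real (energy (\<lambda>x. b x + w n x)) - enn2real (energy (w n))) \<longlonglongrightarrow> enn2real (energy b)"
proof -
  let ?P = "lborel \<Otimes>\<^sub>M lborel :: ((real^3) \<times> (real^3)) measure"
  define F where "F u z = (u (fst z) - u (snd z)) * complex_of_real (sqrt (J (fst z - snd z)))" for u z
  have Fm [measurable]: "F u \<in> borel_measurable ?P" if [measurable]: "u \<in> borel_measurable borel" for u
    unfolding F_def by measurable
  have F2: "(cmod (F u z))\<^sup>2 = (cmod (u (fst z) - u (snd z)))\<^sup>2 * J (fst z - snd z)" for u z
    using J_nonneg by (simp add: F_def norm_mult power_mult_distrib)
  have Fadd: "F (\<lambda>x. u x + v x) z = F u z + F v z" for u v z by (simp add: F_def algebra_simps)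
  have en: "energy u = (\<integral>\<^sup>+z. (cmod (F u z))\<^sup>2 \<partial>?P) + (\<integral>\<^sup>+x. (cmod (u x))\<^sup>2 \<partial>lborel)" for u
    by (simp add: energy_def F2 split_beta')
  have finD: "(\<integral>\<^sup>+z. (cmod (F u z))\<^sup>2 \<partial>?P) < \<infinity>" "(\<integral>\<^sup>+x. (cmod (u x))\<^sup>2 \<partial>lborel) < \<infinity>" if "energy u < \<infinity>" for u
    using that by (auto simp: en)
  have wfin: "energy (w n) < \<infinity>" for n using w[of n] K by (rule le_less_trans)
  have sfin: "energy (\<lambda>x. b x + w n x) < \<infinity>" for n
    using b wfin[of n] by (intro le_less_trans[OF energy_add_le]) (auto simp: ennreal_mult_less_top)
  have "(\<lambda>n. \<integral>\<^sup>+z. \<bar>(cmod (F b z + F (w n) z))\<^sup>2 - (cmod (F (w n) z))\<^sup>2 - (cmod (F b z))\<^sup>2\<bar> \<partial>?P) \<longlonglongrightarrow> 0"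
  proof (rule square_split_tendsto_0[OF _ _ _ K])
    show "AE z in ?P. (\<lambda>n. F (w n) z) \<longlonglongrightarrow> 0"
      using AE_lborel_pairI[OF lim]
    proof eventually_elim
      case (elim z)
      have "(\<lambda>n. F (w n) z) \<longlonglongrightarrow> (0 - 0) * complex_of_real (sqrt (J (fst z - snd z)))"
        unfolding F_def by (intro tendsto_intros) (use elim in auto)
      then show ?case by simp
    qed
    show "(\<integral>\<^sup>+z. (cmod (F (w n) z))\<^sup>2 \<partial>?P) \<le> K" for n
      using w[of n] by (rule order_trans[rotated]) (simp add: en)
  qed (use finD(1)[OF b] in auto)
  then have 1: "(\<lambda>n. enn2real (\<integral>\<^sup>+z. (cmod (F b z + F (w n) z))\<^sup>2 \<partial>?P) - enn2real (\<integral>\<^sup>+z. (cmod (F (w n) z))\<^sup>2 \<partial>?P))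
       \<longlonglongrightarrow> enn2real (\<integral>\<^sup>+z. (cmod (F b z))\<^sup>2 \<partial>?P)"
    using finD(1)[OF b] finD(1)[OF wfin] finD(1)[OF sfin]
    by (intro enn2real_nn_integral_split_tendsto) (auto simp: Fadd)
  have "(\<lambda>n. \<integral>\<^sup>+x. \<bar>(cmod (b x + w n x))\<^sup>2 - (cmod (w n x))\<^sup>2 - (cmod (b x))\<^sup>2\<bar> \<partial>lborel) \<longlonglongrightarrow> 0"
  proof (rule square_split_tendsto_0[OF _ _ lim K])
    show "(\<integral>\<^sup>+x. (cmod (w n x))\<^sup>2 \<partial>lborel) \<le> K" for n
      using w[of n] by (rule order_trans[rotated]) (simp add: en)
  qed (use finD(2)[OF b] in auto)
  then have 2: "(\<lambda>n. enn2real (\<integral>\<^sup>+x. (cmod (b x + w n x))\<^sup>2 \<partial>lborel) - enn2real (\<integral>\<^sup>+x. (cmod (w n x))\<^sup>2 \<partial>lborel))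
       \<longlonglongrightarrow> enn2real (\<integral>\<^sup>+x. (cmod (b x))\<^sup>2 \<partial>lborel)"
    using finD(2)[OF b] finD(2)[OF wfin] finD(2)[OF sfin]
    by (intro enn2real_nn_integral_split_tendsto) auto
  have en': "enn2real (energy u) = enn2real (\<integral>\<^sup>+z. (cmod (F u z))\<^sup>2 \<partial>?P) + enn2real (\<integral>\<^sup>+x. (cmod (u x))\<^sup>2 \<partial>lborel)"
    if "energy u < \<infinity>" for u
    using finD[OF that] by (simp add: en enn2real_plus)
  show ?thesis
    using tendsto_add[OF 1 2] by (simp add: en'[OF b] en'[OF wfin] en'[OF sfin] Fadd algebra_simps)
qed

end

section \<open>Local compactness\<close>
text \<open>
  The increments of a subsequence with summable \<open>L\<^sup>1\<close> distances are almost everywhere absolutely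
  summable.
\<close>
lemma L1_Cauchy_AE_convergent_subseq:
  fixes f :: "nat \<Rightarrow> 'a \<Rightarrow> complex"
  assumes [measurable]: "\<And>n. f n \<in> borel_measurable M"
    and Cauchy: "\<And>e::real. 0 < e \<Longrightarrow> \<exists>N. \<forall>i\<ge>N. \<forall>j\<ge>N. (\<integral>\<^sup>+x. cmod (f i x - f j x) \<partial>M) \<le> ennreal e"
  shows "\<exists>r. strict_mono r \<and> (AE x in M. convergent (\<lambda>n. f (r n) x))"
proof -
  have "\<exists>N. \<forall>i\<ge>N. \<forall>j\<ge>N. (\<integral>\<^sup>+x. cmod (f i x - f j x) \<partial>M) \<le> ennreal ((1/2) ^ n)" for n
    by (rule Cauchy) simp
  then obtain N where N: "\<And>n i j. N n \<le> i \<Longrightarrow> N n \<le> j \<Longrightarrow>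
      (\<integral>\<^sup>+x. cmod (f i x - f j x) \<partial>M) \<le> ennreal ((1/2) ^ n)" by metis
  define r where "r = rec_nat (N 0) (\<lambda>n m. max (Suc m) (N (Suc n)))"
  have r_Suc: "r (Suc n) = max (Suc (r n)) (N (Suc n))" for n by (simp add: r_def)
  have r: "strict_mono r" by (simp add: strict_mono_Suc_iff r_Suc less_max_iff_disj)
  have rN: "N n \<le> r n" for n by (cases n) (auto simp: r_def)
  have step: "(\<integral>\<^sup>+x. cmod (f (r (Suc n)) x - f (r n) x) \<partial>M) \<le> ennreal ((1/2) ^ n)" for n
  proof (rule N)
    show "N n \<le> r n" by (rule rN)
    have "r n \<le> r (Suc n)" by (simp add: r_Suc)
    with rN[of n] show "N n \<le> r (Suc n)" by (rule order_trans)
  qed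
  have "(\<integral>\<^sup>+x. (\<Sum>n. ennreal (cmod (f (r (Suc n)) x - f (r n) x))) \<partial>M)
      = (\<Sum>n. \<integral>\<^sup>+x. cmod (f (r (Suc n)) x - f (r n) x) \<partial>M)"
    by (rule nn_integral_suminf) measurable
  also have "\<dots> \<le> (\<Sum>n. ennreal ((1/2) ^ n))" by (intro suminf_le step) auto
  also have "\<dots> = ennreal (\<Sum>n. (1/2) ^ n)" by (rule suminf_ennreal2) auto
  also have "\<dots> < \<infinity>" by simp
  finally have "AE x in M. (\<Sum>n. ennreal (cmod (f (r (Suc n)) x - f (r n) x))) \<noteq> \<infinity>"
    by (intro nn_integral_noteq_infinite) auto
  then have "AE x in M. convergent (\<lambda>n. f (r n) x)"
  proof eventually_elim
    case (elim x)
    then have "summable (\<lambda>n. cmod (f (r (Suc n)) x - f (r n) x))"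
      by (intro summable_suminf_not_top) auto
    then have "summable (\<lambda>n. f (r (Suc n)) x - f (r n) x)" by (rule summable_norm_cancel)
    then have "convergent (\<lambda>n. \<Sum>i<n. f (r (Suc i)) x - f (r i) x)" by (simp add: summable_iff_convergent)
    then have "convergent (\<lambda>n. f (r n) x - f (r 0) x)"
      by (subst (asm) sum_lessThan_telescope[of "\<lambda>i. f (r i) x"])
    then have "convergent (\<lambda>n. (f (r n) x - f (r 0) x) + f (r 0) x)"
      by (intro convergent_add convergent_const)
    then show ?case by simp
  qed
  with r show ?thesis by blast
qed

text \<open>
  The grid of half-open cubes of side \<open>1 / N\<close>. For fixed \<open>N\<close> there are countably many, so all cell averages
  of a bounded sequence converge along one subsequence.
\<close>
definition same_cell :: "real \<Rightarrow> real^3 \<Rightarrow> real^3 \<Rightarrow> bool" where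
  "same_cell N x y \<longleftrightarrow> (\<forall>i. \<lfloor>N * y $ i\<rfloor> = \<lfloor>N * x $ i\<rfloor>)"

lemma borel_measurable_vec_nth3 [measurable (raw)]:
  assumes "f \<in> borel_measurable M"
  shows "(\<lambda>x. (f x :: real^3) $ i) \<in> borel_measurable M"
  by (rule measurable_compose[OF assms])
     (intro borel_measurable_continuous_onI continuous_intros)

lemma same_cell_measurable [measurable]:
  "Measurable.pred (borel \<Otimes>\<^sub>M borel) (\<lambda>(x, y). same_cell N x y)"
  unfolding same_cell_def split_beta' by measurable

lemma same_cell_measurable' [measurable]: "{y. same_cell N x y} \<in> sets borel"
  unfolding same_cell_def by measurable

lemma same_cell_dist:
  assumes "0 < N" "same_cell N x y"
  shows "norm (x - y) < 2 / N"
proof -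
  have i: "\<bar>N * (x - y) $ i\<bar> < 1" for i
    using assms(2)[unfolded same_cell_def, rule_format, of i] by (simp add: algebra_simps) linarith
  have "((x - y) $ i)\<^sup>2 \<le> (1 / N)\<^sup>2" for i
  proof -
    have "N * \<bar>(x - y) $ i\<bar> < 1" using i[of i] assms(1) by (simp add: abs_mult)
    then have "\<bar>(x - y) $ i\<bar> \<le> \<bar>1 / N\<bar>" using assms(1) by (simp add: pos_le_divide_eq mult.commute)
    then show ?thesis by (simp only: abs_le_square_iff)
  qed
  then have "(\<Sum>i\<in>UNIV. ((x - y) $ i)\<^sup>2) \<le> (\<Sum>i\<in>(UNIV::3 set). (1 / N)\<^sup>2)"
    by (intro sum_mono)
  moreover have "(norm (x - y))\<^sup>2 = (\<Sum>i\<in>UNIV. ((x - y) $ i)\<^sup>2)"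
    unfolding norm_vec_def L2_set_def by (simp add: sum_nonneg)
  ultimately have "(norm (x - y))\<^sup>2 \<le> (\<Sum>i\<in>(UNIV::3 set). (1 / N)\<^sup>2)" by simp
  also have "\<dots> < (2 / N)\<^sup>2" using assms(1) by (simp add: power2_eq_square field_simps)
  finally show ?thesis using assms(1) by (auto intro: power_less_imp_less_base)
qed

lemma emeasure_same_cell:
  assumes N: "0 < N"
  shows "emeasure lborel {y. same_cell N x y} = ennreal (1 / N ^ 3)"
proof -
  define a b :: "real^3" where "a = (\<chi> i. of_int \<lfloor>N * x $ i\<rfloor> / N)" and "b = (\<chi> i. (of_int \<lfloor>N * x $ i\<rfloor> + 1) / N)"
  have fl: "\<lfloor>N * t\<rfloor> = k \<longleftrightarrow> of_int k / N \<le> t \<and> t < (of_int k + 1) / N" for t k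
    using N by (simp add: floor_eq_iff field_simps)
  have sub: "box a b \<subseteq> {y. same_cell N x y}" "{y. same_cell N x y} \<subseteq> cbox a b"
    by (auto simp: mem_box_cart a_def b_def same_cell_def fl less_imp_le)
  have le: "a \<bullet> i \<le> b \<bullet> i" if "i \<in> Basis" for i
    using that N by (auto simp: Basis_vec_def inner_axis a_def b_def field_simps)
  have "(\<Prod>i\<in>Basis. (b - a) \<bullet> i) = 1 / N ^ 3"
  proof -
    have "(\<Prod>i\<in>(Basis::(real^3) set). (b - a) \<bullet> i) = (\<Prod>i\<in>(Basis::(real^3) set). 1 / N)"
      using N by (intro prod.cong) (auto simp: Basis_vec_def inner_axis a_def b_def field_simps)
    then show ?thesis by (simp add: power_divide)
  qed
  then have vol: "emeasure lborel (box a b) = ennreal (1 / N ^ 3)" "emeasure lborel (cbox a b) = ennreal (1 / N ^ 3)"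
    using le by (auto simp: emeasure_lborel_box_eq emeasure_lborel_cbox_eq)
  show ?thesis
    using emeasure_mono[OF sub(1), of lborel] emeasure_mono[OF sub(2), of lborel] vol by auto
qed

definition cell_average :: "real \<Rightarrow> (real^3 \<Rightarrow> complex) \<Rightarrow> real^3 \<Rightarrow> complex" where
  "cell_average N u x = N ^ 3 * (LINT y|lborel. indicator {y. same_cell N x y} y *\<^sub>R u y)"

lemma cell_average_measurable [measurable]:
  assumes [measurable]: "u \<in> borel_measurable borel"
  shows "cell_average N u \<in> borel_measurable borel"
proof -
  have [measurable]: "(\<lambda>(x, y). indicator {y. same_cell N x y} y *\<^sub>R u y) \<in> borel_measurable (borel \<Otimes>\<^sub>M lborel)"
    unfolding indicator_def split_beta' mem_Collect_eq by measurable
  show ?thesis unfolding cell_average_def[abs_def] by measurable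
qed

lemma nn_integral_cell_le:
  assumes [measurable]: "u \<in> borel_measurable borel" and N: "0 < N"
  shows "(\<integral>\<^sup>+y. cmod (indicator {y. same_cell N x y} y *\<^sub>R u y) \<partial>lborel)
      \<le> ennreal (1 / N ^ 3) + (\<integral>\<^sup>+y. (cmod (u y))\<^sup>2 \<partial>lborel)"
proof -
  have "(\<integral>\<^sup>+y. cmod (indicator {y. same_cell N x y} y *\<^sub>R u y) \<partial>lborel)
      \<le> (\<integral>\<^sup>+y. indicator {y. same_cell N x y} y + ennreal ((cmod (u y))\<^sup>2) \<partial>lborel)"
  proof (intro nn_integral_mono)
    fix y
    have "cmod (u y) \<le> 1 + (cmod (u y))\<^sup>2"
    proof -
      have "0 \<le> (cmod (u y))\<^sup>2 - 2 * cmod (u y) + 1"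
        using zero_le_power2[of "cmod (u y) - 1"] by (simp add: power2_diff)
      with norm_ge_zero[of "u y"] show ?thesis by linarith
    qed
    then have "ennreal (cmod (u y)) \<le> 1 + ennreal ((cmod (u y))\<^sup>2)"
      by (metis ennreal_1 ennreal_leI ennreal_plus zero_le_one zero_le_power2)
    then show "ennreal (cmod (indicator {y. same_cell N x y} y *\<^sub>R u y)) \<le> indicator {y. same_cell N x y} y + ennreal ((cmod (u y))\<^sup>2)"
      by (auto simp: indicator_def)
  qed
  also have "\<dots> = ennreal (1 / N ^ 3) + (\<integral>\<^sup>+y. (cmod (u y))\<^sup>2 \<partial>lborel)"
    by (subst nn_integral_add) (auto simp: emeasure_same_cell[OF N])
  finally show ?thesis .
qed

lemma integrable_cell:
  assumes [measurable]: "u \<in> borel_measurable borel" and N: "0 < N"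
    and u: "(\<integral>\<^sup>+y. (cmod (u y))\<^sup>2 \<partial>lborel) < \<infinity>"
  shows "integrable lborel (\<lambda>y. indicator {y. same_cell N x y} y *\<^sub>R u y)"
proof (rule integrableI_bounded)
  show "(\<integral>\<^sup>+y. cmod (indicator {y. same_cell N x y} y *\<^sub>R u y) \<partial>lborel) < \<infinity>"
    using u by (intro le_less_trans[OF nn_integral_cell_le[OF _ N]]) auto
qed measurable

context gagliardo_energy
begin

text \<open>
  Averaging over a cell changes \<open>u\<close> little where the energy density is finite: on the cell
  \<open>\<bar>x - y\<bar> < 2 / N\<close>, so \<open>N\<^sup>3\<close> is at most \<open>N\<^sup>-\<^sup>2\<^sup>s\<close> times a multiple of \<open>J(x - y)\<close>. The inequality
  \<open>t \<le> N\<^sup>-\<^sup>s + N\<^sup>s t\<^sup>2\<close> replaces the Cauchy--Schwarz inequality and gives an \<open>L\<^sup>1\<close> estimate directly.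
\<close>
lemma cell_average_error:
  assumes [measurable]: "u \<in> borel_measurable borel" and N: "1 \<le> N"
    and u: "(\<integral>\<^sup>+y. (cmod (u y))\<^sup>2 \<partial>lborel) < \<infinity>"
  shows "ennreal (cmod (u x - cell_average N u x))
     \<le> ennreal (N powr - s) * (1 + ennreal (2 powr (3 + 2 * s) / c\<^sub>0) * density u x)"
proof -
  let ?I = "\<lambda>y. indicator {y. same_cell N x y} y :: real"
  define C where "C = 2 powr (3 + 2 * s) / c\<^sub>0"
  have C: "0 < C" using c0 by (simp add: C_def)
  have N0: "0 < N" using N by simp
  have I: "integrable lborel (\<lambda>y. ?I y *\<^sub>R u y)" by (rule integrable_cell[OF _ N0 u]) simp
  have I1: "integrable lborel (\<lambda>y. ?I y *\<^sub>R u x)"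
    using emeasure_same_cell[OF N0, of x] by (intro integrable_scaleR_left integrable_real_indicator) auto
  have "measure lborel {y. same_cell N x y} = 1 / N ^ 3"
    using N0 by (simp add: measure_def emeasure_same_cell[OF N0])
  then have "(LINT y|lborel. ?I y *\<^sub>R u x) = (1 / N ^ 3) *\<^sub>R u x"
    using emeasure_same_cell[OF N0, of x] by simp
  then have "u x - cell_average N u x = N ^ 3 * ((LINT y|lborel. ?I y *\<^sub>R u x) - (LINT y|lborel. ?I y *\<^sub>R u y))"
    using N0 by (simp add: cell_average_def right_diff_distrib scaleR_conv_of_real)
  also have "\<dots> = N ^ 3 * (LINT y|lborel. ?I y *\<^sub>R (u x - u y))"
    by (subst Bochner_Integration.integral_diff[OF I1 I, symmetric]) (simp add: scaleR_diff_right)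
  finally have eq: "u x - cell_average N u x = N ^ 3 * (LINT y|lborel. ?I y *\<^sub>R (u x - u y))" .
  have I2: "integrable lborel (\<lambda>y. ?I y *\<^sub>R (u x - u y))"
    using Bochner_Integration.integrable_diff[OF I1 I] by (simp add: scaleR_diff_right)
  have pt: "N ^ 3 * (?I y * cmod (u x - u y)) \<le> N ^ 3 * N powr - s * ?I y + N powr - s * C * ((cmod (u x - u y))\<^sup>2 * J (x - y))" for y
  proof (cases "same_cell N x y \<and> u x \<noteq> u y")
    case True
    then have d: "norm (x - y) < 2 / N" "0 < norm (x - y)"
      using same_cell_dist[OF N0] by auto
    have "2 / N \<le> 2" using N by (simp add: field_simps)
    then have d2: "norm (x - y) < 2" using d by linarith
    define t where "t = cmod (u x - u y)"
    have "(2 / N) powr - (3 + 2 * s) \<le> norm (x - y) powr - (3 + 2 * s)"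
      using d s N0 by (intro powr_mono2') auto
    then have "c\<^sub>0 * (2 / N) powr - (3 + 2 * s) \<le> c\<^sub>0 * norm (x - y) powr - (3 + 2 * s)"
      using c0 by simp
    also have "\<dots> \<le> J (x - y)" by (rule J_lower[OF d(2) d2])
    also have "(2 / N) powr - (3 + 2 * s) = N powr (3 + 2 * s) / 2 powr (3 + 2 * s)"
      unfolding powr_minus powr_divide by simp
    finally have "N powr (3 + 2 * s) \<le> C * J (x - y)"
      using c0 by (simp add: C_def field_simps)
    then have "N powr - s * (t\<^sup>2 * N powr (3 + 2 * s)) \<le> N powr - s * (t\<^sup>2 * (C * J (x - y)))"
      by (intro mult_left_mono) auto
    also have "\<dots> = N powr - s * C * (t\<^sup>2 * J (x - y))" by (simp add: mult_ac)
    also have "N powr - s * (t\<^sup>2 * N powr (3 + 2 * s)) = N ^ 3 * N powr s * t\<^sup>2"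
    proof -
      have "N powr - s * N powr (3 + 2 * s) = N powr 3 * N powr s" by (simp add: add.commute flip: powr_add)
      then show ?thesis using N0 by (simp add: mult_ac)
    qed
    finally have 1: "N ^ 3 * N powr s * t\<^sup>2 \<le> N powr - s * C * (t\<^sup>2 * J (x - y))" .
    have "t \<le> N powr - s + N powr s * t\<^sup>2"
    proof (cases "t \<le> N powr - s")
      case False
      then have "1 \<le> N powr s * t" using N0 by (simp add: powr_minus field_simps)
      then have "t * 1 \<le> t * (N powr s * t)" by (intro mult_left_mono) (auto simp: t_def)
      then show ?thesis by (simp add: power2_eq_square mult_ac add_increasing)
    qed (auto intro: add_increasing2)
    then have "N ^ 3 * t \<le> N ^ 3 * (N powr - s + N powr s * t\<^sup>2)"
      using N0 by (intro mult_left_mono) auto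
    also have "\<dots> = N ^ 3 * N powr - s + N ^ 3 * N powr s * t\<^sup>2" by (simp add: algebra_simps)
    also have "\<dots> \<le> N ^ 3 * N powr - s + N powr - s * C * (t\<^sup>2 * J (x - y))" using 1 by simp
    finally show ?thesis
      using True by (simp add: t_def[symmetric])
  next
    case False
    then have z: "N ^ 3 * (?I y * cmod (u x - u y)) = 0" by (auto simp: indicator_def)
    moreover have "0 \<le> N ^ 3 * N powr - s * ?I y" "0 \<le> N powr - s * C * ((cmod (u x - u y))\<^sup>2 * J (x - y))"
      using N0 C J_nonneg by auto
    ultimately show ?thesis unfolding z by (intro add_nonneg_nonneg)
  qed
  have "ennreal (cmod (u x - cell_average N u x)) = ennreal (N ^ 3) * ennreal (cmod (LINT y|lborel. ?I y *\<^sub>R (u x - u y)))"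
    using N0 by (simp add: eq norm_mult ennreal_mult norm_power)
  also have "\<dots> \<le> ennreal (N ^ 3) * (\<integral>\<^sup>+y. cmod (?I y *\<^sub>R (u x - u y)) \<partial>lborel)"
    by (intro mult_left_mono integral_norm_bound_ennreal I2) auto
  also have "\<dots> = (\<integral>\<^sup>+y. ennreal (N ^ 3) * ennreal (cmod (?I y *\<^sub>R (u x - u y))) \<partial>lborel)"
    by (rule nn_integral_cmult[symmetric]) measurable
  also have "\<dots> \<le> (\<integral>\<^sup>+y. ennreal (N ^ 3 * N powr - s) * indicator {y. same_cell N x y} y
      + ennreal (N powr - s * C) * ennreal ((cmod (u x - u y))\<^sup>2 * J (x - y)) \<partial>lborel)"
  proof (intro nn_integral_mono)
    fix y
    have "ennreal (N ^ 3) * ennreal (cmod (?I y *\<^sub>R (u x - u y))) = ennreal (N ^ 3 * (?I y * cmod (u x - u y)))"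
      using N0 by (simp add: ennreal_mult)
    also have "\<dots> \<le> ennreal (N ^ 3 * N powr - s * ?I y + N powr - s * C * ((cmod (u x - u y))\<^sup>2 * J (x - y)))"
      by (intro ennreal_leI pt)
    also have "\<dots> = ennreal (N ^ 3 * N powr - s * ?I y) + ennreal (N powr - s * C * ((cmod (u x - u y))\<^sup>2 * J (x - y)))"
      using N0 C J_nonneg by (intro ennreal_plus) auto
    also have "\<dots> = ennreal (N ^ 3 * N powr - s) * indicator {y. same_cell N x y} y
      + ennreal (N powr - s * C) * ennreal ((cmod (u x - u y))\<^sup>2 * J (x - y))"
      using N0 C J_nonneg by (intro arg_cong2[where f="(+)"]) (auto simp: ennreal_mult indicator_def)
    finally show "ennreal (N ^ 3) * ennreal (cmod (?I y *\<^sub>R (u x - u y))) \<le> \<dots>" .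
  qed
  also have "\<dots> = ennreal (N ^ 3 * N powr - s) * ennreal (1 / N ^ 3) + ennreal (N powr - s * C) * density u x"
    unfolding density_def
    by (subst nn_integral_add) (auto simp: nn_integral_cmult nn_integral_cmult_indicator emeasure_same_cell[OF N0])
  also have "ennreal (N ^ 3 * N powr - s) * ennreal (1 / N ^ 3) = ennreal (N powr - s)"
    using N0 by (simp add: ennreal_mult[symmetric])
  also have "ennreal (N powr - s) + ennreal (N powr - s * C) * density u x = ennreal (N powr - s) * (1 + ennreal C * density u x)"
    using C by (simp add: ennreal_mult distrib_left mult.assoc)
  finally show ?thesis unfolding C_def .
qed

text \<open>
  A diagonal sequence makes all cell averages converge. Together with \<open>cell_average_error\<close>, which is
  uniform along the sequence, this makes the sequence Cauchy in \<open>L\<^sup>1\<close> of a finite measure equivalent to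
  Lebesgue measure, and a further subsequence converges almost everywhere.
\<close>
lemma local_compactness:
  fixes u :: "nat \<Rightarrow> real^3 \<Rightarrow> complex"
  assumes um [measurable]: "\<And>n. u n \<in> borel_measurable borel" and uK: "\<And>n. energy (u n) \<le> ennreal K"
  shows "\<exists>r v. strict_mono r \<and> v \<in> borel_measurable borel \<and> (AE x in lborel. (\<lambda>n. u (r n) x) \<longlonglongrightarrow> v x)"
proof -
  have K0: "ennreal K \<le> ennreal (max K 0)" by (intro ennreal_leI) simp
  have L2: "(\<integral>\<^sup>+y. (cmod (u n y))\<^sup>2 \<partial>lborel) \<le> ennreal (max K 0)" for n
    by (rule order_trans[OF _ order_trans[OF uK[of n] K0]]) (simp add: energy_def)
  have L2f: "(\<integral>\<^sup>+y. (cmod (u n y))\<^sup>2 \<partial>lborel) < \<infinity>" for n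
    using L2[of n] by (rule le_less_trans) simp
  define g where "g n = (\<lambda>(k, x). LINT y|lborel. indicator {y. same_cell (Suc k) x y} y *\<^sub>R u n y)" for n
  have gb: "cmod (g n (k, x)) \<le> 1 + max K 0" for n k x
  proof -
    have "ennreal (cmod (g n (k, x))) \<le> (\<integral>\<^sup>+y. cmod (indicator {y. same_cell (Suc k) x y} y *\<^sub>R u n y) \<partial>lborel)"
      unfolding g_def prod.case by (intro integral_norm_bound_ennreal integrable_cell L2f) auto
    also have "\<dots> \<le> ennreal (1 / real (Suc k) ^ 3) + ennreal (max K 0)"
      by (rule order_trans[OF nn_integral_cell_le add_left_mono[OF L2]]) auto
    also have "\<dots> \<le> ennreal 1 + ennreal (max K 0)"
      by (intro add_right_mono ennreal_leI) simp
    also have "\<dots> = ennreal (1 + max K 0)" by (simp add: ennreal_plus del: ennreal_1)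
    finally show ?thesis by (subst (asm) ennreal_le_iff) auto
  qed
  \<comment> \<open>One point of each cell, so that the cells are indexed by a countable set.\<close>
  define pt :: "nat \<Rightarrow> int^3 \<Rightarrow> real^3" where "pt k j = (\<chi> i. of_int (j $ i) / Suc k)" for k j
  define S where "S = range (\<lambda>(k, j). (k, pt k j))"
  have "countable S" by (simp add: S_def)
  then obtain r0 where r0: "strict_mono (r0 :: nat \<Rightarrow> nat)" "\<And>z. z \<in> S \<Longrightarrow> \<exists>l. (\<lambda>n. g (r0 n) z) \<longlonglongrightarrow> l"
    using function_convergent_subsequence[of S g "1 + max K 0"] gb by (metis surj_pair)
  define w where "w n = u (r0 n)" for n
  have [measurable]: "w n \<in> borel_measurable borel" for n by (simp add: w_def)
  have wK: "energy (w n) \<le> ennreal (max K 0)" for n unfolding w_def by (rule order_trans[OF uK K0])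
  have conv: "convergent (\<lambda>n. cell_average (Suc k) (w n) x)" for k x
  proof -
    define p where "p = pt k (\<chi> i. \<lfloor>Suc k * x $ i\<rfloor>)"
    have "same_cell (Suc k) x y = same_cell (Suc k) p y" for y
      by (simp add: same_cell_def p_def pt_def)
    then have "cell_average (Suc k) (w n) x = (Suc k) ^ 3 * g (r0 n) (k, p)" for n
      by (simp add: cell_average_def g_def w_def)
    moreover have "(k, p) \<in> S" unfolding S_def p_def by (rule image_eqI[where x="(k, _)"]) auto
    then have "convergent (\<lambda>n. g (r0 n) (k, p))" using r0(2) by (simp add: convergent_def)
    then have "convergent (\<lambda>n. (Suc k) ^ 3 * g (r0 n) (k, p))" by (intro convergent_mult convergent_const)
    ultimately show ?thesis by simp
  qed
  have avb: "cmod (cell_average (Suc k) (w n) x) \<le> real (Suc k) ^ 3 * (1 + max K 0)" for k n x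
    using mult_left_mono[OF gb[of "r0 n" k x], of "real (Suc k) ^ 3"]
    by (simp add: cell_average_def g_def w_def norm_mult norm_power del: of_nat_Suc of_nat_power)
  \<comment> \<open>A strictly positive weight of finite mass, cut to at most \<open>1\<close> below: it makes constants integrable and has the null sets of Lebesgue measure.\<close>
  obtain h0 :: "real^3 \<Rightarrow> ennreal" where [measurable]: "h0 \<in> borel_measurable borel"
    and h0: "integral\<^sup>N lborel h0 \<noteq> \<infinity>" "\<And>x. 0 < h0 x"
    using sigma_finite_measure.Ex_finite_integrable_function[OF sigma_finite_lborel] by force
  define h where "h x = min 1 (h0 x)" for x
  have [measurable]: "h \<in> borel_measurable borel" unfolding h_def by measurable
  have h: "0 < h x" "h x \<le> 1" for x using h0 by (auto simp: h_def)
  define M where "M = Nonnegative_Lebesgue_Integration.density lborel h"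
  have setsM [measurable_cong]: "sets M = sets borel" by (simp add: M_def)
  have Mint: "(\<integral>\<^sup>+x. f x \<partial>M) = (\<integral>\<^sup>+x. h x * f x \<partial>lborel)" if [measurable]: "f \<in> borel_measurable borel" for f
    unfolding M_def by (rule nn_integral_density) auto
  define W where "W = (\<integral>\<^sup>+x. 1 \<partial>M)"
  have Wfin: "W < \<infinity>"
  proof -
    have "W \<le> integral\<^sup>N lborel h0" unfolding W_def by (subst Mint) (auto simp: h_def intro!: nn_integral_mono)
    also have "\<dots> < \<infinity>" using h0(1) by (simp add: less_top)
    finally show ?thesis .
  qed
  have Mle: "(\<integral>\<^sup>+x. f x \<partial>M) \<le> (\<integral>\<^sup>+x. f x \<partial>lborel)" if "f \<in> borel_measurable borel" for f
    unfolding Mint[OF that] using h(2) by (intro nn_integral_mono) (metis mult.left_neutral mult_right_mono zero_le)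
  define C where "C = ennreal (2 powr (3 + 2 * s) / c\<^sub>0)"
  define B where "B = W + C * ennreal (max K 0)"
  have Bfin: "B < \<infinity>" using Wfin by (auto simp: B_def C_def ennreal_mult_less_top)
  have err: "(\<integral>\<^sup>+x. cmod (w n x - cell_average (Suc k) (w n) x) \<partial>M) \<le> ennreal (Suc k powr - s) * B" for n k
  proof -
    have "(\<integral>\<^sup>+x. cmod (w n x - cell_average (Suc k) (w n) x) \<partial>M) \<le> (\<integral>\<^sup>+x. ennreal (Suc k powr - s) * (1 + C * density (w n) x) \<partial>M)"
      unfolding C_def using L2f by (intro nn_integral_mono cell_average_error) (auto simp: w_def)
    also have "\<dots> = ennreal (Suc k powr - s) * (W + C * (\<integral>\<^sup>+x. density (w n) x \<partial>M))"
      by (simp add: nn_integral_cmult nn_integral_add W_def)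
    also have "(\<integral>\<^sup>+x. density (w n) x \<partial>M) \<le> (\<integral>\<^sup>+x. density (w n) x + ennreal ((cmod (w n x))\<^sup>2) \<partial>lborel)"
      by (rule order_trans[OF Mle nn_integral_mono]) auto
    also have "\<dots> \<le> ennreal (max K 0)" by (simp add: nn_integral_density_energy wK)
    finally show ?thesis unfolding B_def by (simp add: add_left_mono mult_left_mono)
  qed
  have avlim: "(\<lambda>n. \<integral>\<^sup>+x. cmod (cell_average (Suc k) (w n) x - lim (\<lambda>n. cell_average (Suc k) (w n) x)) \<partial>M) \<longlonglongrightarrow> 0" for k
  proof -
    let ?a = "\<lambda>n x. cell_average (Suc k) (w n) x" and ?l = "\<lambda>x. lim (\<lambda>n. cell_average (Suc k) (w n) x)"
    let ?b = "real (Suc k) ^ 3 * (1 + max K 0)"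
    have lim: "(\<lambda>n. ?a n x) \<longlonglongrightarrow> ?l x" for x using conv[of k x] by (simp add: convergent_LIMSEQ_iff)
    have lb: "cmod (?l x) \<le> ?b" for x
      by (rule Lim_bounded[OF tendsto_norm[OF lim]]) (use avb in auto)
    have "(\<lambda>n. \<integral>\<^sup>+x. cmod (?a n x - ?l x) \<partial>M) \<longlonglongrightarrow> (\<integral>\<^sup>+x. 0 \<partial>M)"
    proof (rule nn_integral_dominated_convergence[where w="\<lambda>_. ennreal (?b + ?b)"])
      show "AE x in M. ennreal (cmod (?a n x - ?l x)) \<le> ennreal (?b + ?b)" for n
        by (intro AE_I2 ennreal_leI order_trans[OF norm_triangle_ineq4] add_mono avb lb)
      show "(\<integral>\<^sup>+x. ennreal (?b + ?b) \<partial>M) < \<infinity>"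
        using Wfin by (simp add: W_def ennreal_mult_less_top)
      show "AE x in M. (\<lambda>n. ennreal (cmod (?a n x - ?l x))) \<longlonglongrightarrow> 0"
      proof (rule AE_I2)
        fix x
        have "(\<lambda>n. cmod (?a n x - ?l x)) \<longlonglongrightarrow> 0" using lim[of x] by (simp add: tendsto_norm_zero_iff LIM_zero_iff)
        then show "(\<lambda>n. ennreal (cmod (?a n x - ?l x))) \<longlonglongrightarrow> 0"
          using tendsto_ennrealI by fastforce
      qed
    qed measurable
    then show ?thesis by simp
  qed
  have "\<exists>r. strict_mono r \<and> (AE x in M. convergent (\<lambda>n. w (r n) x))"
  proof (rule L1_Cauchy_AE_convergent_subseq)
    fix e :: real assume e: "0 < e"
    have "(\<lambda>k. Suc k powr - s) \<longlonglongrightarrow> 0"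
      using s by (intro tendsto_neg_powr filterlim_compose[OF filterlim_real_sequentially] filterlim_Suc) auto
    then have "(\<lambda>k. ennreal (Suc k powr - s * enn2real B)) \<longlonglongrightarrow> ennreal (0 * enn2real B)"
      by (intro tendsto_ennrealI tendsto_mult tendsto_const)
    moreover have "ennreal (Suc k powr - s * enn2real B) = ennreal (Suc k powr - s) * B" for k
      using Bfin by (simp add: ennreal_mult)
    ultimately have "(\<lambda>k. ennreal (Suc k powr - s) * B) \<longlonglongrightarrow> 0" by simp
    then have "\<forall>\<^sub>F k in sequentially. ennreal (Suc k powr - s) * B < ennreal (e / 4)"
      using e by (intro order_tendstoD(2)[where y=0]) auto
    then obtain k where k: "ennreal (Suc k powr - s) * B < ennreal (e / 4)"
      using eventually_happens by fastforce
    let ?a = "\<lambda>n x. cell_average (Suc k) (w n) x" and ?l = "\<lambda>x. lim (\<lambda>n. cell_average (Suc k) (w n) x)"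
    have "\<forall>\<^sub>F n in sequentially. (\<integral>\<^sup>+x. cmod (?a n x - ?l x) \<partial>M) < ennreal (e / 4)"
      using e by (intro order_tendstoD(2)[OF avlim]) auto
    then obtain n0 where n0: "\<And>n. n0 \<le> n \<Longrightarrow> (\<integral>\<^sup>+x. cmod (?a n x - ?l x) \<partial>M) < ennreal (e / 4)"
      by (auto simp: eventually_sequentially)
    show "\<exists>N. \<forall>i\<ge>N. \<forall>j\<ge>N. (\<integral>\<^sup>+x. cmod (w i x - w j x) \<partial>M) \<le> ennreal e"
    proof (intro exI[of _ n0] allI impI)
      fix i j assume ij: "n0 \<le> i" "n0 \<le> j"
      have "(\<integral>\<^sup>+x. cmod (w i x - w j x) \<partial>M) \<le> (\<integral>\<^sup>+x. (ennreal (cmod (w i x - ?a i x)) + ennreal (cmod (?a i x - ?l x)))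
         + (ennreal (cmod (w j x - ?a j x)) + ennreal (cmod (?a j x - ?l x))) \<partial>M)"
      proof (intro nn_integral_mono)
        fix x
        have "cmod (p - q) \<le> (cmod (p - a) + cmod (a - l)) + (cmod (q - b) + cmod (b - l))" for p q a b l
          using norm_triangle_ineq4[of "(p - a) + (a - l)" "(q - b) + (b - l)"]
            norm_triangle_ineq[of "p - a" "a - l"] norm_triangle_ineq[of "q - b" "b - l"] by simp
        from this[of "w i x" "w j x" "?a i x" "?l x" "?a j x"] show "ennreal (cmod (w i x - w j x)) \<le> (ennreal (cmod (w i x - ?a i x)) + ennreal (cmod (?a i x - ?l x)))
         + (ennreal (cmod (w j x - ?a j x)) + ennreal (cmod (?a j x - ?l x)))"
          by (simp add: ennreal_plus[symmetric] ennreal_leI del: ennreal_plus)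
      qed
      also have "\<dots> = ((\<integral>\<^sup>+x. cmod (w i x - ?a i x) \<partial>M) + (\<integral>\<^sup>+x. cmod (?a i x - ?l x) \<partial>M))
         + ((\<integral>\<^sup>+x. cmod (w j x - ?a j x) \<partial>M) + (\<integral>\<^sup>+x. cmod (?a j x - ?l x) \<partial>M))"
        by (simp add: nn_integral_add)
      also have "\<dots> \<le> (ennreal (e / 4) + ennreal (e / 4)) + (ennreal (e / 4) + ennreal (e / 4))"
        using k n0[OF ij(1)] n0[OF ij(2)] err[of i k] err[of j k]
        by (intro add_mono) (auto intro: order_trans less_imp_le)
      also have "\<dots> = ennreal e" using e by (simp flip: ennreal_plus)
      finally show "(\<integral>\<^sup>+x. cmod (w i x - w j x) \<partial>M) \<le> ennreal e" .
    qed
  qed measurable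
  then obtain r where r: "strict_mono r" "AE x in M. convergent (\<lambda>n. w (r n) x)" by blast
  have ae: "AE x in lborel. convergent (\<lambda>n. w (r n) x)"
    using r(2) h(1) unfolding M_def by (subst (asm) AE_density) auto
  show ?thesis
  proof (intro exI conjI)
    show "strict_mono (r0 \<circ> r)" using r0(1) r(1) by (rule strict_mono_o)
    show "(\<lambda>x. lim (\<lambda>n. w (r n) x)) \<in> borel_measurable borel" by measurable
    show "AE x in lborel. (\<lambda>n. u ((r0 \<circ> r) n) x) \<longlonglongrightarrow> lim (\<lambda>n. w (r n) x)"
      using ae by eventually_elim (simp add: w_def convergent_LIMSEQ_iff)
  qed
qed

end

section \<open>Minimisers on closed translation invariant subspaces\<close>
lemma nn_integral_pair_shift:
  fixes F :: "'a::euclidean_space \<times> 'a \<Rightarrow> ennreal"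
  assumes [measurable]: "F \<in> borel_measurable (lborel \<Otimes>\<^sub>M lborel)"
  shows "(\<integral>\<^sup>+(x, y). F (x + z, y + z) \<partial>(lborel \<Otimes>\<^sub>M lborel)) = (\<integral>\<^sup>+w. F w \<partial>(lborel \<Otimes>\<^sub>M lborel))"
proof -
  have "(\<integral>\<^sup>+(x, y). F (x + z, y + z) \<partial>(lborel \<Otimes>\<^sub>M lborel)) = (\<integral>\<^sup>+x. \<integral>\<^sup>+y. F (x + z, y + z) \<partial>lborel \<partial>lborel)"
    by (subst lborel.nn_integral_fst[symmetric]) auto
  also have "\<dots> = (\<integral>\<^sup>+x. \<integral>\<^sup>+y. F (x + z, y) \<partial>lborel \<partial>lborel)"
    by (intro nn_integral_cong nn_integral_lborel_diff(3)) measurable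
  also have "\<dots> = (\<integral>\<^sup>+x. \<integral>\<^sup>+y. F (x, y) \<partial>lborel \<partial>lborel)"
    by (rule nn_integral_lborel_diff(3)) measurable
  also have "\<dots> = (\<integral>\<^sup>+w. F w \<partial>(lborel \<Otimes>\<^sub>M lborel))"
    by (subst lborel.nn_integral_fst) auto
  finally show ?thesis .
qed

lemma interaction_shift:
  assumes [measurable]: "k \<in> borel_measurable borel" "u \<in> borel_measurable borel"
  shows "interaction k p (\<lambda>x. u (x + z)) = interaction k p u"
  using nn_integral_pair_shift[of "\<lambda>(x, y). ennreal (k (x - y) * (cmod (u x) powr p * cmod (u y) powr p))" z]
  by (simp add: interaction_def)

lemma interaction_cmult:
  assumes [measurable]: "k \<in> borel_measurable borel" "u \<in> borel_measurable borel"
    and "\<And>z. 0 \<le> k z"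
  shows "interaction k p (\<lambda>x. c * u x) = ennreal (cmod c powr (2 * p)) * interaction k p u"
proof -
  have "ennreal (k (x - y) * (cmod (c * u x) powr p * cmod (c * u y) powr p))
     = ennreal (cmod c powr (2 * p)) * ennreal (k (x - y) * (cmod (u x) powr p * cmod (u y) powr p))" for x y
  proof -
    have "cmod c powr (2 * p) = cmod c powr p * cmod c powr p" by (simp flip: powr_add)
    then show ?thesis
      using assms(3) by (subst ennreal_mult[symmetric]) (auto simp: norm_mult powr_mult mult_ac)
  qed
  then show ?thesis by (simp add: interaction_def split_beta' nn_integral_cmult)
qed

text \<open>
  If the interaction vanishes, then for almost every \<open>x\<close> with \<open>u x \<noteq> 0\<close> the function \<open>u\<close> is zero
  almost everywhere; the diagonal, where the kernel need not be positive, is a null set.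
\<close>
lemma interaction_pos:
  fixes k :: "'a::euclidean_space \<Rightarrow> real"
  assumes [measurable]: "k \<in> borel_measurable borel" "u \<in> borel_measurable borel"
    and k: "\<And>z. z \<noteq> 0 \<Longrightarrow> 0 < k z" and "interaction k p u = 0"
  shows "AE x in lborel. u x = 0"
proof -
  have "AE z in lborel \<Otimes>\<^sub>M lborel. ennreal (k (fst z - snd z) * (cmod (u (fst z)) powr p * cmod (u (snd z)) powr p)) = 0"
    using assms(4) unfolding interaction_def split_beta' by (subst (asm) nn_integral_0_iff_AE) auto
  then have "AE x in lborel. AE y in lborel. ennreal (k (x - y) * (cmod (u x) powr p * cmod (u y) powr p)) = 0"
    using lborel_pair.AE_pair by fastforce
  then have *: "AE x in lborel. u x = 0 \<or> (AE y in lborel. u y = 0)"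
  proof eventually_elim
    case (elim x)
    have "AE y in lborel. y \<noteq> x" by (intro AE_lborel_singleton)
    with elim have "AE y in lborel. u x = 0 \<or> u y = 0"
    proof eventually_elim
      case (elim y)
      then have "0 < k (x - y)" using k by simp
      with elim(1) show ?case
        by (auto simp: ennreal_eq_0_iff mult_le_0_iff not_le[symmetric])
    qed
    then show ?case by (cases "u x = 0") auto
  qed
  show ?thesis
  proof (rule ccontr)
    assume n: "\<not> ?thesis"
    from * have ?thesis by eventually_elim (use n in auto)
    with n show False ..
  qed
qed

text \<open>
  The variational problem stripped of its origin. The interaction kernel comes as a sum of two kernels
  because the two parts of the Riesz potential need different exponents; the assumptions on
  \<open>p r\<^sub>1\<close> and \<open>p r\<^sub>2\<close> say that both are subcritical.
\<close>
locale nonlocal_quotient =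
  gagliardo_energy J s c\<^sub>0 +
  near: integrable_power_kernel k\<^sub>1 r\<^sub>1 p a\<^sub>1 + far: integrable_power_kernel k\<^sub>2 r\<^sub>2 p a\<^sub>2
  for J :: "real^3 \<Rightarrow> real" and s c\<^sub>0 and k\<^sub>1 :: "real^3 \<Rightarrow> real" and r\<^sub>1 p a\<^sub>1
    and k\<^sub>2 :: "real^3 \<Rightarrow> real" and r\<^sub>2 a\<^sub>2 +
  fixes X :: "(real^3 \<Rightarrow> complex) set"
  assumes p_gt_1: "1 < p"
    and exp1: "2 < p * r\<^sub>1" "p * r\<^sub>1 < 6 / (3 - 2 * s)"
    and exp2: "2 < p * r\<^sub>2" "p * r\<^sub>2 < 6 / (3 - 2 * s)"
    and kernel_pos: "\<And>z. z \<noteq> 0 \<Longrightarrow> 0 < k\<^sub>1 z + k\<^sub>2 z"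
    and X_meas: "\<And>u. u \<in> X \<Longrightarrow> u \<in> borel_measurable borel"
    and X_fin: "\<And>u. u \<in> X \<Longrightarrow> energy u < \<infinity>"
    and X_lin: "\<And>u v c. u \<in> X \<Longrightarrow> v \<in> X \<Longrightarrow> (\<lambda>x. c * u x + v x) \<in> X"
    and X_shift: "\<And>u z. u \<in> X \<Longrightarrow> (\<lambda>x. u (x + z)) \<in> X"
    and X_closed: "\<And>u. u \<in> borel_measurable borel \<Longrightarrow> energy u < \<infinity> \<Longrightarrow>
        (\<And>\<epsilon>. 0 < \<epsilon> \<Longrightarrow> \<exists>v\<in>X. enn2real (energy (\<lambda>x. u x - v x)) < \<epsilon>) \<Longrightarrow> u \<in> X"
    and X_nontrivial: "\<exists>u\<in>X. \<not> (AE x in lborel. u x = 0)"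
begin

definition N :: "(real^3 \<Rightarrow> complex) \<Rightarrow> real" where "N u = enn2real (energy u)"

definition D :: "(real^3 \<Rightarrow> complex) \<Rightarrow> real" where
  "D u = enn2real (interaction k\<^sub>1 p u) + enn2real (interaction k\<^sub>2 p u)"

definition quotient :: "(real^3 \<Rightarrow> complex) \<Rightarrow> real" where
  "quotient u = N u / D u powr (1 / p)"

lemma N_nonneg: "0 \<le> N u" and D_nonneg: "0 \<le> D u"
  by (auto simp: N_def D_def)

lemma X_diff: "u \<in> X \<Longrightarrow> v \<in> X \<Longrightarrow> (\<lambda>x. u x - v x) \<in> X"
  using X_lin[of v u "-1"] by simp

lemma X_cmult: assumes "u \<in> X" shows "(\<lambda>x. c * u x) \<in> X"
  using X_lin[OF assms X_diff[OF assms assms], of c] by simp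

lemma N_cmult: "u \<in> borel_measurable borel \<Longrightarrow> N (\<lambda>x. c * u x) = (cmod c)\<^sup>2 * N u"
  by (simp add: N_def energy_cmult enn2real_mult)

lemma D_cmult: "u \<in> borel_measurable borel \<Longrightarrow> D (\<lambda>x. c * u x) = cmod c powr (2 * p) * D u"
  by (simp add: D_def interaction_cmult near.k_nonneg far.k_nonneg enn2real_mult algebra_simps)

lemma N_shift: "u \<in> borel_measurable borel \<Longrightarrow> N (\<lambda>x. u (x + z)) = N u"
  by (simp add: N_def energy_shift)

lemma D_shift: "u \<in> borel_measurable borel \<Longrightarrow> D (\<lambda>x. u (x + z)) = D u"
  by (simp add: D_def interaction_shift)

lemma N_pos: "u \<in> X \<Longrightarrow> \<not> (AE x in lborel. u x = 0) \<Longrightarrow> 0 < N u"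
  using energy_eq_0D[of u] X_meas[of u] X_fin[of u]
  by (auto simp: N_def enn2real_positive_iff zero_less_iff_neq_zero)

lemma power_integral_finite:
  assumes "u \<in> borel_measurable borel" "energy u < \<infinity>" "2 < q" "q < 6 / (3 - 2 * s)"
  shows "(\<integral>\<^sup>+x. cmod (u x) powr q \<partial>lborel) < \<infinity>"
proof -
  obtain B where "(\<integral>\<^sup>+x. cmod (u x) powr q \<partial>lborel) \<le> ennreal B"
    using sobolev_embedding[of "enn2real (energy u)" q] assms by auto
  then show ?thesis by (rule le_less_trans) simp
qed

lemma interaction_finite:
  assumes u: "u \<in> borel_measurable borel" "energy u < \<infinity>"
  shows "interaction k\<^sub>1 p u < \<infinity>" "interaction k\<^sub>2 p u < \<infinity>"
proof -
  show "interaction k\<^sub>1 p u < \<infinity>"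
    using power_integral_finite[OF u exp1] near.k_int
    by (intro le_less_trans[OF near.interaction_le[OF u(1)]]) (auto simp: ennreal_mult_less_top)
  show "interaction k\<^sub>2 p u < \<infinity>"
    using power_integral_finite[OF u exp2] far.k_int
    by (intro le_less_trans[OF far.interaction_le[OF u(1)]]) (auto simp: ennreal_mult_less_top)
qed

lemma interaction_sum:
  assumes [measurable]: "u \<in> borel_measurable borel"
  shows "interaction (\<lambda>z. k\<^sub>1 z + k\<^sub>2 z) p u = interaction k\<^sub>1 p u + interaction k\<^sub>2 p u"
proof -
  have "ennreal ((k\<^sub>1 z + k\<^sub>2 z) * t) = ennreal (k\<^sub>1 z * t) + ennreal (k\<^sub>2 z * t)" if "0 \<le> t" for z t
    using that near.k_nonneg far.k_nonneg by (simp add: distrib_right)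
  then show ?thesis
    unfolding interaction_def split_beta' by (simp add: nn_integral_add)
qed

lemma D_eq: "u \<in> X \<Longrightarrow> D u = enn2real (interaction (\<lambda>z. k\<^sub>1 z + k\<^sub>2 z) p u)"
  using interaction_finite[of u] X_meas[of u] X_fin[of u]
  by (simp add: D_def interaction_sum enn2real_plus)

lemma D_pos:
  assumes u: "u \<in> X" "\<not> (AE x in lborel. u x = 0)"
  shows "0 < D u"
proof -
  have "interaction (\<lambda>z. k\<^sub>1 z + k\<^sub>2 z) p u \<noteq> 0"
    using interaction_pos[of "\<lambda>z. k\<^sub>1 z + k\<^sub>2 z" u p] kernel_pos X_meas[OF u(1)] u(2) by auto
  moreover have "interaction (\<lambda>z. k\<^sub>1 z + k\<^sub>2 z) p u < \<infinity>"
    using interaction_finite[OF X_meas X_fin] u(1) by (simp add: interaction_sum X_meas)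
  ultimately show ?thesis
    unfolding D_eq[OF u(1)] by (simp add: enn2real_positive_iff zero_less_iff_neq_zero)
qed

lemma normalize:
  assumes "u \<in> X" "0 < D u"
  shows "\<exists>v\<in>X. D v = 1 \<and> N v = quotient u"
proof -
  define c where "c = complex_of_real (D u powr (- 1 / (2 * p)))"
  have cc: "cmod c = D u powr (- 1 / (2 * p))" by (simp add: c_def)
  have "D (\<lambda>x. c * u x) = 1"
  proof -
    have "cmod c powr (2 * p) = D u powr (- 1)"
      unfolding cc powr_powr using p_gt_1 by simp
    then show ?thesis using assms by (simp add: D_cmult X_meas powr_minus)
  qed
  moreover have "N (\<lambda>x. c * u x) = quotient u"
  proof -
    have "(cmod c)\<^sup>2 = cmod c powr 2" using assms by (simp add: cc)
    also have "\<dots> = D u powr - (1 / p)" by (simp add: cc powr_powr)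
    finally show ?thesis
      using assms by (simp add: N_cmult X_meas quotient_def powr_minus field_simps)
  qed
  ultimately show ?thesis using X_cmult[OF assms(1)] by blast
qed

lemma N_split:
  assumes "b \<in> X" "\<And>n. w n \<in> borel_measurable borel" "\<And>n. energy (w n) \<le> ennreal K"
    and "AE x in lborel. (\<lambda>n. w n x) \<longlonglongrightarrow> 0"
  shows "(\<lambda>n. N (\<lambda>x. b x + w n x) - N (w n)) \<longlonglongrightarrow> N b"
  unfolding N_def by (rule energy_split[where K="ennreal K"]) (use assms X_meas X_fin in auto)

lemma D_split:
  assumes b: "b \<in> X" and w: "\<And>n. w n \<in> borel_measurable borel" "\<And>n. energy (w n) \<le> ennreal K"
    and lim: "AE x in lborel. (\<lambda>n. w n x) \<longlonglongrightarrow> 0"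
  shows "(\<lambda>n. D (\<lambda>x. b x + w n x) - D (w n)) \<longlonglongrightarrow> D b"
proof -
  have bm: "b \<in> borel_measurable borel" "energy b < \<infinity>" using b X_meas X_fin by auto
  have wK: "energy (w n) \<le> ennreal (max K 0)" for n
    using w(2)[of n] by (rule order_trans) (intro ennreal_leI, simp)
  obtain B1 where B1: "\<And>n. (\<integral>\<^sup>+x. cmod (w n x) powr (p * r\<^sub>1) \<partial>lborel) \<le> ennreal B1"
    using sobolev_embedding[of "max K 0" "p * r\<^sub>1"] exp1 w(1) wK by (metis less_imp_le max.cobounded2)
  obtain B2 where B2: "\<And>n. (\<integral>\<^sup>+x. cmod (w n x) powr (p * r\<^sub>2) \<partial>lborel) \<le> ennreal B2"
    using sobolev_embedding[of "max K 0" "p * r\<^sub>2"] exp2 w(1) wK by (metis less_imp_le max.cobounded2)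
  have "(\<lambda>n. enn2real (interaction k\<^sub>1 p (\<lambda>x. b x + w n x)) - enn2real (interaction k\<^sub>1 p (w n)))
      \<longlonglongrightarrow> enn2real (interaction k\<^sub>1 p b)"
    by (rule near.interaction_split[OF bm(1) w(1) power_integral_finite[OF bm exp1] B1 _ lim]) simp
  moreover have "(\<lambda>n. enn2real (interaction k\<^sub>2 p (\<lambda>x. b x + w n x)) - enn2real (interaction k\<^sub>2 p (w n)))
      \<longlonglongrightarrow> enn2real (interaction k\<^sub>2 p b)"
    by (rule far.interaction_split[OF bm(1) w(1) power_integral_finite[OF bm exp2] B2 _ lim]) simp
  ultimately show ?thesis
    unfolding D_def by (rule tendsto_add[THEN tendsto_cong[THEN iffD1, rotated]]) simp
qed

text \<open>
  By \<open>vanishing\<close> and \<open>interaction_le\<close>, functions whose mass is thin everywhere have \<open>D u \<le> 1 / 2\<close>.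
\<close>
lemma nonvanishing:
  assumes "0 \<le> K"
  shows "\<exists>\<delta>>0. \<forall>u\<in>borel_measurable borel. energy u \<le> ennreal K \<longrightarrow> D u = 1 \<longrightarrow>
     (\<exists>x. ennreal \<delta> < (\<integral>\<^sup>+y\<in>ball x 1. (cmod (u y))\<^sup>2 \<partial>lborel))"
proof -
  define \<kappa>1 \<kappa>2 where "\<kappa>1 = enn2real near.\<kappa>" and "\<kappa>2 = enn2real far.\<kappa>"
  have kap: "ennreal \<kappa>1 = near.\<kappa>" "ennreal \<kappa>2 = far.\<kappa>" "0 \<le> \<kappa>1" "0 \<le> \<kappa>2"
    using near.k_int far.k_int by (auto simp: \<kappa>1_def \<kappa>2_def)
  define \<epsilon> where "\<epsilon> = 1 / (4 * (1 + \<kappa>1 + \<kappa>2))"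
  have eps: "0 < \<epsilon>" "\<epsilon> \<le> 1" "\<epsilon> * (1 + \<kappa>1 + \<kappa>2) = 1 / 4"
    using kap(3,4) by (auto simp: \<epsilon>_def)
  obtain \<delta>1 where d1: "0 < \<delta>1" "\<And>u. u \<in> borel_measurable borel \<Longrightarrow> energy u \<le> ennreal K \<Longrightarrow>
     (\<And>x. (\<integral>\<^sup>+y\<in>ball x 1. (cmod (u y))\<^sup>2 \<partial>lborel) \<le> ennreal \<delta>1) \<Longrightarrow>
     (\<integral>\<^sup>+x. cmod (u x) powr (p * r\<^sub>1) \<partial>lborel) \<le> ennreal \<epsilon>"
    using vanishing[OF assms exp1 eps(1)] by blast
  obtain \<delta>2 where d2: "0 < \<delta>2" "\<And>u. u \<in> borel_measurable borel \<Longrightarrow> energy u \<le> ennreal K \<Longrightarrow>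
     (\<And>x. (\<integral>\<^sup>+y\<in>ball x 1. (cmod (u y))\<^sup>2 \<partial>lborel) \<le> ennreal \<delta>2) \<Longrightarrow>
     (\<integral>\<^sup>+x. cmod (u x) powr (p * r\<^sub>2) \<partial>lborel) \<le> ennreal \<epsilon>"
    using vanishing[OF assms exp2 eps(1)] by blast
  show ?thesis
  proof (intro exI[of _ "min \<delta>1 \<delta>2"] conjI ballI impI)
    show "0 < min \<delta>1 \<delta>2" using d1 d2 by simp
    fix u assume u: "u \<in> borel_measurable borel" "energy u \<le> ennreal K" "D u = 1"
    show "\<exists>x. ennreal (min \<delta>1 \<delta>2) < (\<integral>\<^sup>+y\<in>ball x 1. (cmod (u y))\<^sup>2 \<partial>lborel)"
    proof (rule ccontr)
      assume "\<not> ?thesis"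
      then have le: "(\<integral>\<^sup>+y\<in>ball x 1. (cmod (u y))\<^sup>2 \<partial>lborel) \<le> ennreal (min \<delta>1 \<delta>2)" for x
        by (simp add: not_less)
      have le1: "(\<integral>\<^sup>+y\<in>ball x 1. (cmod (u y))\<^sup>2 \<partial>lborel) \<le> ennreal \<delta>1"
        and le2: "(\<integral>\<^sup>+y\<in>ball x 1. (cmod (u y))\<^sup>2 \<partial>lborel) \<le> ennreal \<delta>2" for x
        by (rule order_trans[OF le], intro ennreal_leI, simp)+
      have I: "enn2real i \<le> \<epsilon> * \<epsilon> + 2 * \<kappa> * \<epsilon>"
        if "i \<le> P * P + 2 * ennreal \<kappa> * P" "P \<le> ennreal \<epsilon>" "0 \<le> \<kappa>" for i P \<kappa>
      proof -
        have "i \<le> ennreal \<epsilon> * ennreal \<epsilon> + 2 * ennreal \<kappa> * ennreal \<epsilon>"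
          using that(2) by (intro order_trans[OF that(1)] add_mono mult_mono) auto
        also have "\<dots> = ennreal (\<epsilon> * \<epsilon> + 2 * \<kappa> * \<epsilon>)"
          using eps that(3) by (simp add: ennreal_mult)
        finally show ?thesis using eps that(3) by (intro enn2real_leI) auto
      qed
      have "enn2real (interaction k\<^sub>1 p u) \<le> \<epsilon> * \<epsilon> + 2 * \<kappa>1 * \<epsilon>"
        using near.interaction_le[OF u(1)] d1(2)[OF u(1,2) le1] kap(3) unfolding kap(1)[symmetric] by (rule I)
      moreover have "enn2real (interaction k\<^sub>2 p u) \<le> \<epsilon> * \<epsilon> + 2 * \<kappa>2 * \<epsilon>"
        using far.interaction_le[OF u(1)] d2(2)[OF u(1,2) le2] kap(4) unfolding kap(2)[symmetric] by (rule I)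
      ultimately have "D u \<le> 2 * (\<epsilon> * \<epsilon> + \<kappa>1 * \<epsilon> + \<kappa>2 * \<epsilon>)" by (simp add: D_def)
      also have "\<dots> \<le> 2 * (\<epsilon> * 1 + \<kappa>1 * \<epsilon> + \<kappa>2 * \<epsilon>)" using eps by (intro mult_left_mono add_mono order_refl) auto
      also have "\<dots> = 1 / 2" using eps(3) by (simp add: algebra_simps)
      finally show False using u(3) by simp
    qed
  qed
qed

text \<open>
  On a bounded set, convergence almost everywhere improves to \<open>L\<^sup>2\<close> convergence, since a bound in a
  higher \<open>L\<^sup>q\<close> rules out concentration: \<open>t\<^sup>2 \<le> \<eta> t\<^sup>q + T\<^sup>2\<close>.
\<close>
lemma local_mass_vanishes:
  assumes v [measurable]: "\<And>n. v n \<in> borel_measurable borel" and K: "\<And>n. energy (v n) \<le> ennreal K" "0 \<le> K"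
    and lim: "AE x in lborel. (\<lambda>n. v n x) \<longlonglongrightarrow> 0"
  shows "(\<lambda>n. \<integral>\<^sup>+x\<in>ball z 1. (cmod (v n x))\<^sup>2 \<partial>lborel) \<longlonglongrightarrow> 0"
proof -
  define q where "q = p * r\<^sub>1"
  obtain B where B: "\<And>n. (\<integral>\<^sup>+x. cmod (v n x) powr q \<partial>lborel) \<le> ennreal B"
    using sobolev_embedding[of K q] exp1 v K by (metis less_imp_le q_def)
  have "(\<lambda>n. \<integral>\<^sup>+x. indicator (ball z 1) x * (cmod (v n x))\<^sup>2 \<partial>lborel) \<longlonglongrightarrow> 0"
  proof (rule nn_integral_tendsto_0_almost_dominated[OF _ _ _ _ _ _ B])
    show "AE x in lborel. (\<lambda>n. indicator (ball z 1) x * (cmod (v n x))\<^sup>2) \<longlonglongrightarrow> 0"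
      using lim
    proof eventually_elim
      case (elim x)
      have "(\<lambda>n. indicator (ball z 1) x * (cmod (v n x))\<^sup>2) \<longlonglongrightarrow> indicator (ball z 1) x * (cmod 0)\<^sup>2"
        by (intro tendsto_intros elim)
      then show ?case by simp
    qed
    fix \<eta> :: real assume eta: "0 < \<eta>"
    define T where "T = \<eta> powr (1 / (2 - q))"
    have q: "2 < q" using exp1 by (simp add: q_def)
    have T: "0 < T" "T powr (2 - q) = \<eta>" using eta q by (auto simp: T_def powr_powr)
    have pt: "t\<^sup>2 \<le> \<eta> * t powr q + T\<^sup>2" if "0 \<le> t" for t
    proof (cases "t \<le> T")
      case True
      then have "t\<^sup>2 \<le> T\<^sup>2" using that by (intro power_mono)
      then show ?thesis using eta by (simp add: add_increasing)
    next
      case False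
      then have "t powr (2 - q) \<le> T powr (2 - q)" using T q by (intro powr_mono2') auto
      then have "t powr (2 - q) * t powr q \<le> \<eta> * t powr q" unfolding T(2) by (intro mult_right_mono) auto
      moreover have "t powr (2 - q) * t powr q = t\<^sup>2" using False T by (simp flip: powr_add)
      ultimately show ?thesis by (simp add: add_increasing2)
    qed
    show "\<exists>g\<in>borel_measurable lborel. (\<forall>x. 0 \<le> g x) \<and> (\<integral>\<^sup>+x. ennreal (g x) \<partial>lborel) < \<infinity> \<and>
        (\<forall>n x. indicator (ball z 1) x * (cmod (v n x))\<^sup>2 \<le> \<eta> * cmod (v n x) powr q + g x)"
    proof (intro bexI[of _ "\<lambda>x. T\<^sup>2 * indicator (ball z 1) x"] conjI allI)
      have "(\<integral>\<^sup>+x. ennreal (T\<^sup>2 * indicator (ball z 1) x) \<partial>lborel) = ennreal (T\<^sup>2) * emeasure lborel (ball z 1)"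
        by (subst nn_integral_cmult_indicator[symmetric]) (auto intro!: nn_integral_cong simp: indicator_def)
      also have "\<dots> < \<infinity>" by (simp add: emeasure_ball3 ennreal_mult_less_top)
      finally show "(\<integral>\<^sup>+x. ennreal (T\<^sup>2 * indicator (ball z 1) x) \<partial>lborel) < \<infinity>" .
      show "indicator (ball z 1) x * (cmod (v n x))\<^sup>2 \<le> \<eta> * cmod (v n x) powr q + T\<^sup>2 * indicator (ball z 1) x" for n x
        using pt[of "cmod (v n x)"] eta by (auto simp: indicator_def)
    qed (auto simp: indicator_def)
  qed (auto simp: indicator_def)
  moreover have "ennreal (indicator (ball z 1) x * (cmod (v n x))\<^sup>2) = ennreal ((cmod (v n x))\<^sup>2) * indicator (ball z 1) x" for n x
    by (auto simp: indicator_def)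
  ultimately show ?thesis by simp
qed

text \<open>
  A substitute for Mazur's theorem. Let \<open>d\<close> be the squared distance of the limit \<open>u\<close> to \<open>X\<close> and \<open>\<phi>\<close>
  nearly optimal. Moving from \<open>\<phi>\<close> by a fraction \<open>t\<close> towards \<open>v\<^sub>n\<close> stays in \<open>X\<close>, and in the limit the
  squared distance becomes at most \<open>(1 - t)\<^sup>2 d + t\<^sup>2 M\<close>, because by \<open>energy_split\<close> the difference
  \<open>v\<^sub>n - u\<close> is asymptotically orthogonal to \<open>u - \<phi>\<close>. For small \<open>t\<close> this is less than \<open>d\<close> unless
  \<open>d = 0\<close>.
\<close>
lemma weakly_closed:
  assumes v: "\<And>n. v n \<in> X" and K: "\<And>n. energy (v n) \<le> ennreal K"
    and u [measurable]: "u \<in> borel_measurable borel" and lim: "AE x in lborel. (\<lambda>n. v n x) \<longlonglongrightarrow> u x"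
  shows "u \<in> X"
proof -
  have [measurable]: "v n \<in> borel_measurable borel" for n using v X_meas by auto
  have uK: "energy u \<le> ennreal K" by (rule energy_liminf[of v, OF _ u lim K]) measurable
  then have ufin: "energy u < \<infinity>" by (rule le_less_trans) simp
  define w where "w n x = v n x - u x" for n x
  have [measurable]: "w n \<in> borel_measurable borel" for n unfolding w_def by measurable
  have wlim: "AE x in lborel. (\<lambda>n. w n x) \<longlonglongrightarrow> 0"
    using lim by eventually_elim (simp add: w_def LIM_zero_iff)
  define M where "M = 4 * max K 0"
  have M0: "0 \<le> M" by (simp add: M_def)
  have wM: "energy (w n) \<le> ennreal M" for n
  proof -
    have "energy (w n) \<le> 2 * energy (v n) + 2 * energy u"
      unfolding w_def[abs_def] by (intro energy_diff) measurable
    also have "\<dots> \<le> 2 * ennreal (max K 0) + 2 * ennreal (max K 0)"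
      by (intro add_mono mult_left_mono order_trans[OF K] order_trans[OF uK] ennreal_leI) auto
    also have "\<dots> = ennreal M"
      by (simp add: M_def mult_2[symmetric] ennreal_mult' flip: mult.assoc)
    finally show ?thesis .
  qed
  have NwM: "N (w n) \<le> M" for n unfolding N_def using wM M0 by (intro enn2real_leI) auto
  define d where "d = (INF \<phi>\<in>X. N (\<lambda>x. u x - \<phi> x))"
  have ne: "X \<noteq> {}" using v by auto
  have bdd: "bdd_below ((\<lambda>\<phi>. N (\<lambda>x. u x - \<phi> x)) ` X)" by (rule bdd_belowI2[of _ 0]) (rule N_nonneg)
  have d_le: "d \<le> N (\<lambda>x. u x - \<phi> x)" if "\<phi> \<in> X" for \<phi>
    unfolding d_def using bdd that by (rule cINF_lower)
  have d0: "0 \<le> d" unfolding d_def using ne N_nonneg by (intro cINF_greatest)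
  have "d = 0"
  proof (rule ccontr)
    assume "d \<noteq> 0"
    then have d: "0 < d" using d0 by simp
    define t where "t = d / (d + M + 1)"
    have t: "0 < t" "t < 1" "t * (d + M + 1) = d" using d M0 by (auto simp: t_def)
    define \<epsilon> where "\<epsilon> = t\<^sup>2 / 2"
    have eps: "0 < \<epsilon>" using t by (simp add: \<epsilon>_def)
    obtain \<phi> where phi: "\<phi> \<in> X" "N (\<lambda>x. u x - \<phi> x) < d + \<epsilon>"
      using cINF_less_iff[OF ne bdd, of "d + \<epsilon>"] eps unfolding d_def by auto
    have [measurable]: "\<phi> \<in> borel_measurable borel" using phi X_meas by auto
    define b where "b x = of_real (1 - t) * (u x - \<phi> x)" for x
    have bm [measurable]: "b \<in> borel_measurable borel" unfolding b_def by measurable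
    define w' where "w' n x = of_real (- t) * w n x" for n x
    have w'm [measurable]: "w' n \<in> borel_measurable borel" for n unfolding w'_def by measurable
    have Nb: "N b = (1 - t)\<^sup>2 * N (\<lambda>x. u x - \<phi> x)"
      using N_cmult[of "\<lambda>x. u x - \<phi> x" "of_real (1 - t)"] t unfolding b_def[abs_def]
      by (simp del: of_real_diff)
    have Nw': "N (w' n) = t\<^sup>2 * N (w n)" for n
      using N_cmult[of "w n" "of_real (- t)"] unfolding w'_def[abs_def] by (simp del: of_real_minus)
    have efin: "energy (\<lambda>x. u x - \<phi> x) < \<infinity>"
      using ufin X_fin[OF phi(1)] by (intro energy_diff_finite) auto
    have bfin: "energy b < \<infinity>"
      using efin unfolding b_def[abs_def] by (subst energy_cmult) (auto simp: ennreal_mult_less_top)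
    have w'K: "energy (w' n) \<le> ennreal (t\<^sup>2) * ennreal M" for n
      unfolding w'_def[abs_def] by (subst energy_cmult) (auto intro!: mult_left_mono wM)
    have w'lim: "AE x in lborel. (\<lambda>n. w' n x) \<longlonglongrightarrow> 0"
      using wlim
    proof eventually_elim
      case (elim x)
      have "(\<lambda>n. w' n x) \<longlonglongrightarrow> of_real (- t) * 0" unfolding w'_def by (intro tendsto_intros elim)
      then show ?case by simp
    qed
    have "(\<lambda>n. N (\<lambda>x. b x + w' n x) - N (w' n)) \<longlonglongrightarrow> N b"
      unfolding N_def
      by (rule energy_split[OF bm w'm bfin w'K _ w'lim]) (simp add: ennreal_mult_less_top)
    then have "\<forall>\<^sub>F n in sequentially. N (\<lambda>x. b x + w' n x) - N (w' n) < N b + \<epsilon>"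
      using eps by (intro order_tendstoD(2)) auto
    then obtain n where n: "N (\<lambda>x. b x + w' n x) - N (w' n) < N b + \<epsilon>"
      using eventually_happens by fastforce
    have "(\<lambda>x. of_real t * (v n x - \<phi> x) + \<phi> x) \<in> X"
      using phi v by (intro X_lin X_diff) auto
    from d_le[OF this] have "d \<le> N (\<lambda>x. b x + w' n x)"
      by (simp add: b_def w'_def w_def algebra_simps)
    also have "\<dots> \<le> (1 - t)\<^sup>2 * N (\<lambda>x. u x - \<phi> x) + t\<^sup>2 * N (w n) + \<epsilon>" using n Nb Nw'[of n] by simp
    also have "\<dots> \<le> (1 - t)\<^sup>2 * (d + \<epsilon>) + t\<^sup>2 * M + \<epsilon>"
      using phi(2) NwM[of n] by (intro add_mono mult_left_mono order_refl) auto
    also have "(1 - t)\<^sup>2 * (d + \<epsilon>) \<le> (1 - t)\<^sup>2 * d + \<epsilon>"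
    proof -
      have "(1 - t)\<^sup>2 \<le> 1" using t by (intro power_le_one) auto
      then have "(1 - t)\<^sup>2 * \<epsilon> \<le> \<epsilon>" using eps by (simp add: mult_left_le_one_le)
      then show ?thesis by (simp add: distrib_left)
    qed
    finally have "d \<le> (1 - t)\<^sup>2 * d + \<epsilon> + t\<^sup>2 * M + \<epsilon>" by simp
    then have "2 * t * d \<le> t * (t * (d + M + 1))"
      by (simp add: \<epsilon>_def power2_eq_square algebra_simps)
    then have "2 * d \<le> d" using t(1) unfolding t(3) by simp
    then show False using d by simp
  qed
  show ?thesis
  proof (rule X_closed[OF u ufin])
    fix \<epsilon> :: real assume "0 < \<epsilon>"
    then show "\<exists>v\<in>X. enn2real (energy (\<lambda>x. u x - v x)) < \<epsilon>"
      using cINF_less_iff[OF ne bdd, of \<epsilon>] \<open>d = 0\<close> unfolding d_def N_def by auto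
  qed
qed

text \<open>
  The limit \<open>v\<close> of a translated minimising sequence takes the part \<open>\<theta> = D v\<close> of the constraint, the
  remainder \<open>w\<^sub>n\<close> the part \<open>1 - \<theta>\<close>. As \<open>N\<close> splits in the same way and \<open>t \<mapsto> t\<^sup>1\<^sup>/\<^sup>p\<close> is strictly
  subadditive on \<open>(0, 1)\<close>, the case \<open>\<theta> < 1\<close> would cost more than the infimum.
\<close>
theorem minimizer_exists:
  "\<exists>v\<in>X. \<not> (AE x in lborel. v x = 0) \<and>
     (\<forall>u\<in>X. \<not> (AE x in lborel. u x = 0) \<longrightarrow> quotient v \<le> quotient u)"
proof -
  define S where "S = {u\<in>X. D u = 1}"
  define \<tau> where "\<tau> = (INF u\<in>S. N u)"
  obtain u0 where "u0 \<in> X" "\<not> (AE x in lborel. u0 x = 0)" using X_nontrivial by blast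
  then obtain u1 where "u1 \<in> X" "D u1 = 1" using normalize D_pos by blast
  then have ne: "S \<noteq> {}" by (auto simp: S_def)
  have bdd: "bdd_below (N ` S)" by (rule bdd_belowI2[of _ 0]) (rule N_nonneg)
  have tau_le: "\<tau> \<le> N u" if "u \<in> S" for u unfolding \<tau>_def using bdd that by (rule cINF_lower)
  have tau0: "0 \<le> \<tau>" unfolding \<tau>_def using ne N_nonneg by (intro cINF_greatest)
  have tau_D: "\<tau> * D u powr (1 / p) \<le> N u" if u: "u \<in> X" for u
  proof (cases "D u = 0")
    case False
    then have D: "0 < D u" using D_nonneg[of u] by simp
    obtain v where "v \<in> X" "D v = 1" "N v = quotient u" using normalize[OF u D] by blast
    then have "\<tau> \<le> quotient u" using tau_le[of v] by (simp add: S_def)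
    then show ?thesis using D by (simp add: quotient_def field_simps)
  qed (simp add: N_nonneg)
  have "\<exists>u\<in>S. N u < \<tau> + 1 / Suc n" for n
    using cINF_less_iff[OF ne bdd, of "\<tau> + 1 / Suc n"] unfolding \<tau>_def by auto
  then obtain u where u: "\<And>n. u n \<in> S" "\<And>n. N (u n) < \<tau> + 1 / Suc n" by metis
  have uX: "u n \<in> X" "D (u n) = 1" for n using u(1)[of n] by (auto simp: S_def)
  define K where "K = \<tau> + 1"
  have K0: "0 \<le> K" using tau0 by (simp add: K_def)
  have uK: "energy (u n) \<le> ennreal K" for n
  proof -
    have "N (u n) \<le> K" using u(2)[of n] by (simp add: K_def) (smt (verit) divide_le_eq_1 of_nat_0_le_iff)
    then have "ennreal (N (u n)) \<le> ennreal K" by (rule ennreal_leI)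
    then show ?thesis using X_fin[OF uX(1)[of n]] by (simp add: N_def)
  qed
  obtain \<delta> where delta: "0 < \<delta>" "\<And>u. u \<in> borel_measurable borel \<Longrightarrow> energy u \<le> ennreal K \<Longrightarrow> D u = 1 \<Longrightarrow>
     (\<exists>x. ennreal \<delta> < (\<integral>\<^sup>+y\<in>ball x 1. (cmod (u y))\<^sup>2 \<partial>lborel))"
    using nonvanishing[OF K0] by blast
  have "\<exists>z. ennreal \<delta> < (\<integral>\<^sup>+y\<in>ball z 1. (cmod (u n y))\<^sup>2 \<partial>lborel)" for n
    using uX uK X_meas by (intro delta(2)) auto
  then obtain z where z: "\<And>n. ennreal \<delta> < (\<integral>\<^sup>+y\<in>ball (z n) 1. (cmod (u n y))\<^sup>2 \<partial>lborel)" by metis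
  \<comment> \<open>Translation brings the ball that carries the mass to the origin.\<close>
  define y where "y n x = u n (x + z n)" for n x
  have yX: "y n \<in> X" for n unfolding y_def[abs_def] by (intro X_shift uX)
  have [measurable]: "u n \<in> borel_measurable borel" "y n \<in> borel_measurable borel" for n using uX yX X_meas by auto
  have yN: "N (y n) = N (u n)" "D (y n) = 1" "energy (y n) = energy (u n)" for n
    unfolding y_def[abs_def] by (simp_all add: N_shift D_shift uX energy_shift)
  have yloc: "ennreal \<delta> < (\<integral>\<^sup>+x\<in>ball 0 1. (cmod (y n x))\<^sup>2 \<partial>lborel)" for n
  proof -
    have [measurable]: "ball (z n) 1 \<in> sets borel" by simp
    have "(\<integral>\<^sup>+x\<in>ball 0 1. (cmod (y n x))\<^sup>2 \<partial>lborel)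
        = (\<integral>\<^sup>+x. (\<lambda>x. ennreal ((cmod (u n x))\<^sup>2) * indicator (ball (z n) 1) x) (x + z n) \<partial>lborel)"
      by (intro nn_integral_cong) (auto simp: y_def indicator_def dist_norm)
    also have "\<dots> = (\<integral>\<^sup>+x\<in>ball (z n) 1. (cmod (u n x))\<^sup>2 \<partial>lborel)"
      by (rule nn_integral_lborel_diff(3)) measurable
    finally show ?thesis using z[of n] by simp
  qed
  obtain r v where r: "strict_mono r" and v [measurable]: "v \<in> borel_measurable borel"
    and lim: "AE x in lborel. (\<lambda>n. y (r n) x) \<longlonglongrightarrow> v x"
  proof -
    have "energy (y n) \<le> ennreal K" for n unfolding yN(3) by (rule uK)
    from local_compactness[of y K, OF _ this] show ?thesis using that by auto
  qed
  have yK: "energy (y (r n)) \<le> ennreal K" for n using uK yN(3) by simp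
  have vX: "v \<in> X" by (rule weakly_closed[OF yX yK v lim])
  have v0: "\<not> (AE x in lborel. v x = 0)"
  proof
    assume "AE x in lborel. v x = 0"
    with lim have "AE x in lborel. (\<lambda>n. y (r n) x) \<longlonglongrightarrow> 0" by eventually_elim simp
    from local_mass_vanishes[of "\<lambda>n. y (r n)", OF _ yK K0 this, of 0]
    have "(\<lambda>n. \<integral>\<^sup>+x\<in>ball 0 1. (cmod (y (r n) x))\<^sup>2 \<partial>lborel) \<longlonglongrightarrow> 0" by simp
    then have "\<forall>\<^sub>F n in sequentially. (\<integral>\<^sup>+x\<in>ball 0 1. (cmod (y (r n) x))\<^sup>2 \<partial>lborel) < ennreal \<delta>"
      using delta(1) by (intro order_tendstoD(2)[where y=0]) auto
    then obtain n where "(\<integral>\<^sup>+x\<in>ball 0 1. (cmod (y (r n) x))\<^sup>2 \<partial>lborel) < ennreal \<delta>"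
      using eventually_happens by fastforce
    then show False using yloc[of "r n"] by simp
  qed
  define w where "w n x = y (r n) x - v x" for n x
  have wX: "w n \<in> X" for n unfolding w_def[abs_def] by (intro X_diff yX vX)
  have wm: "w n \<in> borel_measurable borel" for n using wX X_meas by auto
  have wlim: "AE x in lborel. (\<lambda>n. w n x) \<longlonglongrightarrow> 0"
    using lim by eventually_elim (simp add: w_def LIM_zero_iff)
  have sum: "(\<lambda>x. v x + w n x) = y (r n)" for n by (simp add: w_def fun_eq_iff)
  obtain M where wM: "\<And>n. energy (w n) \<le> ennreal M"
  proof
    fix n
    have "energy (w n) \<le> 2 * energy (y (r n)) + 2 * energy v"
      unfolding w_def[abs_def] by (intro energy_diff) measurable
    also have "2 * energy (y (r n)) + 2 * energy v \<le> 2 * ennreal K + 2 * energy v"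
      by (intro add_mono mult_left_mono yK) auto
    also have "\<dots> = ennreal (2 * K + 2 * N v)"
      using K0 X_fin[OF vX] N_nonneg[of v] by (simp add: ennreal_mult' N_def)
    finally show "energy (w n) \<le> ennreal (2 * K + 2 * N v)" .
  qed
  have Nlim: "(\<lambda>n. N (y (r n))) \<longlonglongrightarrow> \<tau>"
  proof (rule tendsto_sandwich[OF _ _ tendsto_const])
    show "\<forall>\<^sub>F n in sequentially. \<tau> \<le> N (y (r n))" using tau_le u(1) by (simp add: yN)
    show "\<forall>\<^sub>F n in sequentially. N (y (r n)) \<le> \<tau> + 1 / Suc (r n)"
      using u(2) by (intro always_eventually allI) (simp add: yN less_imp_le)
    have "(\<lambda>n. \<tau> + 1 / Suc n) \<longlonglongrightarrow> \<tau> + 0"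
      by (intro tendsto_add tendsto_const LIMSEQ_Suc lim_1_over_n)
    from LIMSEQ_subseq_LIMSEQ[OF this r] show "(\<lambda>n. \<tau> + 1 / Suc (r n)) \<longlonglongrightarrow> \<tau>" by (simp add: o_def)
  qed
  have Nw: "(\<lambda>n. N (w n)) \<longlonglongrightarrow> \<tau> - N v"
    using tendsto_diff[OF Nlim N_split[OF vX wm wM wlim]] by (simp add: sum)
  have Dw: "(\<lambda>n. D (w n)) \<longlonglongrightarrow> 1 - D v"
    using tendsto_diff[OF tendsto_const[of 1] D_split[OF vX wm wM wlim]] by (simp add: sum yN)
  have Nv: "0 < N v" by (rule N_pos[OF vX v0])
  have Dv: "0 < D v" by (rule D_pos[OF vX v0])
  have "0 \<le> \<tau> - N v" by (rule LIMSEQ_le_const[OF Nw]) (use N_nonneg in auto)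
  \<comment> \<open>Positivity of the infimum is a consequence here: it is at least \<open>N v\<close> for the nonzero limit \<open>v\<close>.\<close>
  then have tau_pos: "0 < \<tau>" and Nv_le: "N v \<le> \<tau>" using Nv by auto
  have Dv1: "D v \<le> 1"
  proof -
    have "0 \<le> 1 - D v" by (rule LIMSEQ_le_const[OF Dw]) (use D_nonneg in auto)
    then show ?thesis by simp
  qed
  have "(\<lambda>n. \<tau> * D (w n) powr (1 / p)) \<longlonglongrightarrow> \<tau> * (1 - D v) powr (1 / p)"
    using p_gt_1 D_nonneg by (intro tendsto_intros tendsto_powr' Dw) auto
  then have "\<tau> * (1 - D v) powr (1 / p) \<le> \<tau> - N v"
    by (rule LIMSEQ_le[OF _ Nw]) (use tau_D[OF wX] in auto)
  moreover have "\<tau> * D v powr (1 / p) \<le> N v" by (rule tau_D[OF vX])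
  ultimately have "\<tau> * (D v powr (1 / p) + (1 - D v) powr (1 / p)) \<le> \<tau> * 1" by (simp add: algebra_simps)
  then have sub: "D v powr (1 / p) + (1 - D v) powr (1 / p) \<le> 1" using tau_pos by simp
  have "D v = 1"
  proof (rule ccontr)
    assume "D v \<noteq> 1"
    then have "D v < 1" using Dv1 by simp
    have gt: "t < t powr (1 / p)" if "0 < t" "t < 1" for t
    proof -
      have "t powr 1 < t powr (1 / p)" using that p_gt_1 by (intro powr_less_mono') auto
      then show ?thesis using that by simp
    qed
    show False using gt[of "D v"] gt[of "1 - D v"] \<open>D v < 1\<close> Dv sub by simp
  qed
  then have "quotient v \<le> \<tau>" using Nv_le by (simp add: quotient_def)
  moreover have "\<tau> \<le> quotient u" if "u \<in> X" "\<not> (AE x in lborel. u x = 0)" for u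
    using tau_D[OF that(1)] D_pos[OF that] by (simp add: quotient_def field_simps)
  ultimately show ?thesis using vX v0 by (meson order_trans)
qed

end

section \<open>Power kernels, the Riesz potential and the Bessel kernel\<close>
lemma nn_integral_lborel_scale:
  fixes f :: "'a::euclidean_space \<Rightarrow> ennreal"
  assumes [measurable]: "f \<in> borel_measurable borel" and c: "0 < c"
  shows "(\<integral>\<^sup>+z. f z \<partial>lborel) = ennreal (c ^ DIM('a)) * (\<integral>\<^sup>+y. f (c *\<^sub>R y) \<partial>lborel)"
proof -
  have "(lborel :: 'a measure) = Nonnegative_Lebesgue_Integration.density (distr lborel borel (\<lambda>y. c *\<^sub>R y)) (\<lambda>_. ennreal (c ^ DIM('a)))"
    using lborel_affine[of c "0 :: 'a"] c by simp
  then have "(\<integral>\<^sup>+z. f z \<partial>lborel) = (\<integral>\<^sup>+z. f z \<partial>Nonnegative_Lebesgue_Integration.density (distr lborel borel (\<lambda>y. c *\<^sub>R y)) (\<lambda>_. ennreal (c ^ DIM('a))))"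
    by (rule arg_cong)
  also have "\<dots> = ennreal (c ^ DIM('a)) * (\<integral>\<^sup>+y. f (c *\<^sub>R y) \<partial>lborel)"
    by (simp add: nn_integral_density nn_integral_distr nn_integral_cmult)
  finally show ?thesis .
qed

text \<open>
  Integrability by comparison with a series of balls of radius \<open>b\<^sup>n\<close>. With \<open>b = 1 / 2\<close> it decides powers
  of the norm at the origin, with \<open>b = 2\<close> at infinity.
\<close>
lemma nn_integral_le_ball_series:
  fixes f :: "real^3 \<Rightarrow> real"
  assumes [measurable]: "f \<in> borel_measurable borel" and C: "0 \<le> C" and q: "0 \<le> q" "q < 1" and b: "0 < b"
    and cover: "\<And>z. f z \<le> 0 \<or> (\<exists>n. norm z < b ^ n \<and> f z \<le> C * (q / b ^ 3) ^ n)"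
  shows "(\<integral>\<^sup>+z. ennreal (f z) \<partial>lborel) < \<infinity>"
proof -
  let ?g = "\<lambda>n z. ennreal (C * (q / b ^ 3) ^ n) * indicator (ball 0 (b ^ n)) (z :: real^3)"
  have [measurable]: "ball 0 (b ^ n) \<in> sets borel" for n by simp
  have "(\<integral>\<^sup>+z. ennreal (f z) \<partial>lborel) \<le> (\<integral>\<^sup>+z. (\<Sum>n. ?g n z) \<partial>lborel)"
  proof (intro nn_integral_mono)
    fix z :: "real^3"
    show "ennreal (f z) \<le> (\<Sum>n. ?g n z)"
    proof (cases "f z \<le> 0")
      case False
      then obtain n where n: "norm z < b ^ n" "f z \<le> C * (q / b ^ 3) ^ n" using cover[of z] by auto
      define G where "G n = ?g n z" for n
      have "ennreal (f z) \<le> G n" using n by (simp add: G_def ennreal_leI)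
      also have "\<dots> \<le> (\<Sum>n. G n)"
        using sum_le_suminf[of G "{n}"] by simp
      finally show ?thesis by (simp add: G_def)
    qed (simp add: ennreal_neg)
  qed
  also have "\<dots> = (\<Sum>n. \<integral>\<^sup>+z. ?g n z \<partial>lborel)" by (rule nn_integral_suminf) measurable
  also have "\<dots> = (\<Sum>n. ennreal (C * unit_ball_vol 3 * q ^ n))"
  proof (intro suminf_cong)
    fix n
    have "(\<integral>\<^sup>+z. ?g n z \<partial>lborel) = ennreal (C * (q / b ^ 3) ^ n) * ennreal (unit_ball_vol 3 * (b ^ n) ^ 3)"
      using b by (subst nn_integral_cmult_indicator) (auto simp: emeasure_ball)
    also have "\<dots> = ennreal (C * unit_ball_vol 3 * q ^ n)"
    proof -
      have "(b ^ n) ^ 3 = (b ^ 3) ^ n" by (simp add: power_mult[symmetric] mult.commute)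
      then show ?thesis using C q b by (simp add: ennreal_mult[symmetric] power_divide)
    qed
    finally show "(\<integral>\<^sup>+z. ?g n z \<partial>lborel) = ennreal (C * unit_ball_vol 3 * q ^ n)" .
  qed
  also have "\<dots> = ennreal (\<Sum>n. C * unit_ball_vol 3 * q ^ n)"
    using C q by (intro suminf_ennreal2) (auto intro!: summable_mult summable_geometric)
  also have "\<dots> < \<infinity>" by simp
  finally show ?thesis .
qed

lemma near_power_integrable:
  assumes "0 \<le> \<beta>" "\<beta> < 3"
  shows "(\<integral>\<^sup>+z. ennreal (if norm (z :: real^3) < 1 then norm z powr - \<beta> else 0) \<partial>lborel) < \<infinity>"
proof (rule nn_integral_le_ball_series[where b = "1 / 2" and q = "2 powr (\<beta> - 3)" and C = "2 powr \<beta>"])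
  show "(2 :: real) powr (\<beta> - 3) < 1" using assms powr_less_mono[of "\<beta> - 3" 0 2] by simp
  fix z :: "real^3"
  show "(if norm z < 1 then norm z powr - \<beta> else 0) \<le> 0 \<or> (\<exists>n. norm z < (1 / 2) ^ n \<and>
    (if norm z < 1 then norm z powr - \<beta> else 0) \<le> 2 powr \<beta> * (2 powr (\<beta> - 3) / (1 / 2) ^ 3) ^ n)"
  proof (cases "norm z < 1 \<and> z \<noteq> 0")
    case True
    define n where "n = (LEAST n. (1 / 2 :: real) ^ n \<le> norm z)"
    have "\<exists>n. (1 / 2 :: real) ^ n \<le> norm z"
      using real_arch_pow_inv[of "norm z" "1 / 2"] True by (auto intro: less_imp_le)
    then have n: "(1 / 2) ^ n \<le> norm z" unfolding n_def by (rule LeastI_ex)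
    have "n \<noteq> 0" using n True by (cases n) auto
    then obtain k where k: "n = Suc k" by (cases n) auto
    have lt: "norm z < (1 / 2) ^ k"
      using not_less_Least[of k "\<lambda>n. (1 / 2 :: real) ^ n \<le> norm z"] k unfolding n_def[symmetric] by simp
    have "norm z powr - \<beta> \<le> ((1 / 2) ^ n) powr - \<beta>" using n assms by (intro powr_mono2') auto
    also have "\<dots> = 2 powr \<beta> * (2 powr \<beta>) ^ k"
    proof -
      have "((1 / 2 :: real) ^ n) powr - \<beta> = (2 powr \<beta>) ^ n"
        by (simp add: powr_realpow[symmetric] powr_powr powr_minus_divide powr_divide power_one_over mult.commute)
      then show ?thesis by (simp add: k)
    qed
    also have "(2 :: real) powr \<beta> = 2 powr (\<beta> - 3) / (1 / 2) ^ 3"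
      by (simp add: powr_diff power_divide)
    finally have "norm z powr - \<beta> \<le> 2 powr (\<beta> - 3) / (1 / 2) ^ 3 * (2 powr (\<beta> - 3) / (1 / 2) ^ 3) ^ k" .
    moreover have "2 powr (\<beta> - 3) / (1 / 2) ^ 3 = (2 :: real) powr \<beta>"
      by (simp add: powr_diff power_divide)
    ultimately show ?thesis using lt True by auto
  qed auto
qed (use assms in auto)

lemma far_power_integrable:
  assumes "3 < \<beta>"
  shows "(\<integral>\<^sup>+z. ennreal (max 1 (norm (z :: real^3)) powr - \<beta>) \<partial>lborel) < \<infinity>"
proof (rule nn_integral_le_ball_series[where b = 2 and q = "2 powr (3 - \<beta>)" and C = "2 powr \<beta>"])
  show "(2 :: real) powr (3 - \<beta>) < 1" using assms powr_less_mono[of "3 - \<beta>" 0 2] by simp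
  fix z :: "real^3"
  have q: "(2 :: real) powr (3 - \<beta>) / 2 ^ 3 = 2 powr - \<beta>" by (simp add: powr_diff powr_minus_divide)
  define n where "n = (LEAST n. norm z < (2 :: real) ^ n)"
  have "\<exists>n. norm z < (2 :: real) ^ n" by (rule real_arch_pow) simp
  then have n: "norm z < 2 ^ n" unfolding n_def by (rule LeastI_ex)
  have "max 1 (norm z) powr - \<beta> \<le> 2 powr \<beta> * (2 powr - \<beta>) ^ n"
  proof (cases n)
    case 0
    have "max 1 (norm z) powr - \<beta> \<le> 1 powr - \<beta>" using assms by (intro powr_mono2') auto
    also have "\<dots> \<le> 2 powr \<beta>" using assms by (simp add: ge_one_powr_ge_zero)
    finally show ?thesis using 0 by simp
  next
    case (Suc k)
    then have "2 ^ k \<le> norm z"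
      using not_less_Least[of k "\<lambda>n. norm z < (2 :: real) ^ n"] unfolding n_def[symmetric] by simp
    then have "max 1 (norm z) powr - \<beta> \<le> (2 ^ k) powr - \<beta>" using assms by (intro powr_mono2') auto
    also have "\<dots> = (2 powr - \<beta>) ^ k" by (simp add: powr_realpow[symmetric] powr_powr mult.commute)
    also have "\<dots> = 2 powr \<beta> * (2 powr - \<beta>) ^ n" by (simp add: Suc powr_minus)
    finally show ?thesis .
  qed
  then show "max 1 (norm z) powr - \<beta> \<le> 0 \<or> (\<exists>n. norm z < 2 ^ n \<and>
      max 1 (norm z) powr - \<beta> \<le> 2 powr \<beta> * (2 powr (3 - \<beta>) / 2 ^ 3) ^ n)"
    unfolding q using n by blast
qed auto

definition riesz_const :: "real \<Rightarrow> real" where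
  "riesz_const \<alpha> = pi powr (3/2) * 2 powr \<alpha> * (Gamma (\<alpha> / 2) / Gamma ((3 - \<alpha>) / 2))"

lemma Riesz_potential_eq: "Riesz_potential \<alpha> z = riesz_const \<alpha> * norm z powr - (3 - \<alpha>)"
  by (simp only: Riesz_potential_def riesz_const_def powr_minus divide_inverse mult_1_left)

lemma riesz_const_pos: "0 < \<alpha> \<Longrightarrow> \<alpha> < 3 \<Longrightarrow> 0 < riesz_const \<alpha>"
  by (auto simp: riesz_const_def intro!: mult_pos_pos divide_pos_pos Gamma_real_pos)

lemma Riesz_potential_measurable: "Riesz_potential \<alpha> \<in> borel_measurable borel"
  unfolding Riesz_potential_eq[abs_def] by measurable

text \<open>
  Powers of the Riesz potential are again powers of the norm, so \<open>near_power_integrable\<close> and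
  \<open>far_power_integrable\<close> decide which of them are integrable near the origin and near infinity.
\<close>
lemma Riesz_potential_powr:
  "Riesz_potential \<alpha> z powr a = riesz_const \<alpha> powr a * norm z powr - (a * (3 - \<alpha>))"
proof -
  have "- (3 - \<alpha>) * a = - (a * (3 - \<alpha>))" by (simp add: algebra_simps)
  then show ?thesis unfolding Riesz_potential_eq powr_mult powr_powr by (simp only:)
qed

lemma riesz_near_integrable:
  assumes \<alpha>: "0 < \<alpha>" "\<alpha> < 3" and a: "0 < a" "a * (3 - \<alpha>) < 3"
  shows "(\<integral>\<^sup>+z. ennreal ((if norm z < 1 then Riesz_potential \<alpha> z else 0) powr a) \<partial>lborel) < \<infinity>"
proof -
  have "(\<integral>\<^sup>+z. ennreal ((if norm z < 1 then Riesz_potential \<alpha> z else 0) powr a) \<partial>lborel)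
    = (\<integral>\<^sup>+z. ennreal (riesz_const \<alpha> powr a) * ennreal (if norm (z :: real^3) < 1 then norm z powr - (a * (3 - \<alpha>)) else 0) \<partial>lborel)"
    by (intro nn_integral_cong) (simp add: if_distrib[of "\<lambda>x. x powr a"] Riesz_potential_powr ennreal_mult)
  also have "\<dots> = ennreal (riesz_const \<alpha> powr a) * (\<integral>\<^sup>+z. ennreal (if norm (z :: real^3) < 1 then norm z powr - (a * (3 - \<alpha>)) else 0) \<partial>lborel)"
    by (rule nn_integral_cmult) measurable
  also have "\<dots> < \<infinity>"
    using near_power_integrable[of "a * (3 - \<alpha>)"] a \<alpha> by (auto simp: ennreal_mult_less_top)
  finally show ?thesis .
qed

lemma riesz_far_integrable:
  assumes \<alpha>: "0 < \<alpha>" "\<alpha> < 3" and a: "0 < a" "3 < a * (3 - \<alpha>)"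
  shows "(\<integral>\<^sup>+z. ennreal ((if norm z < 1 then 0 else Riesz_potential \<alpha> z) powr a) \<partial>lborel) < \<infinity>"
proof -
  have "(\<integral>\<^sup>+z. ennreal ((if norm z < 1 then 0 else Riesz_potential \<alpha> z) powr a) \<partial>lborel)
    \<le> (\<integral>\<^sup>+z. ennreal (riesz_const \<alpha> powr a) * ennreal (max 1 (norm (z :: real^3)) powr - (a * (3 - \<alpha>))) \<partial>lborel)"
  proof (intro nn_integral_mono)
    fix z :: "real^3"
    have "(if norm z < 1 then 0 else Riesz_potential \<alpha> z) powr a
        \<le> riesz_const \<alpha> powr a * max 1 (norm z) powr - (a * (3 - \<alpha>))"
      by (simp add: Riesz_potential_powr max_absorb2)
    then show "ennreal ((if norm z < 1 then 0 else Riesz_potential \<alpha> z) powr a)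
        \<le> ennreal (riesz_const \<alpha> powr a) * ennreal (max 1 (norm z) powr - (a * (3 - \<alpha>)))"
      by (simp add: ennreal_leI flip: ennreal_mult)
  qed
  also have "\<dots> = ennreal (riesz_const \<alpha> powr a) * (\<integral>\<^sup>+z. ennreal (max 1 (norm (z :: real^3)) powr - (a * (3 - \<alpha>))) \<partial>lborel)"
    by (rule nn_integral_cmult) measurable
  also have "\<dots> < \<infinity>"
    using far_power_integrable[OF a(2)] by (auto simp: ennreal_mult_less_top)
  finally show ?thesis .
qed

lemma powr_le_exp:
  fixes x b :: real
  assumes "0 \<le> x" "0 < b"
  shows "x powr b \<le> b powr b * exp x"
proof (cases "x = 0")
  case False
  then have x: "0 < x" using assms by simp
  have "ln x = ln b + ln (x / b)" using x assms by (simp add: ln_div)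
  also have "\<dots> \<le> ln b + x / b" using ln_le_minus_one[of "x / b"] x assms by simp
  finally have "b * ln x \<le> b * (ln b + x / b)" using assms by (intro mult_left_mono) auto
  also have "\<dots> = b * ln b + x" using assms by (simp add: field_simps)
  finally have "exp (b * ln x) \<le> exp (b * ln b + x)" by simp
  then show ?thesis using x assms by (simp add: powr_def exp_add)
qed simp

text \<open>
  The kernel of the quadratic form. Inserting the integral that defines the Bessel function cancels the
  factor \<open>\<bar>z\<bar>\<^sup>\<nu>\<close>, \<open>\<nu> = (3 + 2 s) / 2\<close>, and shows the kernel as a superposition of Gaussians in \<open>z\<close>
  (\<open>bessel_kernel_eq\<close>), whose integrand is \<open>heat_weight\<close>. Everything needed about the kernel
  is read off from that formula.
\<close>
definition bessel_kernel :: "real \<Rightarrow> real \<Rightarrow> real^3 \<Rightarrow> real" where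
  "bessel_kernel s m z = Bessel_K ((3 + 2 * s) / 2) (m * norm z) / norm z powr ((3 + 2 * s) / 2)"

definition heat_weight :: "real \<Rightarrow> real \<Rightarrow> real \<Rightarrow> real \<Rightarrow> real" where
  "heat_weight \<nu> m r t = indicator {0<..} t * (exp (- ((m * r)\<^sup>2 / (4 * t)) - t) * t powr (- 1 - \<nu>))"

lemma heat_weight_measurable [measurable]:
  "(\<lambda>(r, t). heat_weight \<nu> m r t) \<in> borel_measurable (borel \<Otimes>\<^sub>M borel)"
  unfolding heat_weight_def split_beta' by measurable

lemma heat_weight_measurable' [measurable]: "heat_weight \<nu> m r \<in> borel_measurable borel"
  unfolding heat_weight_def[abs_def] by measurable

lemma heat_weight_nonneg: "0 \<le> heat_weight \<nu> m r t" by (simp add: heat_weight_def)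

lemma Bessel_K_eq:
  "Bessel_K \<nu> (m * r) = 1/2 * (m * r / 2) powr \<nu> * (LINT t|lborel. heat_weight \<nu> m r t)"
  using integral_completion[of "heat_weight \<nu> m r" lborel]
  by (simp add: Bessel_K_def set_lebesgue_integral_def heat_weight_def[abs_def])

lemma integrable_exp_minus: "integrable lborel (\<lambda>t. indicator {0..} t * exp (- t) :: real)"
proof (rule integrableI_nonneg)
  have "(\<integral>\<^sup>+t. ennreal (indicator {0..} t * exp (- t :: real)) \<partial>lborel) =
      (\<integral>\<^sup>+t. ennreal (indicator {0..} t * t powr (1 - 1) / exp t) \<partial>lborel)"
    using AE_lborel_singleton[of "0 :: real"]
    by (intro nn_integral_cong_AE, eventually_elim) (auto simp: indicator_def exp_minus field_simps)
  also have "\<dots> = Gamma (1 :: real)" by (rule Gamma_conv_nn_integral_real[symmetric]) simp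
  finally show "(\<integral>\<^sup>+t. ennreal (indicator {0..} t * exp (- t :: real)) \<partial>lborel) < \<infinity>"
    by simp
qed auto

text \<open>
  The factor \<open>exp(- a / t) t\<^sup>-\<^sup>1\<^sup>-\<^sup>\<nu>\<close> is bounded in \<open>t\<close>, by \<open>powr_le_exp\<close>; the factor \<open>exp(- t)\<close> is
  integrable.
\<close>
lemma integrable_heat_weight:
  assumes "0 < m" "0 < r" "0 < \<nu>"
  shows "integrable lborel (heat_weight \<nu> m r)"
proof (rule Bochner_Integration.integrable_bound)
  define a C where "a = (m * r)\<^sup>2 / 4" and "C = (1 + \<nu>) powr (1 + \<nu>) / a powr (1 + \<nu>)"
  have a: "0 < a" using assms by (simp add: a_def)
  show "integrable lborel (\<lambda>t. C * (indicator {0..} t * exp (- t)))"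
    by (intro integrable_mult_right integrable_exp_minus)
  show "AE t in lborel. norm (heat_weight \<nu> m r t) \<le> norm (C * (indicator {0..} t * exp (- t)))"
  proof (rule AE_I2)
    fix t :: real
    show "norm (heat_weight \<nu> m r t) \<le> norm (C * (indicator {0..} t * exp (- t)))"
    proof (cases "0 < t")
      case True
      have "(a / t) powr (1 + \<nu>) \<le> (1 + \<nu>) powr (1 + \<nu>) * exp (a / t)"
        using a True assms by (intro powr_le_exp) auto
      then have "exp (- (a / t)) * t powr (- 1 - \<nu>) \<le> C"
        using a True by (simp add: C_def powr_divide exp_minus powr_diff powr_minus powr_add field_simps)
      then have "exp (- (a / t)) * t powr (- 1 - \<nu>) * exp (- t) \<le> C * exp (- t)"
        by (intro mult_right_mono) auto
      moreover have "heat_weight \<nu> m r t = exp (- (a / t)) * t powr (- 1 - \<nu>) * exp (- t)"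
      proof -
        have "(m * r)\<^sup>2 / (4 * t) = a / t" by (simp add: a_def)
        moreover have "exp (- (a / t) - t) = exp (- (a / t)) * exp (- t)" by (simp flip: exp_add)
        ultimately show ?thesis using True by (simp add: heat_weight_def)
      qed
      ultimately show ?thesis using True by (simp add: C_def abs_mult)
    qed (simp add: heat_weight_def)
  qed
qed measurable

lemma bessel_kernel_measurable [measurable]: "bessel_kernel s m \<in> borel_measurable borel"
  unfolding bessel_kernel_def[abs_def] Bessel_K_eq by measurable

lemma bessel_kernel_nonneg: "0 < m \<Longrightarrow> 0 \<le> bessel_kernel s m z"
  unfolding bessel_kernel_def Bessel_K_eq
  by (intro divide_nonneg_nonneg mult_nonneg_nonneg integral_nonneg_AE) (auto simp: heat_weight_nonneg)

lemma bessel_kernel_eq: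
  assumes "0 < m" "z \<noteq> 0"
  shows "bessel_kernel s m z = 1/2 * (m / 2) powr ((3 + 2 * s) / 2)
    * (LINT t|lborel. heat_weight ((3 + 2 * s) / 2) m (norm z) t)"
proof -
  have "(m * norm z / 2) powr \<nu> = (m / 2) powr \<nu> * norm z powr \<nu>" for \<nu>
    by (simp add: powr_mult[symmetric])
  then show ?thesis using assms unfolding bessel_kernel_def Bessel_K_eq by simp
qed

text \<open>
  It suffices to integrate over \<open>t\<close> between \<open>\<bar>z\<bar>\<^sup>2\<close> and \<open>2 \<bar>z\<bar>\<^sup>2\<close>, where the exponential is bounded
  below for \<open>\<bar>z\<bar> < 2\<close>.
\<close>
lemma bessel_kernel_lower:
  assumes "0 < m" "0 < s"
  shows "\<exists>c>0. \<forall>z. 0 < norm z \<longrightarrow> norm z < 2 \<longrightarrow> c * norm z powr - (3 + 2 * s) \<le> bessel_kernel s m z"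
proof -
  define \<nu> where "\<nu> = (3 + 2 * s) / 2"
  have nu: "0 < \<nu>" using assms by (simp add: \<nu>_def)
  define c where "c = 1/2 * (m / 2) powr \<nu> * (exp (- (m\<^sup>2 / 4) - 8) * 2 powr (- 1 - \<nu>))"
  show ?thesis
  proof (intro exI[of _ c] conjI allI impI)
    show "0 < c" using assms by (simp add: c_def)
    fix z :: "real^3" assume z: "0 < norm z" "norm z < 2"
    define r where "r = norm z"
    have r: "0 < r" "r < 2" using z by (auto simp: r_def)
    have r2: "r\<^sup>2 \<le> 4" using power_mono[of r 2 2] r by simp
    define d where "d = exp (- (m\<^sup>2 / 4) - 8) * (2 * r\<^sup>2) powr (- 1 - \<nu>)"
    have "d * r\<^sup>2 = (LINT t|lborel. d * indicator {r\<^sup>2..2 * r\<^sup>2} t)" using r by simp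
    also have "\<dots> \<le> (LINT t|lborel. heat_weight \<nu> m r t)"
    proof (rule integral_mono)
      show "integrable lborel (heat_weight \<nu> m r)" using assms r nu by (intro integrable_heat_weight)
      show "integrable lborel (\<lambda>t. d * indicator {r\<^sup>2..2 * r\<^sup>2} t)"
        by (intro integrable_mult_right integrable_real_indicator) auto
      fix t
      show "d * indicator {r\<^sup>2..2 * r\<^sup>2} t \<le> heat_weight \<nu> m r t"
      proof (cases "t \<in> {r\<^sup>2..2 * r\<^sup>2}")
        case True
        then have t: "r\<^sup>2 \<le> t" "t \<le> 2 * r\<^sup>2" by auto
        have t0: "0 < t" using t r by (auto intro: less_le_trans[of _ "r\<^sup>2"])
        have "(m * r)\<^sup>2 / (4 * t) \<le> m\<^sup>2 / 4"
        proof -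
          have "m\<^sup>2 * r\<^sup>2 \<le> m\<^sup>2 * t" using t by (intro mult_left_mono) auto
          then show ?thesis using t0 by (simp add: power_mult_distrib field_simps)
        qed
        then have "exp (- (m\<^sup>2 / 4) - 8) \<le> exp (- ((m * r)\<^sup>2 / (4 * t)) - t)"
          using t r2 by (subst exp_le_cancel_iff) linarith
        moreover have "(2 * r\<^sup>2) powr (- 1 - \<nu>) \<le> t powr (- 1 - \<nu>)"
          using t t0 nu by (intro powr_mono2') auto
        ultimately have "d \<le> exp (- ((m * r)\<^sup>2 / (4 * t)) - t) * t powr (- 1 - \<nu>)"
          unfolding d_def by (intro mult_mono) auto
        then show ?thesis using True t0 by (simp add: heat_weight_def)
      qed (simp add: heat_weight_nonneg)
    qed
    finally have "1/2 * (m / 2) powr \<nu> * (d * r\<^sup>2) \<le> 1/2 * (m / 2) powr \<nu> * (LINT t|lborel. heat_weight \<nu> m r t)"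
      by (intro mult_left_mono) auto
    also have "\<dots> = bessel_kernel s m z"
      using bessel_kernel_eq[of m z s] assms z by (simp add: \<nu>_def r_def)
    also have "1/2 * (m / 2) powr \<nu> * (d * r\<^sup>2) = c * r powr - (3 + 2 * s)"
    proof -
      have "r\<^sup>2 = r powr 2" using r by simp
      then have "(2 * r\<^sup>2) powr (- 1 - \<nu>) * r\<^sup>2 = 2 powr (- 1 - \<nu>) * (r powr (2 * (- 1 - \<nu>)) * r powr 2)"
        by (simp add: powr_mult powr_powr)
      also have "r powr (2 * (- 1 - \<nu>)) * r powr 2 = r powr - (3 + 2 * s)"
      proof -
        have "2 * (- 1 - \<nu>) + 2 = - (3 + 2 * s)" by (simp add: \<nu>_def field_simps)
        then show ?thesis by (simp only: powr_add[symmetric])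
      qed
      finally show ?thesis by (simp add: d_def c_def)
    qed
    finally show "c * norm z powr - (3 + 2 * s) \<le> bessel_kernel s m z" by (simp add: r_def)
  qed
qed

lemma gaussian_second_moment:
  assumes "0 < m"
  shows "(\<integral>\<^sup>+y. ennreal ((norm (y :: real^3))\<^sup>2 * exp (- (m\<^sup>2 * (norm y)\<^sup>2 / 4))) \<partial>lborel) < \<infinity>"
proof -
  define C where "C = max 1 (27 * (4 / m\<^sup>2) ^ 3)"
  have C: "1 \<le> C" "27 * (4 / m\<^sup>2) ^ 3 \<le> C" by (auto simp: C_def)
  have "(norm y)\<^sup>2 * exp (- (m\<^sup>2 * (norm y)\<^sup>2 / 4)) \<le> C * max 1 (norm y) powr - 4" for y :: "real^3"
  proof (cases "norm y \<le> 1")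
    case True
    have "(norm y)\<^sup>2 * exp (- (m\<^sup>2 * (norm y)\<^sup>2 / 4)) \<le> 1 * 1"
      using True by (intro mult_mono) (auto simp: power_le_one)
    then show ?thesis using True C by (simp add: max_absorb1)
  next
    case False
    define x where "x = m\<^sup>2 * (norm y)\<^sup>2 / 4"
    have "0 < norm y" using False by linarith
    then have x: "0 < x" using assms by (simp add: x_def)
    have "x ^ 3 \<le> 27 * exp x" using powr_le_exp[of x 3] x by simp
    then have "x ^ 3 * exp (- x) \<le> 27" by (simp add: exp_minus field_simps)
    moreover have "(norm y)\<^sup>2 * exp (- x) = (4 / m\<^sup>2) ^ 3 * (x ^ 3 * exp (- x)) / (norm y) ^ 4"
    proof -
      have "4 / m\<^sup>2 * x = (norm y)\<^sup>2" using assms by (simp add: x_def)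
      then have "(4 / m\<^sup>2) ^ 3 * x ^ 3 = ((norm y)\<^sup>2) ^ 3" by (simp only: power_mult_distrib[symmetric])
      then have "(4 / m\<^sup>2) ^ 3 * x ^ 3 = (norm y) ^ 6" by simp
      moreover have "(norm y) ^ 6 / (norm y) ^ 4 = (norm y)\<^sup>2"
      proof -
        have "(norm y) ^ 6 = (norm y)\<^sup>2 * (norm y) ^ 4" by (simp flip: power_add)
        then have "(norm y) ^ 6 / (norm y) ^ 4 = (norm y)\<^sup>2 * ((norm y) ^ 4 / (norm y) ^ 4)"
          by (simp only: times_divide_eq_right)
        then show ?thesis using \<open>0 < norm y\<close> by (simp add: divide_self)
      qed
      moreover have "(4 / m\<^sup>2) ^ 3 * (x ^ 3 * exp (- x)) / (norm y) ^ 4 = ((4 / m\<^sup>2) ^ 3 * x ^ 3) / (norm y) ^ 4 * exp (- x)"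
        by (simp only: mult.assoc times_divide_eq_left)
      ultimately show ?thesis by simp
    qed
    ultimately have "(norm y)\<^sup>2 * exp (- x) \<le> (4 / m\<^sup>2) ^ 3 * 27 / (norm y) ^ 4"
      by (simp add: divide_right_mono mult_left_mono)
    also have "\<dots> \<le> C / (norm y) ^ 4" using C by (intro divide_right_mono) (auto simp: mult.commute)
    also have "\<dots> = C * max 1 (norm y) powr - 4"
      using False by (simp add: max_absorb2 powr_minus_divide)
    finally show ?thesis by (simp add: x_def)
  qed
  then have "(\<integral>\<^sup>+y. ennreal ((norm (y :: real^3))\<^sup>2 * exp (- (m\<^sup>2 * (norm y)\<^sup>2 / 4))) \<partial>lborel)
      \<le> (\<integral>\<^sup>+y. ennreal C * ennreal (max 1 (norm (y :: real^3)) powr - 4) \<partial>lborel)"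
    using C by (intro nn_integral_mono) (simp add: ennreal_mult[symmetric] ennreal_leI)
  also have "\<dots> = ennreal C * (\<integral>\<^sup>+y. ennreal (max 1 (norm (y :: real^3)) powr - 4) \<partial>lborel)"
    by (rule nn_integral_cmult) measurable
  also have "\<dots> < \<infinity>" using far_power_integrable[of 4] by (auto simp: ennreal_mult_less_top)
  finally show ?thesis .
qed

text \<open>
  For fixed \<open>t\<close> the scaling \<open>z = \<surd>t y\<close> turns the second moment of the Gaussian into a constant times
  \<open>t\<^sup>5\<^sup>/\<^sup>2\<close>, and the remaining integral over \<open>t\<close> is \<open>\<Gamma>(1 - s)\<close>.
\<close>
lemma bessel_kernel_second_moment:
  assumes "0 < m" "0 < s" "s < 1"
  shows "(\<integral>\<^sup>+z. ennreal ((norm z)\<^sup>2 * bessel_kernel s m z) \<partial>lborel) < \<infinity>"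
proof -
  define \<nu> where "\<nu> = (3 + 2 * s) / 2"
  define c where "c = 1/2 * (m / 2) powr \<nu>"
  define A where "A = (\<integral>\<^sup>+y. ennreal ((norm (y :: real^3))\<^sup>2 * exp (- (m\<^sup>2 * (norm y)\<^sup>2 / 4))) \<partial>lborel)"
  have A: "A < \<infinity>" unfolding A_def by (rule gaussian_second_moment) fact
  have c: "0 \<le> c" by (simp add: c_def)
  have "(\<integral>\<^sup>+z. ennreal ((norm z)\<^sup>2 * bessel_kernel s m z) \<partial>lborel)
      \<le> (\<integral>\<^sup>+z. \<integral>\<^sup>+t. ennreal (c * ((norm (z :: real^3))\<^sup>2 * heat_weight \<nu> m (norm z) t)) \<partial>lborel \<partial>lborel)"
  proof (intro nn_integral_mono)
    fix z :: "real^3"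
    show "ennreal ((norm z)\<^sup>2 * bessel_kernel s m z) \<le> (\<integral>\<^sup>+t. ennreal (c * ((norm z)\<^sup>2 * heat_weight \<nu> m (norm z) t)) \<partial>lborel)"
    proof (cases "z = 0")
      case False
      have int: "integrable lborel (heat_weight \<nu> m (norm z))"
        using assms False by (intro integrable_heat_weight) (auto simp: \<nu>_def)
      have "(\<integral>\<^sup>+t. ennreal (c * ((norm z)\<^sup>2 * heat_weight \<nu> m (norm z) t)) \<partial>lborel)
          = ennreal (LINT t|lborel. c * ((norm z)\<^sup>2 * heat_weight \<nu> m (norm z) t))"
        using c int by (intro nn_integral_eq_integral) (auto simp: heat_weight_nonneg)
      moreover have eq: "bessel_kernel s m z = c * (LINT t|lborel. heat_weight \<nu> m (norm z) t)"
        unfolding c_def \<nu>_def by (rule bessel_kernel_eq[OF assms(1) False])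
      have "(LINT t|lborel. c * ((norm z)\<^sup>2 * heat_weight \<nu> m (norm z) t)) = (norm z)\<^sup>2 * bessel_kernel s m z"
        unfolding eq by simp
      ultimately show ?thesis by (simp only: order_refl)
    qed simp
  qed
  also have "\<dots> = (\<integral>\<^sup>+t. \<integral>\<^sup>+z. ennreal (c * ((norm (z :: real^3))\<^sup>2 * heat_weight \<nu> m (norm z) t)) \<partial>lborel \<partial>lborel)"
    by (rule lborel_pair.Fubini'[symmetric]) measurable
  also have "\<dots> \<le> (\<integral>\<^sup>+t. ennreal c * A * ennreal (indicator {0..} t * t powr (1 - s - 1) / exp t) \<partial>lborel)"
  proof (intro nn_integral_mono)
    fix t :: real
    show "(\<integral>\<^sup>+z. ennreal (c * ((norm (z :: real^3))\<^sup>2 * heat_weight \<nu> m (norm z) t)) \<partial>lborel)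
       \<le> ennreal c * A * ennreal (indicator {0..} t * t powr (1 - s - 1) / exp t)"
    proof (cases "0 < t")
      case True
      define e where "e = exp (- t) * t powr (- 1 - \<nu>)"
      have "(\<integral>\<^sup>+z. ennreal (c * ((norm (z :: real^3))\<^sup>2 * heat_weight \<nu> m (norm z) t)) \<partial>lborel)
        = (\<integral>\<^sup>+z. ennreal (c * e) * ennreal ((norm (z :: real^3))\<^sup>2 * exp (- (m\<^sup>2 * (norm z)\<^sup>2 / (4 * t)))) \<partial>lborel)"
      proof (intro nn_integral_cong)
        fix z :: "real^3"
        have "exp (- ((m * norm z)\<^sup>2 / (4 * t)) - t) = exp (- (m\<^sup>2 * (norm z)\<^sup>2 / (4 * t))) * exp (- t)"
          by (simp add: power_mult_distrib flip: exp_add)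
        then have eq: "c * ((norm z)\<^sup>2 * heat_weight \<nu> m (norm z) t) = (c * e) * ((norm z)\<^sup>2 * exp (- (m\<^sup>2 * (norm z)\<^sup>2 / (4 * t))))"
          using True by (simp add: heat_weight_def e_def)
        have "0 \<le> c * e" using c by (simp add: e_def)
        then show "ennreal (c * ((norm z)\<^sup>2 * heat_weight \<nu> m (norm z) t))
            = ennreal (c * e) * ennreal ((norm z)\<^sup>2 * exp (- (m\<^sup>2 * (norm z)\<^sup>2 / (4 * t))))"
          unfolding eq by (rule ennreal_mult) simp
      qed
      also have "\<dots> = ennreal (c * e) * (\<integral>\<^sup>+z. ennreal ((norm (z :: real^3))\<^sup>2 * exp (- (m\<^sup>2 * (norm z)\<^sup>2 / (4 * t)))) \<partial>lborel)"
        by (rule nn_integral_cmult) measurable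
      also have "(\<integral>\<^sup>+z. ennreal ((norm (z :: real^3))\<^sup>2 * exp (- (m\<^sup>2 * (norm z)\<^sup>2 / (4 * t)))) \<partial>lborel)
         = ennreal (sqrt t ^ 3) * (\<integral>\<^sup>+z. ennreal ((norm (sqrt t *\<^sub>R z :: real^3))\<^sup>2 * exp (- (m\<^sup>2 * (norm (sqrt t *\<^sub>R z))\<^sup>2 / (4 * t)))) \<partial>lborel)"
        using True by (subst nn_integral_lborel_scale[of _ "sqrt t"]) auto
      also have "(\<integral>\<^sup>+z. ennreal ((norm (sqrt t *\<^sub>R z :: real^3))\<^sup>2 * exp (- (m\<^sup>2 * (norm (sqrt t *\<^sub>R z))\<^sup>2 / (4 * t)))) \<partial>lborel)
        = (\<integral>\<^sup>+z. ennreal t * ennreal ((norm (z :: real^3))\<^sup>2 * exp (- (m\<^sup>2 * (norm z)\<^sup>2 / 4))) \<partial>lborel)"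
        using True by (intro nn_integral_cong, subst ennreal_mult[symmetric]) (auto simp: power_mult_distrib)
      also have "\<dots> = ennreal t * A" unfolding A_def by (rule nn_integral_cmult) measurable
      also have "ennreal (c * e) * (ennreal (sqrt t ^ 3) * (ennreal t * A)) = ennreal c * A * ennreal (e * (sqrt t ^ 3 * t))"
        using True c by (simp add: e_def ennreal_mult mult_ac)
      also have "e * (sqrt t ^ 3 * t) = indicator {0..} t * t powr (1 - s - 1) / exp t"
      proof -
        have "sqrt t ^ 3 = t powr (3 / 2)"
          using True by (simp add: powr_half_sqrt[symmetric] powr_powr powr_realpow[symmetric])
        then have "e * (sqrt t ^ 3 * t) = exp (- t) * (t powr (- 1 - \<nu>) * t powr (3 / 2) * t powr 1)"
          using True by (simp add: e_def)
        also have "t powr (- 1 - \<nu>) * t powr (3 / 2) * t powr 1 = t powr (1 - s - 1)"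
          unfolding powr_add[symmetric] by (simp add: \<nu>_def field_simps)
        finally show ?thesis using True by (simp add: exp_minus field_simps)
      qed
      finally show ?thesis by simp
    qed (simp add: heat_weight_def)
  qed
  also have "\<dots> = ennreal c * A * Gamma (1 - s)"
    using assms by (subst nn_integral_cmult) (auto simp: Gamma_conv_nn_integral_real)
  also have "\<dots> < \<infinity>" using A by (auto simp: ennreal_mult_less_top)
  finally show ?thesis .
qed

section \<open>Test functions\<close>
lemma k_times_cont_diff_SucI:
  assumes "\<And>x. (f has_derivative F x) (at x)" "\<And>v. k_times_cont_diff k (\<lambda>x. F x v)"
  shows "k_times_cont_diff (Suc k) f"
proof -
  have "frechet_derivative f (at x) = F x" for x
    using frechet_derivative_at[OF assms(1)] by simp
  then show ?thesis using assms by (auto simp: differentiable_def)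
qed

lemma k_times_cont_diff_SucD:
  assumes "k_times_cont_diff (Suc k) f"
  shows "(f has_derivative frechet_derivative f (at x)) (at x)"
    and "k_times_cont_diff k (\<lambda>x. frechet_derivative f (at x) v)"
  using assms by (auto simp: frechet_derivative_works[symmetric])

lemma k_times_cont_diff_continuous:
  assumes "k_times_cont_diff k f" shows "continuous_on UNIV f"
proof (cases k)
  case (Suc j)
  then show ?thesis using assms
    by (auto intro!: continuous_at_imp_continuous_on differentiable_imp_continuous_within)
qed (use assms in simp)

lemma k_times_cont_diff_Suc_imp:
  "k_times_cont_diff (Suc k) f \<Longrightarrow> k_times_cont_diff k f"
proof (induction k arbitrary: f)
  case 0
  then show ?case using k_times_cont_diff_continuous[OF 0] by simp
next
  case (Suc k)
  then show ?case by (auto simp del: k_times_cont_diff.simps(2) simp: k_times_cont_diff.simps(2)[of "Suc k"] k_times_cont_diff.simps(2)[of k])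
qed

lemma k_times_cont_diff_const: "k_times_cont_diff k (\<lambda>x. c)"
proof (induction k arbitrary: c)
  case (Suc k)
  show ?case by (rule k_times_cont_diff_SucI[where F = "\<lambda>x v. 0"]) (auto intro: Suc)
qed simp

lemma k_times_cont_diff_linear:
  assumes "bounded_linear L" shows "k_times_cont_diff k L"
proof (cases k)
  case 0
  then show ?thesis using assms by (simp add: linear_continuous_on)
next
  case (Suc j)
  show ?thesis unfolding Suc
    by (rule k_times_cont_diff_SucI[where F = "\<lambda>x. L"])
       (auto intro: bounded_linear_imp_has_derivative assms k_times_cont_diff_const)
qed

lemma k_times_cont_diff_add:
  "k_times_cont_diff k f \<Longrightarrow> k_times_cont_diff k g \<Longrightarrow> k_times_cont_diff k (\<lambda>x. f x + g x)"
proof (induction k arbitrary: f g)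
  case (Suc k)
  note f = k_times_cont_diff_SucD[OF Suc.prems(1)] and g = k_times_cont_diff_SucD[OF Suc.prems(2)]
  show ?case
    by (rule k_times_cont_diff_SucI[OF has_derivative_add[OF f(1) g(1)]]) (intro Suc.IH f(2) g(2))
qed (auto intro: continuous_on_add)

lemma k_times_cont_diff_mult:
  "k_times_cont_diff k f \<Longrightarrow> k_times_cont_diff k g \<Longrightarrow> k_times_cont_diff k (\<lambda>x. f x * g x)"
proof (induction k arbitrary: f g)
  case (Suc k)
  note f = k_times_cont_diff_SucD[OF Suc.prems(1)] and g = k_times_cont_diff_SucD[OF Suc.prems(2)]
  show ?case
    by (rule k_times_cont_diff_SucI[OF has_derivative_mult[OF f(1) g(1)]])
       (rule k_times_cont_diff_add[OF
          Suc.IH[OF k_times_cont_diff_Suc_imp[OF Suc.prems(1)] g(2)]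
          Suc.IH[OF f(2) k_times_cont_diff_Suc_imp[OF Suc.prems(2)]]])
qed (auto intro: continuous_on_mult)

lemma k_times_cont_diff_shift:
  "k_times_cont_diff k f \<Longrightarrow> k_times_cont_diff k (\<lambda>x. f (x + z))"
proof (induction k arbitrary: f)
  case 0
  then show ?case by (auto intro!: continuous_on_compose2[of UNIV f] continuous_intros)
next
  case (Suc k)
  note f = k_times_cont_diff_SucD[OF Suc.prems]
  have "((\<lambda>x. f (x + z)) has_derivative frechet_derivative f (at (x + z))) (at x)" for x
  proof -
    have "((\<lambda>x. x + z) has_derivative (\<lambda>h. h)) (at x)" by (auto intro!: derivative_eq_intros)
    from has_derivative_compose[OF this f(1)] show ?thesis .
  qed
  then show ?case by (rule k_times_cont_diff_SucI) (rule Suc.IH[OF f(2)])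
qed

definition quadratic_gauge :: "real^3^3 \<Rightarrow> real \<Rightarrow> real^3 \<Rightarrow> complex" where
  "quadratic_gauge A c x = exp (\<i> * complex_of_real (c / 2 * (x \<bullet> (A *v x))))"

lemma cmod_quadratic_gauge [simp]: "cmod (quadratic_gauge A c x) = 1"
  by (simp add: quadratic_gauge_def)

lemma quadratic_gauge_inverse [simp]:
  "quadratic_gauge A c x * quadratic_gauge A (- c) x = 1"
  by (simp add: quadratic_gauge_def flip: exp_add)

text \<open>
  Each derivative is the gauge function times a linear function, so smoothness follows by induction from
  the product rule.
\<close>
lemma k_times_cont_diff_quadratic_gauge: "k_times_cont_diff k (quadratic_gauge A c)"
proof (induction k)
  case 0
  have "continuous_on UNIV (quadratic_gauge A c)"
    unfolding quadratic_gauge_def by (intro continuous_intros linear_continuous_on_compose matrix_vector_mul_linear)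
  then show ?case by simp
next
  case (Suc k)
  define L where "L v x = \<i> * complex_of_real (c / 2 * (v \<bullet> (A *v x) + x \<bullet> (A *v v)))" for v x
  have "(quadratic_gauge A c has_derivative (\<lambda>v. quadratic_gauge A c x * L v x)) (at x)" for x
  proof -
    have A: "((\<lambda>x. A *v x) has_derivative (\<lambda>v. A *v v)) (at x)"
      by (rule bounded_linear_imp_has_derivative) (simp add: matrix_vector_mul_bounded_linear)
    have "((\<lambda>x. \<i> * complex_of_real (c / 2 * (x \<bullet> (A *v x)))) has_derivative (\<lambda>v. L v x)) (at x)"
      unfolding L_def by (auto intro!: derivative_eq_intros A simp: algebra_simps)
    from has_derivative_compose[OF this DERIV_exp[unfolded has_field_derivative_def]]
    show ?thesis unfolding quadratic_gauge_def .
  qed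
  then show ?case
  proof (rule k_times_cont_diff_SucI)
    fix v
    have "bounded_linear (L v)"
    proof -
      have "linear (L v)"
        by (rule linearI) (simp_all add: L_def matrix_vector_right_distrib matrix_vector_mult_scaleR inner_add algebra_simps scaleR_conv_of_real[where 'a = complex])
      then show ?thesis by (simp add: linear_conv_bounded_linear)
    qed
    then show "k_times_cont_diff k (\<lambda>x. quadratic_gauge A c x * L v x)"
      by (rule k_times_cont_diff_mult[OF Suc.IH k_times_cont_diff_linear])
  qed
qed

text \<open>
  The functions \<open>t\<^sup>-\<^sup>j exp(- 1 / t)\<close>, extended by zero to \<open>t \<le> 0\<close>. They are closed under
  differentiation up to linear combinations, which makes the bump function below smooth. The bound by
  \<open>C t\<^sup>2\<close> gives differentiability at \<open>0\<close>.
\<close>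
definition flat_exp :: "nat \<Rightarrow> real \<Rightarrow> real" where
  "flat_exp j t = (if 0 < t then inverse t ^ j * exp (- inverse t) else 0)"

lemma flat_exp_le: "\<exists>C\<ge>0. \<forall>t. \<bar>flat_exp j t\<bar> \<le> C * t\<^sup>2"
proof -
  define C :: real where "C = real (j + 2) powr real (j + 2)"
  show ?thesis
  proof (intro exI[of _ C] conjI allI)
    show "0 \<le> C" by (simp add: C_def)
    fix t :: real
    show "\<bar>flat_exp j t\<bar> \<le> C * t\<^sup>2"
    proof (cases "0 < t")
      case True
      have "inverse t ^ (j + 2) = inverse t powr real (j + 2)" using True by (subst powr_realpow) auto
      also have "\<dots> \<le> C * exp (inverse t)" unfolding C_def using True by (intro powr_le_exp) auto
      finally have "inverse t ^ (j + 2) * exp (- inverse t) \<le> C * exp (inverse t) * exp (- inverse t)"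
        by (intro mult_right_mono) auto
      also have "\<dots> = C" by (simp add: mult.assoc flip: exp_add)
      finally have "inverse t ^ j * (inverse t)\<^sup>2 * exp (- inverse t) \<le> C"
        by (simp only: power_add)
      then have "inverse t ^ j * (inverse t)\<^sup>2 * exp (- inverse t) * t\<^sup>2 \<le> C * t\<^sup>2"
        by (intro mult_right_mono) auto
      moreover have "inverse t ^ j * (inverse t)\<^sup>2 * exp (- inverse t) * t\<^sup>2 = flat_exp j t"
        using True by (simp add: flat_exp_def power_inverse)
      moreover have "0 \<le> flat_exp j t" using True by (simp add: flat_exp_def)
      ultimately show ?thesis by simp
    qed (simp add: flat_exp_def C_def)
  qed
qed

lemma flat_exp_deriv:
  "(flat_exp j has_real_derivative (flat_exp (j + 2) t - real j * flat_exp (j + 1) t)) (at t)"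
proof -
  consider "0 < t" | "t < 0" | "t = 0" by linarith
  then show ?thesis
  proof cases
    case 1
    have "((\<lambda>t. inverse t ^ j * exp (- inverse t)) has_real_derivative
        (flat_exp (j + 2) t - real j * flat_exp (j + 1) t)) (at t)"
    proof -
      have i: "(inverse has_real_derivative - (inverse t)\<^sup>2) (at t)"
        using DERIV_inverse[of t UNIV] 1 by (simp add: numeral_2_eq_2)
      have e: "((\<lambda>t. exp (- inverse t)) has_real_derivative exp (- inverse t) * (inverse t)\<^sup>2) (at t)"
        using DERIV_chain2[OF DERIV_exp DERIV_minus[OF i]] by simp
      show ?thesis
      proof (cases j)
        case 0
        then show ?thesis using e 1 by (simp add: flat_exp_def mult.commute power2_eq_square)
      next
        case (Suc k)
        show ?thesis unfolding Suc
          by (rule DERIV_cong[OF DERIV_mult[OF DERIV_power_Suc[OF i] e]])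
             (use 1 in \<open>simp add: flat_exp_def power2_eq_square algebra_simps\<close>)
      qed
    qed
    then show ?thesis
      by (rule has_field_derivative_transform_within_open[where S = "{0<..}"]) (use 1 in \<open>auto simp: flat_exp_def\<close>)
  next
    case 2
    have "((\<lambda>t. 0) has_real_derivative (flat_exp (j + 2) t - real j * flat_exp (j + 1) t)) (at t)"
      using 2 by (simp add: flat_exp_def)
    then show ?thesis
      by (rule has_field_derivative_transform_within_open[where S = "{..<0}"]) (use 2 in \<open>auto simp: flat_exp_def\<close>)
  next
    case 3
    obtain C where C: "\<And>t. \<bar>flat_exp j t\<bar> \<le> C * t\<^sup>2" using flat_exp_le by blast
    have "((\<lambda>h. flat_exp j h / h) \<longlongrightarrow> 0) (at 0)"
    proof (rule Lim_null_comparison)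
      show "\<forall>\<^sub>F h in at 0. norm (flat_exp j h / h) \<le> C * \<bar>h\<bar>"
      proof (rule eventually_at_filter[THEN iffD2], rule always_eventually, intro allI impI)
        fix h :: real assume "h \<noteq> 0"
        then show "norm (flat_exp j h / h) \<le> C * \<bar>h\<bar>"
          using C[of h] by (simp add: abs_mult power2_eq_square pos_divide_le_eq)
      qed
      show "((\<lambda>h. C * \<bar>h\<bar>) \<longlongrightarrow> 0) (at 0)" by (auto intro!: tendsto_eq_intros)
    qed
    then show ?thesis using 3 by (simp add: DERIV_def flat_exp_def)
  qed
qed

definition bump :: "nat \<Rightarrow> real^3 \<Rightarrow> complex" where
  "bump j x = complex_of_real (flat_exp j (1 - x \<bullet> x))"

lemma bump_has_derivative:
  "(bump j has_derivative (\<lambda>v. (bump (j + 2) x + complex_of_real (- real j) * bump (j + 1) x)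
     * complex_of_real (- 2 * (v \<bullet> x)))) (at x)"
proof -
  have 1: "((\<lambda>x. 1 - x \<bullet> x) has_derivative (\<lambda>v. - 2 * (v \<bullet> x))) (at x)"
    by (auto intro!: derivative_eq_intros simp: inner_commute)
  have "(flat_exp j has_derivative (\<lambda>h. h * (flat_exp (j + 2) (1 - x \<bullet> x) - real j * flat_exp (j + 1) (1 - x \<bullet> x)))) (at (1 - x \<bullet> x))"
    using flat_exp_deriv[of j "1 - x \<bullet> x"] unfolding has_field_derivative_def
    by (rule has_derivative_eq_rhs) (simp add: fun_eq_iff mult.commute)
  from has_derivative_of_real[OF has_derivative_compose[OF 1 this]] show ?thesis
    unfolding bump_def by (rule has_derivative_eq_rhs) (simp add: fun_eq_iff algebra_simps)
qed

lemma k_times_cont_diff_bump: "k_times_cont_diff k (bump j)"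
proof (induction k arbitrary: j)
  case 0
  have "continuous_on UNIV (bump j)"
    by (intro continuous_at_imp_continuous_on ballI has_derivative_continuous[OF bump_has_derivative])
  then show ?case by simp
next
  case (Suc k)
  have "bounded_linear (\<lambda>x. complex_of_real (- 2 * (v \<bullet> x)))" for v :: "real^3"
    unfolding linear_conv_bounded_linear[symmetric]
    by (rule linearI) (simp_all add: inner_add algebra_simps scaleR_conv_of_real[where 'a = complex])
  then show ?case
    by (rule k_times_cont_diff_SucI[OF bump_has_derivative k_times_cont_diff_mult[OF
          k_times_cont_diff_add[OF Suc.IH k_times_cont_diff_mult[OF k_times_cont_diff_const Suc.IH]]
          k_times_cont_diff_linear]])
qed

lemma test_functions_iff:
  "f \<in> test_functions \<longleftrightarrow> (\<forall>k. k_times_cont_diff k f) \<and> bounded {x. f x \<noteq> 0}"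
  by (simp add: test_functions_def compact_closure)

lemma test_functions_continuous: "f \<in> test_functions \<Longrightarrow> continuous_on UNIV f"
  using k_times_cont_diff_continuous unfolding test_functions_iff by blast

lemma test_functions_measurable: "f \<in> test_functions \<Longrightarrow> f \<in> borel_measurable borel"
  by (intro borel_measurable_continuous_onI test_functions_continuous)

lemma test_functions_mult:
  assumes "f \<in> test_functions" "\<And>k. k_times_cont_diff k g"
  shows "(\<lambda>x. g x * f x) \<in> test_functions"
proof -
  have "bounded {x. f x \<noteq> 0}" using assms(1) unfolding test_functions_iff by blast
  then have "bounded {x. g x * f x \<noteq> 0}" by (rule bounded_subset) auto
  then show ?thesis
    using assms k_times_cont_diff_mult unfolding test_functions_iff by blast
qed

lemma test_functions_add:
  assumes "f \<in> test_functions" "g \<in> test_functions"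
  shows "(\<lambda>x. f x + g x) \<in> test_functions"
proof -
  have "bounded ({x. f x \<noteq> 0} \<union> {x. g x \<noteq> 0})"
    using assms unfolding test_functions_iff bounded_Un by blast
  then have "bounded {x. f x + g x \<noteq> 0}" by (rule bounded_subset) auto
  then show ?thesis using assms k_times_cont_diff_add unfolding test_functions_iff by blast
qed

lemma test_functions_shift:
  assumes "f \<in> test_functions" shows "(\<lambda>x. f (x + z)) \<in> test_functions"
proof -
  have "bounded {x. f x \<noteq> 0}" using assms unfolding test_functions_iff by blast
  then have "bounded ((\<lambda>x. - z + x) ` {x. f x \<noteq> 0})" by (rule bounded_translation)
  then have "bounded {x. f (x + z) \<noteq> 0}" by (rule bounded_subset) (force simp: image_iff)
  then show ?thesis using assms k_times_cont_diff_shift unfolding test_functions_iff by blast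
qed

lemma bump_test_function: "bump 0 \<in> test_functions"
proof -
  have "{x. bump 0 x \<noteq> 0} \<subseteq> ball 0 1"
    by (auto simp: bump_def flat_exp_def norm_eq_sqrt_inner)
  then have "bounded {x. bump 0 x \<noteq> 0}" by (rule bounded_subset[OF bounded_ball])
  then show ?thesis using k_times_cont_diff_bump unfolding test_functions_iff by blast
qed

lemma bump_nonzero: "\<not> (AE x in lborel. bump 0 x = 0)"
proof
  assume z: "AE x in lborel. bump 0 x = 0"
  have nz: "bump 0 x \<noteq> 0" if "x \<in> ball 0 1" for x
  proof -
    have "norm x < 1" using that by simp
    then have "x \<bullet> x < 1" by (simp add: norm_eq_sqrt_inner)
    then show ?thesis by (simp add: bump_def flat_exp_def)
  qed
  have "AE x in lborel. x \<notin> ball (0 :: real^3) 1"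
    using z by eventually_elim (use nz in blast)
  then have "emeasure lborel (ball (0 :: real^3) 1) = 0"
    by (subst (asm) AE_iff_measurable[where N = "ball 0 1"]) auto
  then show False using unit_ball_vol_pos[of 3] by (simp add: emeasure_ball)
qed

lemma continuous_compact_support_bounded:
  fixes g :: "'a::euclidean_space \<Rightarrow> complex"
  assumes "continuous_on UNIV g" "compact K" "\<And>x. x \<notin> K \<Longrightarrow> g x = 0"
  shows "\<exists>M\<ge>0. \<forall>x. cmod (g x) \<le> M"
proof -
  have "bounded (g ` K)"
    using assms by (intro compact_imp_bounded compact_continuous_image) (auto intro: continuous_on_subset)
  then obtain M where "\<And>x. x \<in> K \<Longrightarrow> cmod (g x) \<le> M" by (auto simp: bounded_iff)
  then have "cmod (g x) \<le> max M 0" for x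
    using assms(3)[of x] by (cases "x \<in> K") (auto intro: le_max_iff_disj[THEN iffD2])
  then show ?thesis by (intro exI[of _ "max M 0"]) simp
qed

text \<open>
  The partial derivatives are continuous and vanish off the compact support, hence they are bounded.
\<close>
lemma test_functions_lipschitz:
  assumes f: "f \<in> test_functions"
  shows "\<exists>B\<ge>0. \<forall>x y. cmod (f x - f y) \<le> B * norm (x - y)"
proof -
  let ?K = "closure {x. f x \<noteq> 0}"
  let ?F = "\<lambda>x. frechet_derivative f (at x)"
  have K: "compact ?K" using f unfolding test_functions_def by blast
  have f1: "k_times_cont_diff (Suc 0) f" using f unfolding test_functions_def by blast
  note F = k_times_cont_diff_SucD[OF f1]
  have zero: "?F x v = 0" if "x \<notin> ?K" for x v
  proof -
    have "(f has_derivative (\<lambda>_. 0)) (at x)"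
    proof (rule has_derivative_transform_within_open[where s = "- ?K" and f = "\<lambda>_. 0"])
      fix y assume "y \<in> - ?K"
      then show "0 = f y" using closure_subset[of "{x. f x \<noteq> 0}"] by auto
    qed (use that in auto)
    from frechet_derivative_at[OF this] have "?F x = (\<lambda>_. 0)" by simp
    then show ?thesis by simp
  qed
  have "\<exists>M\<ge>0. \<forall>x. cmod (?F x b) \<le> M" for b
    using F(2)[of b] K zero by (intro continuous_compact_support_bounded[where K = ?K]) auto
  then obtain M where M: "\<And>b. 0 \<le> M b" "\<And>b x. cmod (?F x b) \<le> M b" by metis
  define B where "B = (\<Sum>b\<in>Basis. M b)"
  have B0: "0 \<le> B" unfolding B_def using M(1) by (intro sum_nonneg) auto
  have on: "onorm (?F x) \<le> B" for x
  proof (rule onorm_bound[OF B0])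
    fix h :: "real^3"
    have lin: "linear (?F x)" using F(1)[of x] has_derivative_linear by blast
    have "?F x h = ?F x (\<Sum>b\<in>Basis. (h \<bullet> b) *\<^sub>R b)" by (simp add: euclidean_representation)
    also have "\<dots> = (\<Sum>b\<in>Basis. (h \<bullet> b) *\<^sub>R ?F x b)" by (simp add: linear_sum[OF lin] linear_scale[OF lin])
    also have "cmod \<dots> \<le> (\<Sum>b\<in>Basis. norm h * M b)"
    proof (rule sum_norm_le)
      fix b :: "real^3" assume "b \<in> Basis"
      then have "\<bar>h \<bullet> b\<bar> \<le> norm h" by (rule Basis_le_norm)
      then have "\<bar>h \<bullet> b\<bar> * cmod (?F x b) \<le> norm h * M b"
        using M by (intro mult_mono) auto
      then show "cmod ((h \<bullet> b) *\<^sub>R ?F x b) \<le> norm h * M b" by simp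
    qed
    also have "\<dots> = B * norm h" by (simp add: B_def sum_distrib_left mult.commute)
    finally show "cmod (?F x h) \<le> B * norm h" .
  qed
  show ?thesis
  proof (intro exI[of _ B] conjI allI B0)
    fix x y
    show "cmod (f x - f y) \<le> B * norm (x - y)"
      by (rule differentiable_bound[where S = UNIV and f' = ?F]) (use F(1) on in auto)
  qed
qed

context gagliardo_energy
begin

text \<open>
  By the Lipschitz bound the integrand is at most \<open>B\<^sup>2 \<bar>x - y\<bar>\<^sup>2 J(x - y)\<close>, and it vanishes unless \<open>x\<close> or
  \<open>y\<close> lies in the support.
\<close>
lemma test_functions_energy_finite:
  assumes J2: "(\<integral>\<^sup>+z. ennreal ((norm z)\<^sup>2 * J z) \<partial>lborel) < \<infinity>" and f: "f \<in> test_functions"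
  shows "energy f < \<infinity>"
proof -
  have [measurable]: "f \<in> borel_measurable borel" by (rule test_functions_measurable[OF f])
  obtain B where B: "0 \<le> B" "\<And>x y. cmod (f x - f y) \<le> B * norm (x - y)"
    using test_functions_lipschitz[OF f] by blast
  obtain R where R: "\<And>x. f x \<noteq> 0 \<Longrightarrow> norm x \<le> R"
    using f unfolding test_functions_iff bounded_iff by blast
  define S where "S = cball (0 :: real^3) R"
  have [measurable]: "S \<in> sets borel" by (simp add: S_def)
  have Sf: "emeasure lborel S < \<infinity>" unfolding S_def by (rule emeasure_bounded_finite) simp
  have fS: "f x = 0" if "x \<notin> S" for x using R that by (auto simp: S_def)
  have "compact S" by (simp add: S_def)
  then obtain M where M: "0 \<le> M" "\<And>x. cmod (f x) \<le> M"
    using continuous_compact_support_bounded[OF test_functions_continuous[OF f] _ fS] by blast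
  let ?k = "\<lambda>z. ennreal ((norm z)\<^sup>2 * J z)"
  have "(\<integral>\<^sup>+(x, y). ennreal ((cmod (f x - f y))\<^sup>2 * J (x - y)) \<partial>(lborel \<Otimes>\<^sub>M lborel))
     \<le> (\<integral>\<^sup>+z. ennreal (B\<^sup>2) * (?k (fst z - snd z) * indicator S (fst z) + ?k (fst z - snd z) * indicator S (snd z)) \<partial>(lborel \<Otimes>\<^sub>M lborel))"
    unfolding split_beta'
  proof (intro nn_integral_mono)
    fix z :: "(real^3) \<times> (real^3)"
    show "ennreal ((cmod (f (fst z) - f (snd z)))\<^sup>2 * J (fst z - snd z))
      \<le> ennreal (B\<^sup>2) * (?k (fst z - snd z) * indicator S (fst z) + ?k (fst z - snd z) * indicator S (snd z))"
    proof (cases "fst z \<in> S \<or> snd z \<in> S")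
      case True
      have "(cmod (f (fst z) - f (snd z)))\<^sup>2 \<le> (B * norm (fst z - snd z))\<^sup>2"
        by (intro power_mono B) auto
      then have "(cmod (f (fst z) - f (snd z)))\<^sup>2 * J (fst z - snd z) \<le> B\<^sup>2 * ((norm (fst z - snd z))\<^sup>2 * J (fst z - snd z))"
        using mult_right_mono[OF _ J_nonneg[of "fst z - snd z"]] by (fastforce simp: power_mult_distrib mult_ac)
      then have "ennreal ((cmod (f (fst z) - f (snd z)))\<^sup>2 * J (fst z - snd z)) \<le> ennreal (B\<^sup>2) * ?k (fst z - snd z)"
        using J_nonneg by (subst ennreal_mult[symmetric]) (auto intro: ennreal_leI)
      also have "\<dots> \<le> ennreal (B\<^sup>2) * (?k (fst z - snd z) * indicator S (fst z) + ?k (fst z - snd z) * indicator S (snd z))"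
        using True by (intro mult_left_mono) (auto simp: indicator_def)
      finally show ?thesis .
    qed (simp add: fS)
  qed
  also have "\<dots> = ennreal (B\<^sup>2) * ((\<integral>\<^sup>+z. ?k z \<partial>lborel) * emeasure lborel S + (\<integral>\<^sup>+z. ?k z \<partial>lborel) * emeasure lborel S)"
    using nn_integral_pair_kernel[of ?k "indicator S"]
    by (simp add: nn_integral_cmult nn_integral_add split_beta')
  also have "\<dots> < \<infinity>" using J2 Sf by (auto simp: ennreal_mult_less_top)
  finally have 1: "(\<integral>\<^sup>+(x, y). ennreal ((cmod (f x - f y))\<^sup>2 * J (x - y)) \<partial>(lborel \<Otimes>\<^sub>M lborel)) < \<infinity>" .
  have "(\<integral>\<^sup>+x. ennreal ((cmod (f x))\<^sup>2) \<partial>lborel) \<le> (\<integral>\<^sup>+x. ennreal (M\<^sup>2) * indicator S x \<partial>lborel)"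
    using M fS by (intro nn_integral_mono) (auto simp: indicator_def intro!: ennreal_leI power_mono)
  also have "\<dots> = ennreal (M\<^sup>2) * emeasure lborel S" by (rule nn_integral_cmult_indicator) simp
  also have "\<dots> < \<infinity>" using Sf by (auto simp: ennreal_mult_less_top)
  finally show ?thesis using 1 by (simp add: energy_def)
qed

end

section \<open>Gauge transformation and Borel representatives\<close>
lemma borel_measurable_completion_AE:
  assumes F: "F \<in> borel_measurable M" and ae: "AE x in M. f x = F x"
  shows "f \<in> borel_measurable (completion M)"
proof (rule measurableI)
  obtain N where N: "N \<in> null_sets M" "\<And>x. x \<in> space M - N \<Longrightarrow> f x = F x"
    using AE_E3[OF ae] by auto
  fix B :: "'b set" assume B: "B \<in> sets borel"
  have "f -` B \<inter> space M = (F -` B \<inter> space M - N) \<union> (f -` B \<inter> space M \<inter> N)"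
    using N(2) by auto
  moreover have "(F -` B \<inter> space M - N) \<union> (f -` B \<inter> space M \<inter> N) \<in> sets (completion M)"
  proof (rule sets.Un)
    show "F -` B \<inter> space M - N \<in> sets (completion M)"
      using F B N(1) by (auto intro!: sets.Diff measurable_sets)
    show "f -` B \<inter> space M \<inter> N \<in> sets (completion M)"
      using N(1) null_sets_completion_subset[of "f -` B \<inter> space M \<inter> N" N M]
      by (auto simp: null_sets_completionI)
  qed
  ultimately show "f -` B \<inter> space (completion M) \<in> sets (completion M)"
    by (simp only: space_completion)
qed simp

lemma integral_lebesgue_cong_AE:
  fixes f F :: "'a::euclidean_space \<Rightarrow> 'b::{banach, second_countable_topology}"
  assumes F: "F \<in> borel_measurable borel" and ae: "AE x in lborel. f x = F x"
  shows "integrable lebesgue f \<longleftrightarrow> integrable lborel F"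
    and "integral\<^sup>L lebesgue f = integral\<^sup>L lborel F"
proof -
  have Fm: "F \<in> borel_measurable lborel" using F by simp
  have fm: "f \<in> borel_measurable lebesgue" by (rule borel_measurable_completion_AE[OF Fm ae])
  have Fm': "F \<in> borel_measurable lebesgue" using Fm by (rule measurable_completion)
  have ae': "AE x in lebesgue. f x = F x" using ae by (rule AE_completion)
  show "integrable lebesgue f \<longleftrightarrow> integrable lborel F"
    using integrable_cong_AE[OF fm Fm' ae'] integrable_completion[OF Fm] by simp
  show "integral\<^sup>L lebesgue f = integral\<^sup>L lborel F"
    using integral_cong_AE[OF fm Fm' ae'] integral_completion[OF Fm] by simp
qed

text \<open>
  Divergence needs no separate case in the second equation: both the Bochner integral and the real
  part of an infinite nonnegative integral are \<open>0\<close>.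
\<close>
lemma complex_integral_lebesgue_nonneg:
  fixes f :: "'a::euclidean_space \<Rightarrow> complex" and F :: "'a \<Rightarrow> real"
  assumes F [measurable]: "F \<in> borel_measurable borel" and F0: "\<And>x. 0 \<le> F x"
    and ae: "AE x in lborel. f x = complex_of_real (F x)"
  shows "integrable lebesgue f \<longleftrightarrow> (\<integral>\<^sup>+x. ennreal (F x) \<partial>lborel) < \<infinity>"
    and "Re (integral\<^sup>L lebesgue f) = enn2real (\<integral>\<^sup>+x. ennreal (F x) \<partial>lborel)"
proof -
  have m: "(\<lambda>x. complex_of_real (F x)) \<in> borel_measurable borel" by measurable
  have "integrable lborel F \<longleftrightarrow> (\<integral>\<^sup>+x. ennreal (F x) \<partial>lborel) < \<infinity>"
    using F0 by (simp add: integrable_iff_bounded)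
  then show "integrable lebesgue f \<longleftrightarrow> (\<integral>\<^sup>+x. ennreal (F x) \<partial>lborel) < \<infinity>"
    unfolding integral_lebesgue_cong_AE(1)[OF m ae] complex_of_real_integrable_eq .
  have "integral\<^sup>L lborel F = enn2real (\<integral>\<^sup>+x. ennreal (F x) \<partial>lborel)"
    using F0 by (intro integral_eq_nn_integral) auto
  then show "Re (integral\<^sup>L lebesgue f) = enn2real (\<integral>\<^sup>+x. ennreal (F x) \<partial>lborel)"
    unfolding integral_lebesgue_cong_AE(2)[OF m ae] integral_complex_of_real by simp
qed

lemma complex_borel_representative:
  fixes f :: "'a::euclidean_space \<Rightarrow> complex"
  assumes "f \<in> borel_measurable lebesgue"
  shows "\<exists>F\<in>borel_measurable borel. AE x in lborel. F x = f x"
proof -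
  have "(\<lambda>x. Re (f x)) \<in> borel_measurable lebesgue" "(\<lambda>x. Im (f x)) \<in> borel_measurable lebesgue"
    using assms by auto
  from this[THEN completion_ex_borel_measurable_real] obtain R I where
    RI: "R \<in> borel_measurable lborel" "AE x in lborel. Re (f x) = R x"
        "I \<in> borel_measurable lborel" "AE x in lborel. Im (f x) = I x" by auto
  have "(\<lambda>x. Complex (R x) (I x)) \<in> borel_measurable borel"
    using RI(1,3) unfolding Complex_eq by simp
  moreover have "AE x in lborel. Complex (R x) (I x) = f x"
    using RI(2,4) by eventually_elim (simp add: complex_eq_iff)
  ultimately show ?thesis by (intro bexI[of _ "\<lambda>x. Complex (R x) (I x)"])
qed

text \<open>
  The iterated integral is a double integral by Fubini's theorem. Where the inner integral diverges it has
  the default value \<open>0\<close>; this does no harm, because such points \<open>x\<close> with \<open>u x \<noteq> 0\<close> form a null set.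
\<close>
lemma Choquard_energy_eq_interaction:
  assumes w [measurable]: "w \<in> borel_measurable borel"
    and ae: "AE x in lborel. cmod (u x) = cmod (w x)"
    and R: "Riesz_potential \<alpha> \<in> borel_measurable borel" "\<And>z. 0 \<le> Riesz_potential \<alpha> z"
    and fin: "interaction (Riesz_potential \<alpha>) p w < \<infinity>"
  shows "Choquard_energy \<alpha> p u = enn2real (interaction (Riesz_potential \<alpha>) p w)"
proof -
  let ?R = "Riesz_potential \<alpha>"
  note R(1) [measurable]
  define f where "f z = ?R (fst z - snd z) * (cmod (w (fst z)) powr p * cmod (w (snd z)) powr p)" for z
  have fm [measurable]: "f \<in> borel_measurable (lborel \<Otimes>\<^sub>M lborel)" unfolding f_def by measurable
  have f0: "0 \<le> f z" for z using R(2) by (simp add: f_def)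
  have eq: "interaction ?R p w = (\<integral>\<^sup>+z. ennreal (f z) \<partial>(lborel \<Otimes>\<^sub>M lborel))"
    by (simp add: interaction_def f_def split_beta')
  have int: "integrable (lborel \<Otimes>\<^sub>M lborel) f"
    using fin f0 unfolding eq by (intro integrableI_nonneg) auto
  have conv: "fun_convolution ?R (\<lambda>y. cmod (u y) powr p) x = (LINT y|lborel. ?R (x - y) * cmod (w y) powr p)" for x
    unfolding fun_convolution_def
    by (rule integral_lebesgue_cong_AE(2)) (measurable, use ae in \<open>eventually_elim, simp\<close>)
  have "Choquard_energy \<alpha> p u = (LINT x|lborel. (LINT y|lborel. ?R (x - y) * cmod (w y) powr p) * cmod (w x) powr p)"
    unfolding Choquard_energy_def conv
    by (rule integral_lebesgue_cong_AE(2)) (measurable, use ae in \<open>eventually_elim, simp\<close>)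
  also have "\<dots> = (LINT x|lborel. LINT y|lborel. f (x, y))"
  proof -
    have "f (x, y) = ?R (x - y) * cmod (w y) powr p * cmod (w x) powr p" for x y
      by (simp add: f_def)
    then show ?thesis by simp
  qed
  also have "\<dots> = integral\<^sup>L (lborel \<Otimes>\<^sub>M lborel) f"
    using int by (rule lborel_pair.integral_fst')
  also have "\<dots> = enn2real (interaction ?R p w)"
    unfolding eq using f0 by (intro integral_eq_nn_integral) auto
  finally show ?thesis .
qed

locale symmetric_magnetic_field =
  fixes s m :: real and A :: "real^3^3"
  assumes s01: "0 < s" "s < 1" and m_pos: "0 < m" and A_sym: "transpose A = A"
begin

text \<open>
  Dividing the inner product by \<open>m\<^sup>2\<^sup>s\<close> gives the mass term the coefficient \<open>1\<close> that it has in
  \<open>energy\<close>; the weight is what then stands in front of the double integral.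
\<close>
definition kernel_weight :: real where
  "kernel_weight = C_const s / 2 * m powr ((3 + 2 * s) / 2) / m powr (2 * s)"

definition J :: "real^3 \<Rightarrow> real" where "J z = kernel_weight * bessel_kernel s m z"

lemma kernel_weight_pos: "0 < kernel_weight"
  using s01 m_pos by (auto simp: kernel_weight_def C_const_def intro!: divide_pos_pos mult_pos_pos Gamma_real_pos)

text \<open>
  The locale for the energy wants a definite constant; any one admissible for the lower bound will do.
\<close>
definition c\<^sub>0 :: real where
  "c\<^sub>0 = (SOME c. 0 < c \<and> (\<forall>z. 0 < norm z \<longrightarrow> norm z < 2 \<longrightarrow> c * norm z powr - (3 + 2 * s) \<le> J z))"

lemma c0: "0 < c\<^sub>0" "0 < norm z \<Longrightarrow> norm z < 2 \<Longrightarrow> c\<^sub>0 * norm z powr - (3 + 2 * s) \<le> J z"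
proof -
  obtain c where c: "0 < c" "\<And>z. 0 < norm z \<Longrightarrow> norm z < 2 \<Longrightarrow> c * norm z powr - (3 + 2 * s) \<le> bessel_kernel s m z"
    using bessel_kernel_lower[OF m_pos s01(1)] by blast
  have "\<exists>c. 0 < c \<and> (\<forall>z. 0 < norm z \<longrightarrow> norm z < 2 \<longrightarrow> c * norm z powr - (3 + 2 * s) \<le> J z)"
    using c kernel_weight_pos
    by (intro exI[of _ "kernel_weight * c"]) (auto simp: J_def mult.assoc intro!: mult_pos_pos mult_left_mono)
  from someI_ex[OF this] show "0 < c\<^sub>0"
    "0 < norm z \<Longrightarrow> norm z < 2 \<Longrightarrow> c\<^sub>0 * norm z powr - (3 + 2 * s) \<le> J z"
    unfolding c\<^sub>0_def by blast+
qed

sublocale gagliardo_energy J s c\<^sub>0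
proof
  show "J \<in> borel_measurable borel" unfolding J_def[abs_def] by measurable
  show "0 \<le> J z" for z using kernel_weight_pos bessel_kernel_nonneg[OF m_pos] by (simp add: J_def)
qed (use s01 c0 in auto)

lemma J_second_moment: "(\<integral>\<^sup>+z. ennreal ((norm z)\<^sup>2 * J z) \<partial>lborel) < \<infinity>"
proof -
  have "(\<integral>\<^sup>+z. ennreal ((norm z)\<^sup>2 * J z) \<partial>lborel)
      = (\<integral>\<^sup>+z. ennreal kernel_weight * ennreal ((norm z)\<^sup>2 * bessel_kernel s m z) \<partial>lborel)"
    using kernel_weight_pos bessel_kernel_nonneg[OF m_pos]
    by (intro nn_integral_cong, subst ennreal_mult[symmetric]) (auto simp: J_def mult_ac)
  also have "\<dots> = ennreal kernel_weight * (\<integral>\<^sup>+z. ennreal ((norm z)\<^sup>2 * bessel_kernel s m z) \<partial>lborel)"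
    by (rule nn_integral_cmult) measurable
  also have "\<dots> < \<infinity>"
    using bessel_kernel_second_moment[OF m_pos s01] by (auto simp: ennreal_mult_less_top)
  finally show ?thesis .
qed

text \<open>
  Symmetry of \<open>A\<close> cancels the mixed terms \<open>x \<bullet> A y\<close> and \<open>y \<bullet> A x\<close>, so the phase is a quotient of
  values of one function.
\<close>
lemma magnetic_phase_eq:
  "magnetic_phase (\<lambda>x. A *v x) x y = quadratic_gauge A (- 1) x * quadratic_gauge A 1 y"
proof -
  have "x \<bullet> (A *v y) = y \<bullet> (A *v x)"
  proof -
    have "x v* A = A *v x" using transpose_matrix_vector[of A x] A_sym by simp
    then show ?thesis using dot_lmul_matrix[of x A y] by (simp add: inner_commute)
  qed
  then have "(x - y) \<bullet> (A *v ((1/2) *\<^sub>R (x + y))) = 1/2 * (x \<bullet> (A *v x)) - 1/2 * (y \<bullet> (A *v y))"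
    by (simp add: matrix_vector_mult_scaleR matrix_vector_right_distrib inner_diff_left inner_add_right algebra_simps)
  then show ?thesis
    by (simp add: magnetic_phase_def quadratic_gauge_def exp_add[symmetric] algebra_simps)
qed

definition ungauge :: "(real^3 \<Rightarrow> complex) \<Rightarrow> real^3 \<Rightarrow> complex" where
  "ungauge u x = quadratic_gauge A (- 1) x * u x"

lemma cmod_ungauge: "cmod (ungauge u x) = cmod (u x)" by (simp add: ungauge_def norm_mult)

lemma magnetic_integrand_eq:
  "magnetic_integrand (\<lambda>x. A *v x) s m u u z
    = complex_of_real ((cmod (ungauge u (fst z) - ungauge u (snd z)))\<^sup>2 * bessel_kernel s m (fst z - snd z))"
proof -
  obtain x y where z: "z = (x, y)" by (cases z)
  let ?d = "magnetic_phase (\<lambda>x. A *v x) x y * u x - u y"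
  have "quadratic_gauge A 1 y * (quadratic_gauge A (- 1) y * u y) = u y"
    by (simp only: mult.assoc[symmetric] quadratic_gauge_inverse mult_1_left)
  then have "?d = quadratic_gauge A 1 y * (ungauge u x - ungauge u y)"
    by (simp add: magnetic_phase_eq ungauge_def right_diff_distrib mult.left_commute mult.commute)
  then have "cmod ?d = cmod (ungauge u x - ungauge u y)" by (simp add: norm_mult)
  moreover have "?d * cnj ?d = complex_of_real ((cmod ?d)\<^sup>2)" by (simp only: complex_norm_square)
  ultimately have "?d * cnj ?d = complex_of_real ((cmod (ungauge u x - ungauge u y))\<^sup>2)" by simp
  then show ?thesis by (simp add: z magnetic_integrand_def bessel_kernel_def)
qed

text \<open>
  Integration over pairs is done for the product of Borel measures, so each Lebesgue measurable function is
  replaced by a Borel function that agrees almost everywhere with its gauge transform.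
\<close>
definition represents :: "(real^3 \<Rightarrow> complex) \<Rightarrow> (real^3 \<Rightarrow> complex) \<Rightarrow> bool" where
  "represents w u \<longleftrightarrow> w \<in> borel_measurable borel \<and> (AE x in lborel. w x = ungauge u x)"

lemma quadratic_gauge_measurable: "quadratic_gauge A c \<in> borel_measurable borel"
  using k_times_cont_diff_continuous[OF k_times_cont_diff_quadratic_gauge]
  by (intro borel_measurable_continuous_onI)

lemma represents_exists:
  assumes "u \<in> borel_measurable lebesgue" shows "\<exists>w. represents w u"
proof -
  have "quadratic_gauge A (- 1) \<in> borel_measurable lebesgue"
    using quadratic_gauge_measurable by (intro measurable_completion) simp
  then have "ungauge u \<in> borel_measurable lebesgue"
    unfolding ungauge_def[abs_def] using assms by (rule borel_measurable_times)
  from complex_borel_representative[OF this] show ?thesis unfolding represents_def by blast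
qed

lemma represents_measurable:
  assumes "represents w u" shows "u \<in> borel_measurable lebesgue"
proof (rule borel_measurable_completion_AE)
  note quadratic_gauge_measurable [measurable]
  have [measurable]: "w \<in> borel_measurable borel" using assms by (simp add: represents_def)
  show "(\<lambda>x. quadratic_gauge A 1 x * w x) \<in> borel_measurable lborel" by measurable
  have "AE x in lborel. w x = ungauge u x" using assms by (simp add: represents_def)
  then show "AE x in lborel. u x = quadratic_gauge A 1 x * w x"
    by eventually_elim (simp only: ungauge_def mult.assoc[symmetric] quadratic_gauge_inverse mult_1_left)
qed

lemma represented_energy:
  assumes rep: "represents w u"
  shows "u \<in> finite_energy_space (\<lambda>x. A *v x) s m \<longleftrightarrow> energy w < \<infinity>"
    and "energy w < \<infinity> \<Longrightarrow> magnetic_inner (\<lambda>x. A *v x) s m u u = m powr (2 * s) * enn2real (energy w)"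
proof -
  have w [measurable]: "w \<in> borel_measurable borel" and ae: "AE x in lborel. w x = ungauge u x"
    using rep by (auto simp: represents_def)
  define F where "F z = (cmod (w (fst z) - w (snd z)))\<^sup>2 * bessel_kernel s m (fst z - snd z)" for z
  have Fm: "F \<in> borel_measurable (lborel \<Otimes>\<^sub>M lborel)" unfolding F_def by measurable
  then have Fm': "F \<in> borel_measurable borel" by (simp add: lborel_prod)
  have F0: "0 \<le> F z" for z using bessel_kernel_nonneg[OF m_pos] by (simp add: F_def)
  have aeF: "AE z in lborel. magnetic_integrand (\<lambda>x. A *v x) s m u u z = complex_of_real (F z)"
    using AE_lborel_pairI[OF ae] unfolding lborel_prod
    by eventually_elim (simp add: magnetic_integrand_eq F_def)
  have aeG: "AE x in lborel. u x * cnj (u x) = complex_of_real ((cmod (w x))\<^sup>2)"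
    using ae by eventually_elim (simp only: complex_norm_square[symmetric] cmod_ungauge)
  note F = complex_integral_lebesgue_nonneg[OF Fm' F0 aeF]
  have G0: "\<And>x. 0 \<le> (cmod (w x))\<^sup>2" and Gm: "(\<lambda>x. (cmod (w x))\<^sup>2) \<in> borel_measurable borel"
    by simp measurable
  note G = complex_integral_lebesgue_nonneg[OF Gm G0 aeG]
  have en: "energy w = ennreal kernel_weight * (\<integral>\<^sup>+z. ennreal (F z) \<partial>lborel) + (\<integral>\<^sup>+x. ennreal ((cmod (w x))\<^sup>2) \<partial>lborel)"
  proof -
    have "(\<integral>\<^sup>+z. ennreal ((cmod (w (fst z) - w (snd z)))\<^sup>2 * J (fst z - snd z)) \<partial>(lborel \<Otimes>\<^sub>M lborel))
        = (\<integral>\<^sup>+z. ennreal kernel_weight * ennreal (F z) \<partial>(lborel \<Otimes>\<^sub>M lborel))"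
      using kernel_weight_pos F0
      by (intro nn_integral_cong, subst ennreal_mult[symmetric]) (auto simp: J_def F_def mult_ac)
    also have "\<dots> = ennreal kernel_weight * (\<integral>\<^sup>+z. ennreal (F z) \<partial>(lborel \<Otimes>\<^sub>M lborel))"
      by (rule nn_integral_cmult) (rule measurable_compose[OF Fm measurable_ennreal])
    finally show ?thesis by (simp add: energy_def split_beta' lborel_prod)
  qed
  have fin: "energy w < \<infinity> \<longleftrightarrow> (\<integral>\<^sup>+z. ennreal (F z) \<partial>lborel) < \<infinity> \<and> (\<integral>\<^sup>+x. ennreal ((cmod (w x))\<^sup>2) \<partial>lborel) < \<infinity>"
    using kernel_weight_pos by (auto simp: en ennreal_mult_less_top)
  show "u \<in> finite_energy_space (\<lambda>x. A *v x) s m \<longleftrightarrow> energy w < \<infinity>"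
    using represents_measurable[OF rep] F(1) G(1) fin by (simp add: finite_energy_space_def)
  assume "energy w < \<infinity>"
  then have f: "(\<integral>\<^sup>+z. ennreal (F z) \<partial>lborel) < \<infinity>" "(\<integral>\<^sup>+x. ennreal ((cmod (w x))\<^sup>2) \<partial>lborel) < \<infinity>"
    using fin by auto
  have "m powr (2 * s) * enn2real (energy w)
     = m powr (2 * s) * kernel_weight * enn2real (\<integral>\<^sup>+z. ennreal (F z) \<partial>lborel)
        + m powr (2 * s) * enn2real (\<integral>\<^sup>+x. ennreal ((cmod (w x))\<^sup>2) \<partial>lborel)"
    using f kernel_weight_pos unfolding en
    by (subst enn2real_plus) (auto simp: ennreal_mult_less_top enn2real_mult algebra_simps)
  also have "m powr (2 * s) * kernel_weight = C_const s / 2 * m powr ((3 + 2 * s) / 2)"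
    using m_pos by (simp add: kernel_weight_def)
  finally show "magnetic_inner (\<lambda>x. A *v x) s m u u = m powr (2 * s) * enn2real (energy w)"
    by (simp add: magnetic_inner_def magnetic_form_def F(2) G(2))
qed

text \<open>
  The gauge transform of the magnetic Sobolev space, on the level of Borel functions (\<open>Sobolev_iff\<close>).
\<close>
definition X :: "(real^3 \<Rightarrow> complex) set" where
  "X = {w \<in> borel_measurable borel. energy w < \<infinity> \<and>
      (\<forall>\<epsilon>>0. \<exists>\<phi>\<in>test_functions. enn2real (energy (\<lambda>x. w x - \<phi> x)) < \<epsilon>)}"

lemma test_energy: "\<phi> \<in> test_functions \<Longrightarrow> energy \<phi> < \<infinity>"
  by (rule test_functions_energy_finite[OF J_second_moment])

lemma enn2real_energy_add:
  assumes "u \<in> borel_measurable borel" "v \<in> borel_measurable borel" "energy u < \<infinity>" "energy v < \<infinity>"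
  shows "enn2real (energy (\<lambda>x. u x + v x)) \<le> 2 * enn2real (energy u) + 2 * enn2real (energy v)"
proof -
  have "energy (\<lambda>x. u x + v x) \<le> ennreal (2 * enn2real (energy u) + 2 * enn2real (energy v))"
    using energy_add_le[OF assms(1,2)] assms(3,4) by (simp add: ennreal_mult')
  then show ?thesis by (intro enn2real_leI) auto
qed

text \<open>
  The gauge factor is smooth and unimodular, so it maps test functions to test functions in both
  directions and turns the magnetic norm into the energy.
\<close>
lemma Sobolev_iff:
  assumes rep: "represents w u"
  shows "u \<in> magnetic_Sobolev (\<lambda>x. A *v x) s m \<longleftrightarrow> w \<in> X"
proof -
  have wm: "w \<in> borel_measurable borel" using rep by (simp add: represents_def)
  have norm: "magnetic_norm (\<lambda>x. A *v x) s m (\<lambda>x. u x - \<phi> x)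
      = sqrt (m powr (2 * s) * enn2real (energy (\<lambda>x. w x - ungauge \<phi> x)))"
    and test: "ungauge \<phi> \<in> test_functions"
    if phi: "\<phi> \<in> test_functions" and fin: "energy w < \<infinity>" for \<phi>
  proof -
    show t: "ungauge \<phi> \<in> test_functions"
      unfolding ungauge_def[abs_def] by (intro test_functions_mult phi k_times_cont_diff_quadratic_gauge)
    have "AE x in lborel. w x = ungauge u x" using rep by (simp add: represents_def)
    then have "AE x in lborel. w x - ungauge \<phi> x = ungauge (\<lambda>x. u x - \<phi> x) x"
      by eventually_elim (simp add: ungauge_def right_diff_distrib)
    moreover have "(\<lambda>x. w x - ungauge \<phi> x) \<in> borel_measurable borel"
      using wm test_functions_measurable[OF t] by (rule borel_measurable_diff)
    ultimately have "represents (\<lambda>x. w x - ungauge \<phi> x) (\<lambda>x. u x - \<phi> x)"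
      by (simp add: represents_def)
    from represented_energy(2)[OF this] show "magnetic_norm (\<lambda>x. A *v x) s m (\<lambda>x. u x - \<phi> x)
      = sqrt (m powr (2 * s) * enn2real (energy (\<lambda>x. w x - ungauge \<phi> x)))"
      using energy_diff_finite[OF wm test_functions_measurable[OF t] fin test_energy[OF t]]
      by (simp add: magnetic_norm_def)
  qed
  have c: "0 < m powr (2 * s)" using m_pos by simp
  show ?thesis
  proof
    assume u: "u \<in> magnetic_Sobolev (\<lambda>x. A *v x) s m"
    then have fin: "energy w < \<infinity>"
      using represented_energy(1)[OF rep] by (simp add: magnetic_Sobolev_def)
    have "\<exists>\<phi>\<in>test_functions. enn2real (energy (\<lambda>x. w x - \<phi> x)) < \<epsilon>" if "0 < \<epsilon>" for \<epsilon>
    proof -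
      have "0 < sqrt (m powr (2 * s) * \<epsilon>)" using c that by simp
      then obtain \<phi> where phi: "\<phi> \<in> test_functions" "magnetic_norm (\<lambda>x. A *v x) s m (\<lambda>x. u x - \<phi> x) < sqrt (m powr (2 * s) * \<epsilon>)"
        using u unfolding magnetic_Sobolev_def by blast
      then have "enn2real (energy (\<lambda>x. w x - ungauge \<phi> x)) < \<epsilon>"
        using c by (simp add: norm[OF _ fin])
      then show ?thesis using test[OF phi(1) fin] by blast
    qed
    then show "w \<in> X" using wm fin by (simp add: X_def)
  next
    assume w: "w \<in> X"
    then have fin: "energy w < \<infinity>" by (simp add: X_def)
    have "\<exists>\<phi>\<in>test_functions. magnetic_norm (\<lambda>x. A *v x) s m (\<lambda>x. u x - \<phi> x) < \<epsilon>" if "0 < \<epsilon>" for \<epsilon>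
    proof -
      have "0 < \<epsilon>\<^sup>2 / m powr (2 * s)" using c that by simp
      then obtain \<psi> where psi: "\<psi> \<in> test_functions" "enn2real (energy (\<lambda>x. w x - \<psi> x)) < \<epsilon>\<^sup>2 / m powr (2 * s)"
        using w unfolding X_def by blast
      define \<phi> where "\<phi> x = quadratic_gauge A 1 x * \<psi> x" for x
      have phi: "\<phi> \<in> test_functions"
        unfolding \<phi>_def[abs_def] by (intro test_functions_mult psi k_times_cont_diff_quadratic_gauge)
      have "ungauge \<phi> x = \<psi> x" for x
        using quadratic_gauge_inverse[of A "-1" x]
        by (simp only: ungauge_def \<phi>_def mult.assoc[symmetric] minus_minus mult_1_left)
      then have eq: "magnetic_norm (\<lambda>x. A *v x) s m (\<lambda>x. u x - \<phi> x) = sqrt (m powr (2 * s) * enn2real (energy (\<lambda>x. w x - \<psi> x)))"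
        using norm[OF phi fin] by simp
      have "m powr (2 * s) * enn2real (energy (\<lambda>x. w x - \<psi> x)) < \<epsilon>\<^sup>2"
        using psi(2) c by (simp add: pos_less_divide_eq mult.commute)
      then have "magnetic_norm (\<lambda>x. A *v x) s m (\<lambda>x. u x - \<phi> x) < sqrt (\<epsilon>\<^sup>2)"
        unfolding eq by (rule real_sqrt_less_mono)
      then show ?thesis using phi that by auto
    qed
    then show "u \<in> magnetic_Sobolev (\<lambda>x. A *v x) s m"
      using represented_energy(1)[OF rep] fin by (simp add: magnetic_Sobolev_def)
  qed
qed

lemma X_measurable: "w \<in> X \<Longrightarrow> w \<in> borel_measurable borel" and X_finite: "w \<in> X \<Longrightarrow> energy w < \<infinity>"
  by (auto simp: X_def)

lemma X_approx:
  "w \<in> X \<Longrightarrow> 0 < \<epsilon> \<Longrightarrow> \<exists>\<phi>\<in>test_functions. enn2real (energy (\<lambda>x. w x - \<phi> x)) < \<epsilon>"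
  by (simp add: X_def)

lemma X_lin:
  assumes u: "u \<in> X" and v: "v \<in> X" shows "(\<lambda>x. c * u x + v x) \<in> X"
proof -
  have m [measurable]: "u \<in> borel_measurable borel" "v \<in> borel_measurable borel" using u v by (auto simp: X_def)
  have cm [measurable]: "(\<lambda>x. c * u x) \<in> borel_measurable borel" by measurable
  have "energy (\<lambda>x. c * u x) < \<infinity>" using X_finite[OF u] by (simp add: energy_cmult ennreal_mult_less_top)
  then have fin: "energy (\<lambda>x. c * u x + v x) < \<infinity>"
    using X_finite[OF v] by (intro le_less_trans[OF energy_add_le]) (auto simp: ennreal_mult_less_top)
  have "\<exists>\<phi>\<in>test_functions. enn2real (energy (\<lambda>x. c * u x + v x - \<phi> x)) < \<epsilon>" if "0 < \<epsilon>" for \<epsilon>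
  proof -
    define \<eta> where "\<eta> = \<epsilon> / (4 * ((cmod c)\<^sup>2 + 1))"
    have eta: "0 < \<eta>" "(cmod c)\<^sup>2 * \<eta> \<le> \<epsilon> / 4" "\<eta> \<le> \<epsilon> / 4"
    proof -
      have p: "0 < (cmod c)\<^sup>2 + 1" by (intro add_nonneg_pos) auto
      then show "0 < \<eta>" using that by (simp add: \<eta>_def)
      have "k * (\<epsilon> / (4 * k)) = \<epsilon> / 4" if "0 < k" for k using that by simp
      from this[OF p] have "((cmod c)\<^sup>2 + 1) * \<eta> = \<epsilon> / 4" by (simp only: \<eta>_def)
      moreover have "0 \<le> (cmod c)\<^sup>2 * \<eta>" using \<open>0 < \<eta>\<close> by simp
      ultimately show "(cmod c)\<^sup>2 * \<eta> \<le> \<epsilon> / 4" "\<eta> \<le> \<epsilon> / 4" using \<open>0 < \<eta>\<close> by (auto simp: algebra_simps)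
    qed
    obtain \<phi> where phi: "\<phi> \<in> test_functions" "enn2real (energy (\<lambda>x. u x - \<phi> x)) < \<eta>"
      using X_approx[OF u eta(1)] by blast
    obtain \<psi> where psi: "\<psi> \<in> test_functions" "enn2real (energy (\<lambda>x. v x - \<psi> x)) < \<eta>"
      using X_approx[OF v eta(1)] by blast
    have pm [measurable]: "\<phi> \<in> borel_measurable borel" "\<psi> \<in> borel_measurable borel"
      using phi psi by (auto intro: test_functions_measurable)
    have f1: "energy (\<lambda>x. u x - \<phi> x) < \<infinity>" by (intro energy_diff_finite m pm X_finite u test_energy phi)
    have f2: "energy (\<lambda>x. v x - \<psi> x) < \<infinity>" by (intro energy_diff_finite m pm X_finite v test_energy psi)
    have f3: "energy (\<lambda>x. c * (u x - \<phi> x)) < \<infinity>" using f1 by (simp add: energy_cmult ennreal_mult_less_top)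
    have "(\<lambda>x. c * \<phi> x + \<psi> x) \<in> test_functions"
      by (intro test_functions_add test_functions_mult phi psi k_times_cont_diff_const)
    moreover have "enn2real (energy (\<lambda>x. c * u x + v x - (c * \<phi> x + \<psi> x))) < \<epsilon>"
    proof -
      have "enn2real (energy (\<lambda>x. c * (u x - \<phi> x) + (v x - \<psi> x)))
         \<le> 2 * enn2real (energy (\<lambda>x. c * (u x - \<phi> x))) + 2 * enn2real (energy (\<lambda>x. v x - \<psi> x))"
        by (rule enn2real_energy_add[OF _ _ f3 f2]) measurable
      also have "enn2real (energy (\<lambda>x. c * (u x - \<phi> x))) = (cmod c)\<^sup>2 * enn2real (energy (\<lambda>x. u x - \<phi> x))"
        by (simp add: energy_cmult enn2real_mult)
      also have "2 * \<dots> + 2 * enn2real (energy (\<lambda>x. v x - \<psi> x)) < 2 * ((cmod c)\<^sup>2 * \<eta>) + 2 * \<eta>"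
        using phi(2) psi(2) by (intro add_le_less_mono mult_left_mono) auto
      also have "\<dots> \<le> \<epsilon>" using eta by simp
      finally show ?thesis by (simp add: algebra_simps)
    qed
    ultimately show ?thesis by (intro bexI[of _ "\<lambda>x. c * \<phi> x + \<psi> x"])
  qed
  then show ?thesis using fin by (simp add: X_def)
qed

lemma X_shift:
  assumes u: "u \<in> X" shows "(\<lambda>x. u (x + z)) \<in> X"
proof -
  have m [measurable]: "u \<in> borel_measurable borel" using u by (auto simp: X_def)
  have "\<exists>\<phi>\<in>test_functions. enn2real (energy (\<lambda>x. u (x + z) - \<phi> x)) < \<epsilon>" if e: "0 < \<epsilon>" for \<epsilon>
  proof -
    obtain \<phi> where phi: "\<phi> \<in> test_functions" "enn2real (energy (\<lambda>x. u x - \<phi> x)) < \<epsilon>"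
      using X_approx[OF u e] by blast
    have "(\<lambda>x. u x - \<phi> x) \<in> borel_measurable borel" using test_functions_measurable[OF phi(1)] by measurable
    from energy_shift[OF this, of z] have "enn2real (energy (\<lambda>x. u (x + z) - \<phi> (x + z))) < \<epsilon>" using phi(2) by simp
    then show ?thesis using test_functions_shift[OF phi(1), of z] by (intro bexI)
  qed
  then show ?thesis using X_finite[OF u] by (simp add: X_def energy_shift)
qed

lemma X_closed:
  assumes u: "u \<in> borel_measurable borel" "energy u < \<infinity>"
    and near: "\<And>\<epsilon>. 0 < \<epsilon> \<Longrightarrow> \<exists>v\<in>X. enn2real (energy (\<lambda>x. u x - v x)) < \<epsilon>"
  shows "u \<in> X"
proof -
  note u(1) [measurable]
  have "\<exists>\<phi>\<in>test_functions. enn2real (energy (\<lambda>x. u x - \<phi> x)) < \<epsilon>" if e: "0 < \<epsilon>" for \<epsilon>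
  proof -
    obtain v where v: "v \<in> X" "enn2real (energy (\<lambda>x. u x - v x)) < \<epsilon> / 4" using near[of "\<epsilon> / 4"] e by auto
    obtain \<phi> where phi: "\<phi> \<in> test_functions" "enn2real (energy (\<lambda>x. v x - \<phi> x)) < \<epsilon> / 4"
      using X_approx[OF v(1), of "\<epsilon> / 4"] e by auto
    have m [measurable]: "v \<in> borel_measurable borel" "\<phi> \<in> borel_measurable borel"
      using v phi by (auto intro: X_measurable test_functions_measurable)
    have f: "energy (\<lambda>x. u x - v x) < \<infinity>" "energy (\<lambda>x. v x - \<phi> x) < \<infinity>"
      by (intro energy_diff_finite u m X_finite v test_energy phi)+
    have "enn2real (energy (\<lambda>x. (u x - v x) + (v x - \<phi> x)))
        \<le> 2 * enn2real (energy (\<lambda>x. u x - v x)) + 2 * enn2real (energy (\<lambda>x. v x - \<phi> x))"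
      by (rule enn2real_energy_add[OF _ _ f]) measurable
    then have "enn2real (energy (\<lambda>x. u x - \<phi> x)) < \<epsilon>" using v(2) phi(2) by simp
    then show ?thesis using phi(1) by blast
  qed
  then show ?thesis using u by (simp add: X_def)
qed

lemma test_functions_subset_X: "\<phi> \<in> test_functions \<Longrightarrow> \<phi> \<in> X"
proof -
  assume phi: "\<phi> \<in> test_functions"
  have "enn2real (energy (\<lambda>x. \<phi> x - \<phi> x)) = 0" by (simp add: energy_def split_beta')
  then have "\<exists>\<psi>\<in>test_functions. enn2real (energy (\<lambda>x. \<phi> x - \<psi> x)) < \<epsilon>" if "0 < \<epsilon>" for \<epsilon>
    using phi that by (intro bexI[of _ \<phi>]) simp_all
  then show "\<phi> \<in> X"
    unfolding X_def using test_functions_measurable[OF phi] test_energy[OF phi] by blast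
qed

end

section \<open>Attainment of the infimum\<close>
text \<open>
  The borderline is \<open>r = 6 / (3 + \<alpha>)\<close>, where the required power of the Riesz potential is
  \<open>\<bar>z\<bar>\<^sup>-\<^sup>3\<close>, integrable neither at the origin nor at infinity. The range of \<open>p\<close> says that \<open>p r\<close> lies strictly
  between \<open>2\<close> and the critical exponent, so \<open>r\<close> can be increased for the near part and decreased for
  the far part.
\<close>
lemma subcritical_exponents:
  fixes s \<alpha> p :: real
  assumes s: "0 < s" "s < 1" and \<alpha>: "0 < \<alpha>" "\<alpha> < 3" and p: "1 + \<alpha> / 3 < p" "p < (3 + \<alpha>) / (3 - 2 * s)"
  obtains r\<^sub>1 r\<^sub>2 where "1 < r\<^sub>1" "r\<^sub>1 \<le> 2" "2 < p * r\<^sub>1" "p * r\<^sub>1 < 6 / (3 - 2 * s)" "r\<^sub>1 / (2 * (r\<^sub>1 - 1)) * (3 - \<alpha>) < 3"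
    and "1 < r\<^sub>2" "r\<^sub>2 \<le> 2" "2 < p * r\<^sub>2" "p * r\<^sub>2 < 6 / (3 - 2 * s)" "3 < r\<^sub>2 / (2 * (r\<^sub>2 - 1)) * (3 - \<alpha>)"
proof -
  define q where "q = 6 / (3 - 2 * s)"
  define r where "r = 6 / (3 + \<alpha>)"
  have p1: "1 < p" using p(1) \<alpha> by simp
  have r: "1 < r" "r < 2" using \<alpha> by (auto simp: r_def field_simps)
  have pr: "2 < p * r" "p * r < q"
  proof -
    show "2 < p * r" using p(1) \<alpha> by (simp add: r_def field_simps)
    have "p * r < (3 + \<alpha>) / (3 - 2 * s) * r" using p(2) r by (intro mult_strict_right_mono) auto
    also have "\<dots> = q"
    proof -
      have "x / d * (6 / x) = 6 / d" if "x \<noteq> 0" for x d :: real using that by simp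
      from this[of "3 + \<alpha>"] show ?thesis using \<alpha> unfolding r_def q_def by fastforce
    qed
    finally show "p * r < q" .
  qed
  have "r < min 2 (q / p)" using r pr p1 by (simp add: pos_less_divide_eq mult.commute)
  then obtain r1 where r1: "r < r1" "r1 < min 2 (q / p)" using dense by blast
  have "max 1 (2 / p) < r" using r pr p1 by (simp add: pos_divide_less_eq mult.commute)
  then obtain r2 where r2: "max 1 (2 / p) < r2" "r2 < r" using dense by blast
  have k: "t / (2 * (t - 1)) * (3 - \<alpha>) < 3 \<longleftrightarrow> r < t" "3 < t / (2 * (t - 1)) * (3 - \<alpha>) \<longleftrightarrow> t < r" if "1 < t" for t
  proof -
    have eq: "t / (2 * (t - 1)) * (3 - \<alpha>) = t * (3 - \<alpha>) / (2 * (t - 1))" by simp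
    have pos: "0 < 2 * (t - 1)" "0 < 3 + \<alpha>" using that \<alpha> by auto
    show "t / (2 * (t - 1)) * (3 - \<alpha>) < 3 \<longleftrightarrow> r < t"
      unfolding eq r_def pos_divide_less_eq[OF pos(1)] pos_divide_less_eq[OF pos(2)] by (simp add: algebra_simps)
    show "3 < t / (2 * (t - 1)) * (3 - \<alpha>) \<longleftrightarrow> t < r"
      unfolding eq r_def pos_less_divide_eq[OF pos(1)] pos_less_divide_eq[OF pos(2)] by (simp add: algebra_simps)
  qed
  show thesis
  proof (rule that[of r1 r2])
    show "1 < r1" "r1 \<le> 2" "1 < r2" "r2 \<le> 2" using r r1 r2 by auto
    then show "r1 / (2 * (r1 - 1)) * (3 - \<alpha>) < 3" "3 < r2 / (2 * (r2 - 1)) * (3 - \<alpha>)"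
      using k r1 r2 by auto
    have "p * r < p * r1" "p * r2 < p * r" using r1 r2 p1 by auto
    then show "2 < p * r1" "p * r2 < 6 / (3 - 2 * s)" using pr by (auto simp: q_def)
    show "p * r1 < 6 / (3 - 2 * s)" "2 < p * r2"
      unfolding q_def[symmetric]
      using r1 r2 p1 by (auto simp: pos_less_divide_eq pos_divide_less_eq mult.commute)
  qed
qed

theorem theorem5p7:
  fixes s m \<alpha> p :: real and A :: "real^3^3"
  assumes "0 < s" "s < 1" "0 < m" "0 < \<alpha>" "\<alpha> < 3"
    and "transpose A = A"
    and "p \<in> {1 + \<alpha> / 3 <..< (3 + \<alpha>) / (3 - 2 * s)}"
  shows "\<exists>u\<in>magnetic_Sobolev_nonzero (\<lambda>x. A *v x) s m.
           magnetic_quotient (\<lambda>x. A *v x) s m \<alpha> p u = tau (\<lambda>x. A *v x) s m \<alpha> p"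
proof -
  interpret symmetric_magnetic_field s m A by unfold_locales (use assms in auto)
  have p: "1 + \<alpha> / 3 < p" "p < (3 + \<alpha>) / (3 - 2 * s)" using assms(7) by auto
  have p1: "1 < p" using p(1) assms(4) by simp
  obtain r\<^sub>1 r\<^sub>2 where r1: "1 < r\<^sub>1" "r\<^sub>1 \<le> 2" "2 < p * r\<^sub>1" "p * r\<^sub>1 < 6 / (3 - 2 * s)" "r\<^sub>1 / (2 * (r\<^sub>1 - 1)) * (3 - \<alpha>) < 3"
    and r2: "1 < r\<^sub>2" "r\<^sub>2 \<le> 2" "2 < p * r\<^sub>2" "p * r\<^sub>2 < 6 / (3 - 2 * s)" "3 < r\<^sub>2 / (2 * (r\<^sub>2 - 1)) * (3 - \<alpha>)"
    using subcritical_exponents[OF assms(1,2,4,5) p] .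
  define k\<^sub>1 where "k\<^sub>1 z = (if norm z < 1 then Riesz_potential \<alpha> z else 0)" for z
  define k\<^sub>2 where "k\<^sub>2 z = (if norm z < 1 then 0 else Riesz_potential \<alpha> z)" for z
  have R0: "0 \<le> Riesz_potential \<alpha> z" for z
    using riesz_const_pos[OF assms(4,5)] by (simp add: Riesz_potential_eq)
  note Riesz_potential_measurable [measurable]
  interpret nonlocal_quotient J s c\<^sub>0 k\<^sub>1 r\<^sub>1 p "r\<^sub>1 / (2 * (r\<^sub>1 - 1))" k\<^sub>2 r\<^sub>2 "r\<^sub>2 / (2 * (r\<^sub>2 - 1))" X
  proof unfold_locales
    show "k\<^sub>1 \<in> borel_measurable borel" "k\<^sub>2 \<in> borel_measurable borel"
      unfolding k\<^sub>1_def[abs_def] k\<^sub>2_def[abs_def] by measurable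
    show "0 \<le> k\<^sub>1 z" "0 \<le> k\<^sub>2 z" for z using R0 by (auto simp: k\<^sub>1_def k\<^sub>2_def)
    show "(\<integral>\<^sup>+z. ennreal (k\<^sub>1 z powr (r\<^sub>1 / (2 * (r\<^sub>1 - 1)))) \<partial>lborel) < \<infinity>"
      unfolding k\<^sub>1_def using r1 assms by (intro riesz_near_integrable) auto
    show "(\<integral>\<^sup>+z. ennreal (k\<^sub>2 z powr (r\<^sub>2 / (2 * (r\<^sub>2 - 1)))) \<partial>lborel) < \<infinity>"
      unfolding k\<^sub>2_def using r2 assms by (intro riesz_far_integrable) auto
    show "0 < k\<^sub>1 z + k\<^sub>2 z" if "z \<noteq> 0" for z
      using that riesz_const_pos[OF assms(4,5)] by (auto simp: k\<^sub>1_def k\<^sub>2_def Riesz_potential_eq)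
    show "\<exists>u\<in>X. \<not> (AE x in lborel. u x = 0)"
      using bump_nonzero test_functions_subset_X[OF bump_test_function] by blast
    show "1 < p" "1 \<le> p" using p1 by auto
    show "u \<in> borel_measurable borel" "energy u < \<infinity>" if "u \<in> X" for u
      using X_measurable[OF that] X_finite[OF that] by auto
    show "(\<lambda>x. c * u x + v x) \<in> X" if "u \<in> X" "v \<in> X" for u v c using that by (rule X_lin)
    show "(\<lambda>x. u (x + z)) \<in> X" if "u \<in> X" for u z using that by (rule X_shift)
    show "u \<in> X" if "u \<in> borel_measurable borel" "energy u < \<infinity>"
      "\<And>\<epsilon>. 0 < \<epsilon> \<Longrightarrow> \<exists>v\<in>X. enn2real (energy (\<lambda>x. u x - v x)) < \<epsilon>" for u
      using that by (rule X_closed)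
  qed (fact r1 r2 refl)+
  have sum: "(\<lambda>z. k\<^sub>1 z + k\<^sub>2 z) = Riesz_potential \<alpha>" by (auto simp: k\<^sub>1_def k\<^sub>2_def)
  have Q: "magnetic_quotient (\<lambda>x. A *v x) s m \<alpha> p u = m powr (2 * s) * quotient w"
    if rep: "represents w u" and w: "w \<in> X" for u w
  proof -
    have wm: "w \<in> borel_measurable borel" and fin: "energy w < \<infinity>" using w X_meas X_fin by auto
    have "interaction (Riesz_potential \<alpha>) p w < \<infinity>"
      using interaction_finite[OF wm fin] interaction_sum[OF wm] by (simp add: sum)
    moreover have "AE x in lborel. w x = ungauge u x" using rep by (simp add: represents_def)
    then have "AE x in lborel. cmod (u x) = cmod (w x)" by eventually_elim (simp add: cmod_ungauge)
    ultimately have "Choquard_energy \<alpha> p u = D w"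
      using Choquard_energy_eq_interaction[OF wm _ Riesz_potential_measurable R0] D_eq[OF w] by (simp add: sum)
    moreover have "(magnetic_norm (\<lambda>x. A *v x) s m u)\<^sup>2 = m powr (2 * s) * N w"
      using represented_energy(2)[OF rep fin] by (simp add: magnetic_norm_def N_def)
    ultimately show ?thesis by (simp add: magnetic_quotient_def quotient_def)
  qed
  have nonzero: "(AE x in lebesgue. u x = 0) \<longleftrightarrow> (AE x in lborel. w x = 0)" if "represents w u" for u w
  proof -
    have "AE x in lborel. w x = ungauge u x" using that by (simp add: represents_def)
    then have "AE x in lborel. w x = 0 \<longleftrightarrow> u x = 0"
      by eventually_elim (metis cmod_ungauge norm_eq_zero)
    then have "(AE x in lborel. w x = 0) \<longleftrightarrow> (AE x in lborel. u x = 0)"       by (auto elim: eventually_elim2)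
    then show ?thesis by (simp add: AE_completion_iff)
  qed
  obtain v where v: "v \<in> X" "\<not> (AE x in lborel. v x = 0)"
    and min: "\<And>w. w \<in> X \<Longrightarrow> \<not> (AE x in lborel. w x = 0) \<Longrightarrow> quotient v \<le> quotient w"
    using minimizer_exists by blast
  define u where "u x = quadratic_gauge A 1 x * v x" for x
  have "ungauge u x = v x" for x
    using quadratic_gauge_inverse[of A "-1" x]
    by (simp only: ungauge_def u_def mult.assoc[symmetric] minus_minus mult_1_left)
  then have rep: "represents v u" using X_meas[OF v(1)] by (simp add: represents_def)
  have u: "u \<in> magnetic_Sobolev_nonzero (\<lambda>x. A *v x) s m"
    using Sobolev_iff[OF rep] nonzero[OF rep] v by (simp add: magnetic_Sobolev_nonzero_def)
  have "magnetic_quotient (\<lambda>x. A *v x) s m \<alpha> p u \<le> magnetic_quotient (\<lambda>x. A *v x) s m \<alpha> p u'"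
    if u': "u' \<in> magnetic_Sobolev_nonzero (\<lambda>x. A *v x) s m" for u'
  proof -
    have "u' \<in> borel_measurable lebesgue"
      using u' by (simp add: magnetic_Sobolev_nonzero_def magnetic_Sobolev_def finite_energy_space_def)
    then obtain w where w: "represents w u'" using represents_exists by blast
    then have "w \<in> X" "\<not> (AE x in lborel. w x = 0)"
      using u' Sobolev_iff[OF w] nonzero[OF w] by (auto simp: magnetic_Sobolev_nonzero_def)
    then show ?thesis using min Q[OF rep v(1)] Q[OF w] by (simp add: mult_left_mono)
  qed
  then have "tau (\<lambda>x. A *v x) s m \<alpha> p = magnetic_quotient (\<lambda>x. A *v x) s m \<alpha> p u"
    unfolding tau_def using u by (intro cInf_eq_minimum) auto
  then show ?thesis using u by (intro bexI[of _ u]) auto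
qed

end
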